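(* Let $K$ be a field of characteristic zero. For any integer $n\ge 3$, there is an injective group homomorphism $$\mathrm{SAut}_0^{<n}\,\mathbb{A}^2_K\longrightarrow \mathrm{SL}\bigl(1+\mathrm{lcm}(1,2,\dots,n),\,K(t)\bigr).$$ In particular, any finitely generated subgroup of $\mathrm{SAut}_0\,\mathbb{A}^2_K$ is linear over $K(t)$ (i.e. embeds in $\mathrm{GL}(m,K(t))$ for some integer $m\ge1$).
   Context: $\mathrm{Aut}\,\mathbb{A}^2_K$ is the group of polynomial automorphisms of the affine plane over $K$ (pairs of polynomials in $K[x,y]$ invertible under composition). $\mathrm{SAut}_0\,\mathbb{A}^2_K$ is the subgroup of those $\phi$ with $\phi(\mathbf 0)=\mathbf 0$ and $\det\mathrm d\phi=1$. For $n\geq 3$, $\mathrm{SAut}_0^{<n}\,\mathbb{A}^2_K$ is the subgroup of $\mathrm{SAut}_0\,\mathbb{A}^2_K$ generated by all $\phi\in\mathrm{SAut}_0\,\mathbb{A}^2_K$ of degree $<n$, where the degree of $\phi=(f,g)$ is $\max(\deg f,\deg g)$. $K(t)$ is the field of rational functions in one variable. *)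

theory Defs
  imports
    "HOL-Algebra.Generated_Groups"
    "HOL-Computational_Algebra.Fraction_Field"
    "Jordan_Normal_Form.Determinant"
begin

text \<open>
  A polynomial in \<open>K[x,y]\<close> is an element of \<open>K[x][y]\<close>: the outer variable is \<open>y\<close>, so the
  coefficient of \<open>x\<^sup>i y\<^sup>j\<close> in \<open>p\<close> is \<open>coeff (coeff p j) i\<close>.
\<close>

type_synonym 'a bipoly = "'a poly poly"

definition varX :: "'a::comm_ring_1 bipoly" where
  "varX = [:[:0, 1:]:]"

definition varY :: "'a::comm_ring_1 bipoly" where
  "varY = [:0, 1:]"

text \<open>The inserted \<open>0\<close> only fixes the degree of the zero polynomial.\<close>

definition total_degree :: "'a::comm_ring_1 bipoly \<Rightarrow> nat" where
  "total_degree p = Max (insert 0 {i + j | i j. coeff (coeff p j) i \<noteq> 0})"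

definition eval_origin :: "'a::comm_ring_1 bipoly \<Rightarrow> 'a" where
  "eval_origin p = poly (poly p 0) 0"

definition diffX :: "'a::field bipoly \<Rightarrow> 'a bipoly" where
  "diffX p = map_poly pderiv p"

definition diffY :: "'a::field bipoly \<Rightarrow> 'a bipoly" where
  "diffY p = pderiv p"

text \<open>\<open>bisubst p (f, g)\<close> is \<open>p(f, g)\<close>.\<close>

definition bisubst :: "'a::comm_ring_1 bipoly \<Rightarrow> 'a bipoly \<times> 'a bipoly \<Rightarrow> 'a bipoly" where
  "bisubst p \<phi> =
     poly (map_poly (\<lambda>c. poly (map_poly (\<lambda>a. [:[:a:]:]) c) (fst \<phi>)) p) (snd \<phi>)"

definition end_plane :: "('a::comm_ring_1 bipoly \<times> 'a bipoly) monoid" where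
  "end_plane = \<lparr>carrier = UNIV,
     monoid.mult = (\<lambda>\<phi> \<psi>. (bisubst (fst \<phi>) \<psi>, bisubst (snd \<phi>) \<psi>)),
     one = (varX, varY)\<rparr>"

definition aut_plane :: "('a::comm_ring_1 bipoly \<times> 'a bipoly) monoid" where
  "aut_plane = units_of end_plane"

definition map_degree :: "'a::comm_ring_1 bipoly \<times> 'a bipoly \<Rightarrow> nat" where
  "map_degree \<phi> = max (total_degree (fst \<phi>)) (total_degree (snd \<phi>))"

definition jacobian :: "'a::field bipoly \<times> 'a bipoly \<Rightarrow> 'a bipoly" where
  "jacobian \<phi> = diffX (fst \<phi>) * diffY (snd \<phi>) - diffY (fst \<phi>) * diffX (snd \<phi>)"

definition saut0 :: "('a::field bipoly \<times> 'a bipoly) monoid" where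
  "saut0 = aut_plane\<lparr>carrier := {\<phi> \<in> carrier aut_plane.
     eval_origin (fst \<phi>) = 0 \<and> eval_origin (snd \<phi>) = 0 \<and> jacobian \<phi> = 1}\<rparr>"

definition saut0_less :: "nat \<Rightarrow> ('a::field bipoly \<times> 'a bipoly) monoid" where
  "saut0_less n =
     saut0\<lparr>carrier := generate saut0 {\<phi> \<in> carrier saut0. map_degree \<phi> < n}\<rparr>"

definition general_linear :: "nat \<Rightarrow> 'a::comm_ring_1 mat monoid" where
  "general_linear n = units_of (ring_mat TYPE('a) n ())"

definition special_linear :: "nat \<Rightarrow> 'a::comm_ring_1 mat monoid" where
  "special_linear n = (general_linear n)\<lparr>carrier := {A \<in> carrier (general_linear n). det A = 1}\<rparr>"


context comm_ring_hom
begin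

lemma eval_map_pCons: "poly (map_poly hom (pCons a p)) x = hom a + x * poly (map_poly hom p) x"
  by (simp add: map_poly_pCons)

lemma eval_map_add:
  "poly (map_poly hom (p + q)) x = poly (map_poly hom p) x + poly (map_poly hom q) x"
  by (induction p q rule: poly_induct2) (simp_all add: eval_map_pCons hom_add algebra_simps)

lemma eval_map_smult: "poly (map_poly hom (smult a p)) x = hom a * poly (map_poly hom p) x"
  by (induction p) (simp_all add: eval_map_pCons hom_mult algebra_simps)

lemma eval_map_mult:
  "poly (map_poly hom (p * q)) x = poly (map_poly hom p) x * poly (map_poly hom q) x"
  by (induction p)
     (simp_all add: eval_map_pCons eval_map_add eval_map_smult algebra_simps del: map_poly_pCons)

lemma eval_map_hom: "comm_ring_hom (\<lambda>p. poly (map_poly hom p) x)"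
  by unfold_locales (simp_all add: eval_map_add eval_map_mult)

end

lemma const_hom: "comm_ring_hom (\<lambda>a::'a::comm_ring_1. [:[:a:]:])"
  by unfold_locales (auto simp: one_pCons)

lemma bisubst_inner_hom:
  "comm_ring_hom (\<lambda>c. poly (map_poly (\<lambda>a::'a::comm_ring_1. [:[:a:]:]) c) f)"
  by (rule comm_ring_hom.eval_map_hom[OF const_hom])

lemma bisubst_hom: "comm_ring_hom (\<lambda>p. bisubst p \<phi>)"
  unfolding bisubst_def by (rule comm_ring_hom.eval_map_hom[OF bisubst_inner_hom])

lemma bisubst_const [simp]: "bisubst [:[:a:]:] \<phi> = [:[:a:]:]"
  by (simp add: bisubst_def map_poly_pCons)

lemma bisubst_zero [simp]: "bisubst 0 \<phi> = 0"
  by (simp add: bisubst_def)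

lemma bisubst_varX [simp]: "bisubst varX \<phi> = fst \<phi>"
  by (simp add: bisubst_def varX_def map_poly_pCons flip: one_pCons)

lemma bisubst_varY [simp]: "bisubst varY \<phi> = snd \<phi>"
  by (simp add: bisubst_def varY_def map_poly_pCons flip: one_pCons)

lemma bipoly_induct [case_names const varX varY add mult]:
  fixes p :: "'a::comm_ring_1 bipoly"
  assumes c: "\<And>a. P [:[:a:]:]" and X: "P varX" and Y: "P varY"
    and add: "\<And>p q. P p \<Longrightarrow> P q \<Longrightarrow> P (p + q)" and mult: "\<And>p q. P p \<Longrightarrow> P q \<Longrightarrow> P (p * q)"
  shows "P p"
proof -
  have inner: "P [:c:]" for c
  proof (induction c)
    case 0
    then show ?case using c[of 0] by simp
  next
    case (pCons a c)
    have "[:pCons a c:] = [:[:a:]:] + varX * [:c:]"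
      by (simp add: varX_def)
    then show ?case using add mult c X pCons.IH by metis
  qed
  show ?thesis
  proof (induction p)
    case 0
    then show ?case using c[of 0] by simp
  next
    case (pCons a p)
    have "pCons a p = [:a:] + varY * p"
      by (simp add: varY_def)
    then show ?case using add mult inner Y pCons.IH by metis
  qed
qed

lemma bisubst_add: "bisubst (p + q) \<phi> = bisubst p \<phi> + bisubst q \<phi>"
  and bisubst_mult: "bisubst (p * q) \<phi> = bisubst p \<phi> * bisubst q \<phi>"
  and bisubst_diff: "bisubst (p - q) \<phi> = bisubst p \<phi> - bisubst q \<phi>"
  and bisubst_one [simp]: "bisubst 1 \<phi> = 1"
proof -
  interpret comm_ring_hom "\<lambda>p. bisubst p \<phi>" by (rule bisubst_hom)
  show "bisubst (p + q) \<phi> = bisubst p \<phi> + bisubst q \<phi>" by (rule hom_add)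
  show "bisubst (p * q) \<phi> = bisubst p \<phi> * bisubst q \<phi>" by (rule hom_mult)
  show "bisubst (p - q) \<phi> = bisubst p \<phi> - bisubst q \<phi>"
    using hom_add[of "p - q" q] by (simp add: algebra_simps)
  show "bisubst 1 \<phi> = 1" by (rule hom_one)
qed

lemma bisubst_id [simp]: "bisubst p (varX, varY) = p"
  by (induction p rule: bipoly_induct) (simp_all add: bisubst_add bisubst_mult)

lemma bisubst_assoc:
  "bisubst (bisubst p \<phi>) \<psi> = bisubst p (bisubst (fst \<phi>) \<psi>, bisubst (snd \<phi>) \<psi>)"
  by (induction p rule: bipoly_induct) (simp_all add: bisubst_add bisubst_mult)

lemma end_plane_simps [simp]:
  "carrier end_plane = UNIV"
  "\<phi> \<otimes>\<^bsub>end_plane\<^esub> \<psi> = (bisubst (fst \<phi>) \<psi>, bisubst (snd \<phi>) \<psi>)"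
  "\<one>\<^bsub>end_plane\<^esub> = (varX, varY)"
  by (simp_all add: end_plane_def)

lemma monoid_end_plane: "monoid end_plane"
  by unfold_locales (simp_all add: bisubst_assoc)

lemma group_aut_plane: "group aut_plane"
  unfolding aut_plane_def by (rule monoid.units_group[OF monoid_end_plane])

lemma aut_plane_simps [simp]:
  "\<phi> \<otimes>\<^bsub>aut_plane\<^esub> \<psi> = (bisubst (fst \<phi>) \<psi>, bisubst (snd \<phi>) \<psi>)"
  "\<one>\<^bsub>aut_plane\<^esub> = (varX, varY)"
  by (simp_all add: aut_plane_def units_of_def)

lemma eval_origin_simps [simp]:
  "eval_origin [:[:a:]:] = a" "eval_origin varX = 0" "eval_origin varY = 0"
  "eval_origin (p + q) = eval_origin p + eval_origin q"
  "eval_origin (p * q) = eval_origin p * eval_origin q"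
  by (simp_all add: eval_origin_def varX_def varY_def)

lemma eval_origin_bisubst:
  assumes "eval_origin (fst \<phi>) = 0" "eval_origin (snd \<phi>) = 0"
  shows "eval_origin (bisubst p \<phi>) = eval_origin p"
  by (induction p rule: bipoly_induct) (simp_all add: assms bisubst_add bisubst_mult)

lemma diffX_pCons: "diffX (pCons a p) = pCons (pderiv a) (diffX p)"
  by (simp add: diffX_def map_poly_pCons)

lemma diffX_add: "diffX (p + q) = diffX p + diffX q"
  by (rule poly_eqI) (simp add: diffX_def coeff_map_poly pderiv_add)

lemma diffX_smult: "diffX (smult c p) = smult (pderiv c) p + smult c (diffX p)"
  by (rule poly_eqI) (simp add: diffX_def coeff_map_poly pderiv_mult algebra_simps)

lemma diffX_mult: "diffX (p * q) = diffX p * q + p * diffX q"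
proof (induction p)
  case 0
  then show ?case by (simp add: diffX_def)
next
  case (pCons a p)
  then show ?case
    by (simp add: diffX_add diffX_smult diffX_pCons algebra_simps)
qed

lemma diffX_simps [simp]:
  "diffX [:[:a:]:] = 0" "diffX varX = 1" "diffX varY = 0"
  by (simp_all add: diffX_def varX_def varY_def map_poly_pCons pderiv_pCons one_pCons)

lemma diffY_simps [simp]:
  "diffY [:[:a:]:] = 0" "diffY varX = 0" "diffY varY = 1"
  by (simp_all add: diffY_def varX_def varY_def pderiv_pCons flip: one_pCons)

lemma diffY_add: "diffY (p + q) = diffY p + diffY q"
  and diffY_mult: "diffY (p * q) = diffY p * q + p * diffY q"
  by (simp_all add: diffY_def pderiv_add pderiv_mult)

lemma diffX_bisubst:
  "diffX (bisubst p \<phi>) =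
     bisubst (diffX p) \<phi> * diffX (fst \<phi>) + bisubst (diffY p) \<phi> * diffX (snd \<phi>)"
  by (induction p rule: bipoly_induct)
     (simp_all add: bisubst_add bisubst_mult diffX_add diffX_mult diffY_add diffY_mult algebra_simps)

lemma diffY_bisubst:
  "diffY (bisubst p \<phi>) =
     bisubst (diffX p) \<phi> * diffY (fst \<phi>) + bisubst (diffY p) \<phi> * diffY (snd \<phi>)"
  by (induction p rule: bipoly_induct)
     (simp_all add: bisubst_add bisubst_mult diffX_add diffX_mult diffY_add diffY_mult algebra_simps)

lemma jacobian_comp:
  "jacobian (bisubst (fst \<phi>) \<psi>, bisubst (snd \<phi>) \<psi>) = bisubst (jacobian \<phi>) \<psi> * jacobian \<psi>"
  by (simp add: jacobian_def diffX_bisubst diffY_bisubst bisubst_diff bisubst_mult algebra_simps)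

lemma subgroup_saut0: "subgroup (carrier saut0) aut_plane"
proof -
  interpret group aut_plane by (rule group_aut_plane)
  show ?thesis
  proof (rule subgroupI)
    show "carrier saut0 \<subseteq> carrier aut_plane" by (auto simp: saut0_def)
    have "\<one>\<^bsub>aut_plane\<^esub> \<in> carrier saut0"
      using one_closed by (simp add: saut0_def jacobian_def)
    then show "carrier saut0 \<noteq> {}" by blast
  next
    fix \<phi> :: "'a bipoly \<times> 'a bipoly"
    assume \<phi>: "\<phi> \<in> carrier saut0"
    let ?\<psi> = "inv\<^bsub>aut_plane\<^esub> \<phi>"
    have in_aut: "\<phi> \<in> carrier aut_plane" using \<phi> by (simp add: saut0_def)
    have left: "(bisubst (fst ?\<psi>) \<phi>, bisubst (snd ?\<psi>) \<phi>) = (varX, varY)"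
      using l_inv[OF in_aut] by simp
    have right: "(bisubst (fst \<phi>) ?\<psi>, bisubst (snd \<phi>) ?\<psi>) = (varX, varY)"
      using r_inv[OF in_aut] by simp
    have "eval_origin (fst ?\<psi>) = 0" "eval_origin (snd ?\<psi>) = 0"
      using left \<phi> eval_origin_bisubst[of \<phi> "fst ?\<psi>"] eval_origin_bisubst[of \<phi> "snd ?\<psi>"]
      by (simp_all add: saut0_def)
    moreover have "jacobian ?\<psi> = 1"
      using jacobian_comp[of \<phi> ?\<psi>] right \<phi> by (simp add: saut0_def) (simp add: jacobian_def)
    ultimately show "?\<psi> \<in> carrier saut0"
      using inv_closed[OF in_aut] by (simp add: saut0_def)
  next
    fix \<phi> \<psi> :: "'a bipoly \<times> 'a bipoly"
    assume "\<phi> \<in> carrier saut0" "\<psi> \<in> carrier saut0"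
    then show "\<phi> \<otimes>\<^bsub>aut_plane\<^esub> \<psi> \<in> carrier saut0"
      using m_closed[of \<phi> \<psi>]
      by (simp add: saut0_def eval_origin_bisubst jacobian_comp)
  qed
qed

lemma group_saut0: "group saut0"
  using group.subgroup_imp_group[OF group_aut_plane subgroup_saut0] by (simp add: saut0_def)

lemma group_saut0_less: "group (saut0_less n)"
  unfolding saut0_less_def
  by (intro group.subgroup_imp_group group.generate_is_subgroup group_saut0) auto

lemma group_general_linear: "group (general_linear n)"
  unfolding general_linear_def by (rule monoid.units_group) (rule ring.is_monoid[OF ring_mat])

lemma group_special_linear: "group (special_linear n :: 'a::comm_ring_1 mat monoid)"
proof -
  interpret group "general_linear n :: 'a mat monoid" by (rule group_general_linear)
  have sub: "carrier (general_linear n :: 'a mat monoid) \<subseteq> carrier_mat n n"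
    by (auto simp: general_linear_def units_of_def Units_def ring_mat_simps)
  have mult: "A \<otimes>\<^bsub>general_linear n\<^esub> B = A * B" for A B :: "'a mat"
    by (simp add: general_linear_def units_of_def ring_mat_simps)
  have one: "\<one>\<^bsub>general_linear n\<^esub> = (1\<^sub>m n :: 'a mat)"
    by (simp add: general_linear_def units_of_def ring_mat_simps)
  have "subgroup {A \<in> carrier (general_linear n). det A = 1} (general_linear n :: 'a mat monoid)"
  proof (rule subgroupI)
    show "{A \<in> carrier (general_linear n :: 'a mat monoid). det A = 1} \<noteq> {}"
      using one_closed by (auto simp: one intro!: exI[of _ "1\<^sub>m n"])
  next
    fix A :: "'a mat"
    assume A: "A \<in> {A \<in> carrier (general_linear n). det A = 1}"
    let ?B = "inv\<^bsub>general_linear n\<^esub> A"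
    have B: "?B \<in> carrier (general_linear n)" using A by simp
    have "det (?B * A) = 1" using A l_inv[of A] by (simp add: mult one)
    then have "det ?B = 1" using A B sub det_mult[of ?B n A] by auto
    then show "?B \<in> {A \<in> carrier (general_linear n). det A = 1}" using B by simp
  next
    fix A B :: "'a mat"
    assume "A \<in> {A \<in> carrier (general_linear n). det A = 1}"
      and "B \<in> {A \<in> carrier (general_linear n). det A = 1}"
    then show "A \<otimes>\<^bsub>general_linear n\<^esub> B \<in> {A \<in> carrier (general_linear n). det A = 1}"
      using sub det_mult[of A n B] m_closed[of A B] by (auto simp: mult)
  qed auto
  then show ?thesis
    unfolding special_linear_def by (rule subgroup_imp_group)
qed

lemma finite_exponents: "finite {i + j | i j. coeff (coeff p j) i \<noteq> 0}"
proof (rule finite_subset)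
  let ?I = "\<Union>j\<le>degree p. {..degree (coeff p j)} \<times> {j}"
  show "{i + j | i j. coeff (coeff p j) i \<noteq> 0} \<subseteq> (\<lambda>(i, j). i + j) ` ?I"
  proof
    fix d assume "d \<in> {i + j | i j. coeff (coeff p j) i \<noteq> 0}"
    then obtain i j where d: "d = i + j" and nz: "coeff (coeff p j) i \<noteq> 0" by blast
    have "i \<le> degree (coeff p j)" using nz by (rule le_degree)
    moreover have "j \<le> degree p" using nz by (intro le_degree) auto
    ultimately show "d \<in> (\<lambda>(i, j). i + j) ` ?I" using d by (auto intro!: image_eqI[of _ _ "(i, j)"])
  qed
qed auto

end

theory Submission
  imports Defs "HOL-Number_Theory.Cong"
begin

text \<open>
  Every origin-preserving automorphism of Jacobian one is a product of shears
  \<open>\<tau>\<^bsub>v,f\<^esub>(u) = u + f(\<langle>v, u\<rangle>) v\<close>, and apart from the linear ones these generate a free product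
  with one factor for each line \<open>K v\<close>, on which \<open>SL(2, K)\<close> acts by permuting the lines. Jung's
  theorem is obtained from degree estimates for a pair \<open>(f, g)\<close> of Jacobian one: if
  \<open>\<Gamma>(f, g) = x\<close>, then each application of \<open>y \<partial>\<^sub>y\<close> to \<open>\<Gamma>\<close> raises the degree of \<open>\<Gamma>(f, g)\<close> by at most
  \<open>deg f + deg g - 2\<close>, and this forces one of the degrees of \<open>f\<close> and \<open>g\<close> to divide the other.

  Let \<open>lcm(1, \<dots>, n) = 2 m\<close>. On the sum of the binary forms of degree \<open>m\<close> and \<open>m - 1\<close>, of dimension
  \<open>2 m + 1\<close>, each \<open>v\<close> gives an operator \<open>s\<^sub>v\<close> of \<open>osp(1|2)\<close>, linear and \<open>SL(2)\<close>-equivariant in \<open>v\<close>,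
  with \<open>s\<^sub>v\<^bsup>2m+1\<^esup> = 0\<close>. The shear of \<open>f = \<Sum> a\<^sub>k T\<^sup>k\<close> is sent to \<open>exp(\<Sum> a\<^sub>k t\<^bsup>w(k)\<^esup> s\<^sub>v\<^bsup>k+1\<^esup>)\<close> with \<open>w(1) = 0\<close>.
  Since \<open>deg f + 1\<close> divides \<open>2 m\<close>, the leading coefficient in \<open>t\<close> is a multiple of the rank one
  operator \<open>s\<^sub>v\<^bsup>2m\<^esup>\<close>, and a product of such operators with consecutively independent vectors does
  not vanish; hence the representation is faithful.
\<close>

text \<open>Replacing \<open>v\<close> by \<open>c v\<close> multiplies the coefficient of
  \<open>T^k\<close> by \<open>c^(k+1)\<close>, so an equivariant map must send it to something of
  degree \<open>k+1\<close> in \<open>v\<close>. The root vectors of sl(2) have degree 2 in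
  \<open>v\<close> and their powers cover only odd \<open>k\<close>; even \<open>k\<close> requires
  a square root \<open>s_v\<close> of the root vector, which is what the odd part of the
  superalgebra provides. Linear shears have to act through SL(2) alone, free of \<open>t\<close>;
  hence w(1) = 0 and the separate treatment of the linear term of every polynomial.

  The obstacle is that the map is prescribed only on generators and must be shown well defined. No
  presentation of the group is used: automorphisms and operators are paired in a relation, and each
  pair is brought to a normal form in both coordinates at once, a reduced word of nonlinear shears
  with an element of SL(2) at its right end. If the plane map is the identity, growth of degrees
  makes the word empty; if the operator is the identity, growth in \<open>t\<close> does. What
  remains is the linear factor, where operators representing the identity matrix must be shown
  trivial.\<close>

lemma coeff_mult_le_degree:
  fixes p q :: "'a::comm_semiring_0 poly"
  assumes "degree p \<le> a" "degree q \<le> b"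
  shows "coeff (p * q) (a + b) = coeff p a * coeff q b"
proof -
  have "coeff p i * coeff q (a + b - i) = (if i = a then coeff p a * coeff q b else 0)"
    if "i \<le> a + b" for i
  proof (cases i a rule: linorder_cases)
    case less
    then have "coeff q (a + b - i) = 0" using assms by (intro coeff_eq_0) simp
    with less show ?thesis by simp
  next
    case greater
    then have "coeff p i = 0" using assms by (intro coeff_eq_0) simp
    with greater show ?thesis by simp
  qed simp
  then have "coeff (p * q) (a + b) = (\<Sum>i\<le>a + b. if i = a then coeff p a * coeff q b else 0)"
    by (simp add: coeff_mult)
  then show ?thesis by simp
qed

subsection \<open>Total degree via homogenization\<close>

text \<open>The monomial \<open>x^i y^j\<close> becomes \<open>x^i y^(i+j)\<close>: the outer degree
  is the total degree, the leading coefficient is the top form at \<open>y = 1\<close>, and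
  multiplicativity reduces questions about total degree to \<open>degree\<close> on
  \<open>poly\<close>.\<close>

definition homog :: "'a::comm_ring_1 bipoly \<Rightarrow> 'a bipoly" where
  "homog p = bisubst p (varX * varY, varY)"

definition tdeg :: "'a::comm_ring_1 bipoly \<Rightarrow> nat" where
  "tdeg p = degree (homog p)"

lemma coeff_varX_mult: "coeff (varX * p) j = pCons 0 (coeff p j)"
  by (simp add: varX_def)

lemma varY_mult: "varY * p = pCons 0 p"
  by (simp add: varY_def)

lemma homog_simps [simp]:
  "homog 0 = 0" "homog 1 = 1" "homog [:[:a:]:] = [:[:a:]:]"
  "homog varX = varX * varY" "homog varY = varY"
  by (simp_all add: homog_def)

lemma homog_add: "homog (p + q) = homog p + homog q"
  and homog_mult: "homog (p * q) = homog p * homog q"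
  and homog_diff: "homog (p - q) = homog p - homog q"
  by (simp_all add: homog_def bisubst_add bisubst_mult bisubst_diff)

lemma homog_power: "homog (p ^ k) = homog p ^ k"
  by (induction k) (simp_all add: homog_mult)

lemma homog_sum: "homog (\<Sum>i\<in>A. f i) = (\<Sum>i\<in>A. homog (f i))"
  by (induction A rule: infinite_finite_induct) (simp_all add: homog_add)

lemma coeff_homog_inner: "coeff (coeff (homog [:c:]) m) i = (if i = m then coeff c i else 0)"
proof (induction c arbitrary: m i)
  case 0
  then show ?case by simp
next
  case (pCons a c)
  have "homog ([:[:a:]:] + varX * [:c:]) = [:[:a:]:] + varX * (varY * homog [:c:])"
    by (simp only: homog_add homog_mult homog_simps mult.assoc)
  moreover have "[:pCons a c:] = [:[:a:]:] + varX * [:c:]" by (simp add: varX_def)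
  ultimately have "homog [:pCons a c:] = [:[:a:]:] + varX * (varY * homog [:c:])"
    by (simp only:)
  then show ?case
    by (cases m; cases i) (auto simp: coeff_varX_mult varY_mult pCons.IH)
qed

lemma coeff_homog:
  "coeff (coeff (homog p) m) i = (if i \<le> m then coeff (coeff p (m - i)) i else 0)"
proof (induction p arbitrary: m i)
  case 0
  then show ?case by simp
next
  case (pCons a p)
  have "pCons a p = [:a:] + varY * p" by (simp add: varY_def)
  then have "homog (pCons a p) = homog [:a:] + varY * homog p"
    by (simp add: homog_add homog_mult)
  then show ?case
    by (cases m) (auto simp: varY_mult pCons.IH coeff_homog_inner coeff_pCons Suc_diff_le
        split: nat.splits)
qed

lemma coeff_eq_coeff_homog: "coeff (coeff p j) i = coeff (coeff (homog p) (i + j)) i"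
  by (simp add: coeff_homog)

lemma homog_eq_0_iff [simp]: "homog p = 0 \<longleftrightarrow> p = 0"
proof
  assume "homog p = 0"
  then show "p = 0"
    by (intro poly_eqI) (simp add: coeff_eq_coeff_homog)
qed simp

lemma tdeg_le_total_degree: "tdeg p \<le> total_degree p"
proof (cases "p = 0")
  case True
  then show ?thesis by (simp add: tdeg_def)
next
  case False
  then have "coeff (homog p) (tdeg p) \<noteq> 0" by (simp add: tdeg_def)
  then obtain i where i: "coeff (coeff (homog p) (tdeg p)) i \<noteq> 0"
    by (auto simp: poly_eq_iff)
  then have "i \<le> tdeg p" "coeff (coeff p (tdeg p - i)) i \<noteq> 0"
    by (auto simp: coeff_homog split: if_splits)
  then have "tdeg p \<in> {i + j | i j. coeff (coeff p j) i \<noteq> 0}"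
    by (intro CollectI exI[of _ i] exI[of _ "tdeg p - i"]) simp
  then show ?thesis
    unfolding total_degree_def using finite_exponents[of p] by (intro Max_ge) auto
qed

lemma tdeg_simps [simp]:
  "tdeg 0 = 0" "tdeg 1 = 0" "tdeg [:[:a:]:] = 0"
  by (simp_all add: tdeg_def)

lemma tdeg_varX [simp]: "tdeg (varX :: 'a::comm_ring_1 bipoly) = 1"
  by (simp add: tdeg_def) (simp add: varX_def varY_def)

lemma tdeg_mult: "p \<noteq> 0 \<Longrightarrow> q \<noteq> 0 \<Longrightarrow> tdeg (p * q) = tdeg p + tdeg (q :: 'a::idom bipoly)"
  by (simp add: tdeg_def homog_mult degree_mult_eq)

lemma tdeg_mult_le: "tdeg (p * q) \<le> tdeg p + tdeg q"
  by (simp add: tdeg_def homog_mult degree_mult_le)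

lemma tdeg_power: "tdeg (p ^ k) = k * tdeg (p :: 'a::idom bipoly)"
  by (cases "p = 0") (simp_all add: tdeg_def homog_power degree_power_eq power_0_left)

lemma tdeg_add_le: "tdeg p \<le> d \<Longrightarrow> tdeg q \<le> d \<Longrightarrow> tdeg (p + q) \<le> d"
  and tdeg_diff_le: "tdeg p \<le> d \<Longrightarrow> tdeg q \<le> d \<Longrightarrow> tdeg (p - q) \<le> d"
  by (simp_all add: tdeg_def homog_add homog_diff degree_add_le degree_diff_le)

lemma tdeg_le_1_imp_linear:
  assumes "tdeg p \<le> 1" "eval_origin p = 0"
  shows "\<exists>\<alpha> \<beta>. p = [:[:\<alpha>:]:] * varX + [:[:\<beta>:]:] * varY"
proof -
  have 0: "coeff (coeff p j) i = 0" if "i + j > 1" for i j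
    using assms(1) that coeff_eq_0[of "homog p" "i + j"]
    by (simp add: coeff_eq_coeff_homog tdeg_def)
  have 00: "coeff (coeff p 0) 0 = 0"
    using assms(2) by (simp add: eval_origin_def poly_0_coeff_0)
  have "coeff (coeff p j) i =
      coeff (coeff ([:[:coeff (coeff p 0) 1:]:] * varX + [:[:coeff (coeff p 1) 0:]:] * varY) j) i" for i j
    using 0[of i j] 00 by (cases i; cases j)
      (auto simp: varX_def varY_def coeff_pCons split: nat.splits)
  then show ?thesis by (metis poly_eqI)
qed

subsection \<open>Degree and Jacobian\<close>

lemma jacobian_homog: "jacobian (homog f, homog h) = homog (jacobian (f, h)) * varY"
proof -
  have "jacobian (varX * varY, varY :: 'a bipoly) = varY"
    by (simp add: jacobian_def diffX_mult diffY_mult)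
  then show ?thesis
    using jacobian_comp[of "(f, h)" "(varX * varY, varY)"] by (simp add: homog_def)
qed

lemma degree_diffX_le: "degree (diffX p) \<le> degree p"
  by (rule degree_le) (auto simp: diffX_def coeff_map_poly coeff_eq_0)

lemma degree_diffY: "degree (diffY (p :: 'a::field_char_0 bipoly)) = degree p - 1"
  unfolding diffY_def by (rule degree_pderiv)

text \<open>By \<open>jacobian_homog\<close> the Jacobian of the homogenized pair is that of
  \<open>(f, h)\<close>, homogenized, times \<open>varY\<close>, while each of its two products
  contains one \<open>diffY\<close>, which costs an outer degree. Together this gives the 2.\<close>

lemma tdeg_jacobian:
  fixes f h :: "'a::field_char_0 bipoly"
  assumes "jacobian (f, h) \<noteq> 0"
  shows "tdeg (jacobian (f, h)) + 2 \<le> tdeg f + tdeg h"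
proof -
  let ?F = "homog f" and ?H = "homog h"
  have Y0: "diffY p = 0" if "degree p = 0" for p :: "'a bipoly"
    using that by (simp add: diffY_def pderiv_eq_0_iff)
  have 1: "degree (diffX ?F * diffY ?H) \<le> tdeg f + tdeg h - 1"
  proof (cases "tdeg h = 0")
    case True
    then show ?thesis using Y0 by (simp add: tdeg_def)
  next
    case False
    have "degree (diffX ?F * diffY ?H) \<le> degree ?F + (degree ?H - 1)"
      using degree_mult_le[of "diffX ?F" "diffY ?H"] degree_diffX_le[of ?F] degree_diffY[of ?H]
      by linarith
    then show ?thesis using False by (simp add: tdeg_def)
  qed
  have 2: "degree (diffY ?F * diffX ?H) \<le> tdeg f + tdeg h - 1"
  proof (cases "tdeg f = 0")
    case True
    then show ?thesis using Y0 by (simp add: tdeg_def)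
  next
    case False
    have "degree (diffY ?F * diffX ?H) \<le> (degree ?F - 1) + degree ?H"
      using degree_mult_le[of "diffY ?F" "diffX ?H"] degree_diffX_le[of ?H] degree_diffY[of ?F]
      by linarith
    then show ?thesis using False by (simp add: tdeg_def)
  qed
  have "degree (jacobian (?F, ?H)) \<le> tdeg f + tdeg h - 1"
    using 1 2 by (simp add: jacobian_def degree_diff_le)
  moreover have "degree (jacobian (?F, ?H)) = tdeg (jacobian (f, h)) + 1"
    using assms by (simp add: jacobian_homog tdeg_def mult.commute[of _ varY] varY_mult)
  moreover have "tdeg f + tdeg h \<noteq> 0"
  proof
    assume "tdeg f + tdeg h = 0"
    then have "jacobian (?F, ?H) = 0" using Y0 by (simp add: jacobian_def tdeg_def)
    then show False using calculation(2) by simp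
  qed
  ultimately show ?thesis by linarith
qed

text \<open>The homogenized Jacobian is just \<open>varY\<close>, so its coefficient at
  \<open>tdeg f + tdeg g - 1 > 1\<close> vanishes. The resulting relation says that
  \<open>F ^ tdeg g\<close> and \<open>G ^ tdeg f\<close> have the same logarithmic
  derivative.\<close>

lemma leading_forms_dependent:
  fixes f g :: "'a::field_char_0 bipoly"
  assumes "jacobian (f, g) = 1" "tdeg f + tdeg g > 2"
  defines "F \<equiv> lead_coeff (homog f)" and "G \<equiv> lead_coeff (homog g)"
  shows "of_nat (tdeg g) * (pderiv F * G) = of_nat (tdeg f) * (F * pderiv G)"
proof -
  let ?F = "homog f" and ?G = "homog g" and ?a = "tdeg f" and ?b = "tdeg g"
  have coeffX: "coeff (diffX p) i = pderiv (coeff p i)" for p :: "'a bipoly" and i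
    by (simp add: diffX_def coeff_map_poly)
  have 1: "coeff (diffX p * diffY q) (degree p + degree q - 1) =
      of_nat (degree q) * (pderiv (lead_coeff p) * lead_coeff q)" for p q :: "'a bipoly"
  proof (cases "degree q")
    case 0
    then show ?thesis by (simp add: diffY_def pderiv_eq_0_iff[THEN iffD2])
  next
    case (Suc d)
    then have "coeff (diffX p * diffY q) (degree p + d) = coeff (diffX p) (degree p) * coeff (diffY q) d"
      using degree_diffX_le[of p] degree_diffY[of q] by (intro coeff_mult_le_degree) auto
    then show ?thesis using Suc
      by (simp add: coeffX diffY_def coeff_pderiv algebra_simps of_nat_poly[symmetric])
  qed
  have "coeff (jacobian (?F, ?G)) (?a + ?b - 1) = 0"
    using assms(1,2) by (simp add: jacobian_homog) (simp add: varY_def coeff_pCons split: nat.splits)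
  then have "coeff (diffX ?F * diffY ?G) (?a + ?b - 1) = coeff (diffX ?G * diffY ?F) (?b + ?a - 1)"
    by (simp add: jacobian_def mult.commute add.commute)
  then show ?thesis
    unfolding F_def G_def tdeg_def 1 by (simp add: mult_ac)
qed

subsection \<open>Reduction of the degree of a Jacobian pair\<close>

definition support :: "'a::comm_ring_1 bipoly \<Rightarrow> (nat \<times> nat) set" where
  "support p = {(i, j). coeff (coeff p j) i \<noteq> 0}"

lemma finite_support: "finite (support p)"
proof (rule finite_subset)
  show "support p \<subseteq> (\<Union>j\<le>degree p. {..degree (coeff p j)} \<times> {j})"
    by (auto simp: support_def le_degree intro!: le_degree)
qed auto

lemma support_eq_empty_iff: "support p = {} \<longleftrightarrow> p = 0"
  by (auto simp: support_def poly_eq_iff)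

lemma bipoly_as_sum: "p = (\<Sum>(i, j)\<in>support p. [:[:coeff (coeff p j) i:]:] * varX ^ i * varY ^ j)"
proof (intro poly_eqI)
  fix l k
  have X: "varX ^ i = ([:monom 1 i:] :: 'a bipoly)" for i
    by (induction i) (simp_all add: varX_def monom_Suc one_pCons mult.commute)
  have Y: "varY ^ j = (monom 1 j :: 'a bipoly)" for j
    by (induction j) (simp_all add: varY_def monom_Suc)
  have m: "[:[:c:]:] * varX ^ i * varY ^ j = monom (monom c i) j" for c :: 'a and i j
    by (simp add: X Y smult_monom)
  have "coeff (coeff (\<Sum>(i, j)\<in>support p. [:[:coeff (coeff p j) i:]:] * varX ^ i * varY ^ j) l) k =
      (\<Sum>x\<in>support p. if x = (k, l) then coeff (coeff p l) k else 0)"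
    unfolding m by (simp add: coeff_sum case_prod_unfold) (intro sum.cong, auto)
  also have "\<dots> = coeff (coeff p l) k"
    using finite_support[of p] by (simp add: support_def)
  finally show "coeff (coeff p l) k =
    coeff (coeff (\<Sum>(i, j)\<in>support p. [:[:coeff (coeff p j) i:]:] * varX ^ i * varY ^ j) l) k" ..
qed

lemma bisubst_power: "bisubst (p ^ k) \<phi> = bisubst p \<phi> ^ k"
  by (induction k) (simp_all add: bisubst_mult)

lemma bisubst_sum: "bisubst (\<Sum>i\<in>A. f i) \<phi> = (\<Sum>i\<in>A. bisubst (f i) \<phi>)"
  by (induction A rule: infinite_finite_induct) (simp_all add: bisubst_add)

lemma bisubst_as_sum:
  "bisubst p \<phi> = (\<Sum>(i, j)\<in>support p. [:[:coeff (coeff p j) i:]:] * fst \<phi> ^ i * snd \<phi> ^ j)"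
  by (subst bipoly_as_sum)
    (simp add: bisubst_sum case_prod_unfold bisubst_mult bisubst_power del: mult_pCons_left)

text \<open>The unique monomial of largest weight contributes a top form that no other monomial can
  cancel.\<close>

lemma tdeg_bisubst_ge:
  fixes f g p :: "'a::idom bipoly"
  assumes "f \<noteq> 0" "g \<noteq> 0" and max: "(i0, j0) \<in> support p"
    and less: "\<And>i j. (i, j) \<in> support p \<Longrightarrow> (i, j) \<noteq> (i0, j0) \<Longrightarrow>
                 tdeg f * i + tdeg g * j < tdeg f * i0 + tdeg g * j0"
  shows "tdeg f * i0 + tdeg g * j0 \<le> tdeg (bisubst p (f, g))"
proof -
  define t where "t = (\<lambda>(i, j). [:[:coeff (coeff p j) i:]:] * f ^ i * g ^ j)"
  define w where "w = tdeg f * i0 + tdeg g * j0"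
  have t: "tdeg (t (i, j)) = tdeg f * i + tdeg g * j" "t (i, j) \<noteq> 0" if "(i, j) \<in> support p" for i j
    using that assms(1,2)
    by (simp_all add: t_def support_def tdeg_mult tdeg_power del: mult_pCons_left)
  have "bisubst p (f, g) = sum t (support p)"
    by (simp add: bisubst_as_sum t_def case_prod_unfold)
  then have "coeff (homog (bisubst p (f, g))) w = (\<Sum>x\<in>support p. coeff (homog (t x)) w)"
    by (simp add: homog_sum coeff_sum)
  also have "\<dots> = (\<Sum>x\<in>support p. if x = (i0, j0) then coeff (homog (t (i0, j0))) w else 0)"
  proof (intro sum.cong refl)
    fix x assume x: "x \<in> support p"
    show "coeff (homog (t x)) w = (if x = (i0, j0) then coeff (homog (t (i0, j0))) w else 0)"
    proof (cases "x = (i0, j0)")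
      case False
      obtain i j where ij: "x = (i, j)" by (cases x)
      then have "degree (homog (t x)) < w"
        using less[of i j] t(1)[of i j] x False by (simp add: w_def tdeg_def)
      then show ?thesis using False by (simp add: coeff_eq_0)
    qed simp
  qed
  also have "\<dots> = coeff (homog (t (i0, j0))) w"
    using max finite_support[of p] by simp
  also have "\<dots> \<noteq> 0"
    using t[OF max] by (metis homog_eq_0_iff leading_coeff_0_iff tdeg_def w_def)
  finally show ?thesis
    using le_degree by (simp add: w_def tdeg_def)
qed

text \<open>When the Jacobian of \<open>(f, g)\<close> is one, the derivation
  \<open>jacobian (f, -)\<close> acts on \<open>p(f, g)\<close> as \<open>diffY\<close> acts on
  \<open>p\<close>; thus \<open>tdeg_jacobian\<close> controls derivatives of the outer
  polynomial.\<close>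

lemma jacobian_bisubst_right:
  "jacobian (f, bisubst p (f, g)) = bisubst (diffY p) (f, g) * jacobian (f, g)"
  by (simp add: jacobian_def diffX_bisubst diffY_bisubst algebra_simps)

lemma coeff_varY_diffY: "coeff (coeff (varY * diffY p) j) i = of_nat j * coeff (coeff p j) i"
proof (cases j)
  case (Suc k)
  have "coeff (of_nat (Suc k) * q) i = of_nat (Suc k) * coeff q i" for q :: "'a poly"
    by (simp add: of_nat_poly del: of_nat_Suc)
  then show ?thesis using Suc by (simp add: varY_mult diffY_def coeff_pderiv del: of_nat_Suc)
qed (simp add: varY_mult)

text \<open>The operator \<open>y \<partial>\<^sub>y - l\<close> removes the monomials \<open>x\<^sup>i y\<^sup>l\<close>, while the Jacobian condition
  bounds by how much it can raise the degree after the substitution of \<open>(f, g)\<close>.\<close>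

lemma remove_rows:
  fixes f g p :: "'a::field_char_0 bipoly"
  assumes jac: "jacobian (f, g) = 1" and "finite S"
    and deg: "tdeg f + tdeg g \<ge> 2"
  shows "\<exists>q. (\<forall>i j. coeff (coeff q j) i = (\<Prod>l\<in>S. of_nat j - of_nat l) * coeff (coeff p j) i) \<and>
           tdeg (bisubst q (f, g)) \<le> tdeg (bisubst p (f, g)) + card S * (tdeg f + tdeg g - 2)"
  using \<open>finite S\<close>
proof (induction S rule: finite_induct)
  case empty
  then show ?case by auto
next
  case (insert l S)
  then obtain q where
    q: "\<And>i j. coeff (coeff q j) i = (\<Prod>l\<in>S. of_nat j - of_nat l) * coeff (coeff p j) i" and
    d: "tdeg (bisubst q (f, g)) \<le> tdeg (bisubst p (f, g)) + card S * (tdeg f + tdeg g - 2)"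
    by blast
  define q' where "q' = varY * diffY q - [:[:of_nat l:]:] * q"
  have coeff: "coeff (coeff q' j) i = (\<Prod>l\<in>insert l S. of_nat j - of_nat l) * coeff (coeff p j) i" for i j
    using insert(1,2) by (simp add: q'_def coeff_varY_diffY q algebra_simps)
  let ?u = "bisubst q (f, g)"
  have "bisubst q' (f, g) = g * jacobian (f, ?u) - [:[:of_nat l:]:] * ?u"
    by (simp add: q'_def bisubst_diff bisubst_mult jacobian_bisubst_right jac del: mult_pCons_left)
  moreover have "tdeg (g * jacobian (f, ?u)) \<le> tdeg ?u + (tdeg f + tdeg g - 2)"
  proof (cases "jacobian (f, ?u) = 0")
    case False
    then show ?thesis
      using tdeg_mult_le[of g "jacobian (f, ?u)"] tdeg_jacobian[OF False] by linarith
  qed simp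
  moreover have "tdeg ([:[:of_nat l:]:] * ?u) \<le> tdeg ?u + (tdeg f + tdeg g - 2)"
    using tdeg_mult_le[of "[:[:of_nat l:]:]" ?u] by (simp del: mult_pCons_left)
  ultimately have "tdeg (bisubst q' (f, g)) \<le> tdeg ?u + (tdeg f + tdeg g - 2)"
    by (simp add: tdeg_diff_le)
  then have "tdeg (bisubst q' (f, g)) \<le>
      tdeg (bisubst p (f, g)) + card (insert l S) * (tdeg f + tdeg g - 2)"
    using d insert(1,2) by simp
  then show ?case using coeff by blast
qed

lemma card_residue_class_le:
  fixes J :: "nat set"
  assumes "finite J" "J \<noteq> {}" "\<And>i j. i \<in> J \<Longrightarrow> j \<in> J \<Longrightarrow> i mod p = j mod p" "p > 0"
  shows "p * (card J - 1) \<le> Max J"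
proof -
  have "inj_on (\<lambda>j. j div p) J"
    using assms(3) by (intro inj_onI) (metis div_mult_mod_eq)
  moreover have "(\<lambda>j. j div p) ` J \<subseteq> {..Max J div p}"
    using assms(1) by (auto intro!: div_le_mono)
  ultimately have "card J \<le> Max J div p + 1"
    using card_inj_on_le[of "\<lambda>j. j div p" J "{..Max J div p}"] by simp
  then have "p * (card J - 1) \<le> p * (Max J div p)" by (intro mult_le_mono2) simp
  then show ?thesis using times_div_less_eq_dividend[of p "Max J"] by (meson le_trans)
qed

text \<open>The \<open>y\<close>-exponents of the monomials of \<open>\<Gamma>\<close> of maximal
  weight \<open>w\<close> agree modulo \<open>p\<close>; if there are \<open>L + 1\<close> of them,
  then \<open>w\<close> is at least \<open>tdeg g * (p * L)\<close>. Killing all but one of these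
  rows takes \<open>L\<close> derivations and leaves a monomial that cannot cancel, so
  \<open>w\<close> is at most \<open>1 + L * (tdeg f + tdeg g - 2)\<close>. For
  \<open>p, q \<ge> 2\<close> both bounds hold only if \<open>L = 0\<close> and
  \<open>w \<le> 1\<close>, which would make \<open>\<Gamma>\<close> constant.\<close>

lemma jacobian_pair_degrees:
  fixes f g \<Gamma> :: "'a::field_char_0 bipoly"
  assumes jac: "jacobian (f, g) = 1" and \<Gamma>: "bisubst \<Gamma> (f, g) = varX"
    and pq: "tdeg f = p * d" "tdeg g = q * d" "coprime p q"
    and pos: "tdeg f > 0" "tdeg g > 0"
  shows "p = 1 \<or> q = 1"
proof (rule ccontr)
  assume "\<not> (p = 1 \<or> q = 1)"
  moreover have "p > 0" "q > 0" "d > 0" using pos pq by auto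
  ultimately have 2: "p \<ge> 2" "q \<ge> 2" by auto
  have "p \<noteq> q" using pq(3) 2 by auto
  \<comment> \<open>Distinct \<open>p, q \<ge> 2\<close> satisfy
    \<open>(p - 1) * (q - 1) \<ge> 2\<close>.\<close>
  have pq_ge: "p * q \<ge> p + q + 1"
  proof -
    obtain p' q' where "p = p' + 2" "q = q' + 2" using 2 by (metis le_add_diff_inverse2)
    then show ?thesis using \<open>p \<noteq> q\<close> by (cases p'; cases q') auto
  qed
  have fg: "f \<noteq> 0" "g \<noteq> 0" using pos by auto
  have "\<Gamma> \<noteq> 0"
  proof
    assume "\<Gamma> = 0"
    then have "(varX :: 'a bipoly) = 0" using \<Gamma> by simp
    then show False by (simp add: varX_def)
  qed
  define wt where "wt = (\<lambda>(i, j). tdeg f * i + tdeg g * j)"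
  define w where "w = Max (wt ` support \<Gamma>)"
  define J where "J = {j. \<exists>i. (i, j) \<in> support \<Gamma> \<and> wt (i, j) = w}"
  have w_max: "wt x \<le> w" if "x \<in> support \<Gamma>" for x
    unfolding w_def using that finite_support[of \<Gamma>] by simp
  have "w \<in> wt ` support \<Gamma>"
    unfolding w_def using finite_support[of \<Gamma>] \<open>\<Gamma> \<noteq> 0\<close> support_eq_empty_iff[of \<Gamma>]
    by (intro Max_in) auto
  then obtain i0 j0 where ij0: "(i0, j0) \<in> support \<Gamma>" "wt (i0, j0) = w" by auto
  have J: "finite J" "j0 \<in> J"
    using finite_subset[of J "snd ` support \<Gamma>"] finite_support[of \<Gamma>] ij0
    by (force simp: J_def)+
  have mod: "j mod p = j' mod p" if jj: "j \<in> J" "j' \<in> J" for j j'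
  proof -
    obtain i i' where "wt (i, j) = w" "wt (i', j') = w" using jj by (auto simp: J_def)
    then have "d * (p * i + q * j) = d * (p * i' + q * j')"
      by (simp add: wt_def pq algebra_simps)
    then have "p * i + q * j = p * i' + q * j'" using \<open>d > 0\<close> by simp
    then have "(q * j) mod p = (q * j') mod p" by (metis mod_mult_self4)
    moreover have "coprime q p" using pq(3) coprime_commute by blast
    ultimately show ?thesis
      using cong_mult_lcancel_nat[of q p j j'] unfolding cong_def by blast
  qed
  define L where "L = card J - 1"
  have "p * L \<le> Max J"
    unfolding L_def using J(2) by (intro card_residue_class_le[OF J(1) _ mod \<open>p > 0\<close>]) blast+
  moreover have "Max J \<in> J" using J by (intro Max_in) auto
  then have "tdeg g * Max J \<le> w" by (auto simp: J_def wt_def)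
  ultimately have w_ge: "tdeg g * (p * L) \<le> w" by (meson mult_le_mono2 le_trans)
  obtain M where
    M: "\<And>i j. coeff (coeff M j) i = (\<Prod>l\<in>J - {j0}. of_nat j - of_nat l) * coeff (coeff \<Gamma> j) i" and
    deg_M: "tdeg (bisubst M (f, g)) \<le> 1 + card (J - {j0}) * (tdeg f + tdeg g - 2)"
    using remove_rows[OF jac, of "J - {j0}" \<Gamma>] J pos \<Gamma> by auto
  have supp_M: "support M = support \<Gamma> - {(i, j). j \<in> J - {j0}}"
    using J by (auto simp: support_def M)
  have "tdeg f * i0 + tdeg g * j0 \<le> tdeg (bisubst M (f, g))"
  proof (rule tdeg_bisubst_ge[OF fg])
    show "(i0, j0) \<in> support M" using ij0 by (simp add: supp_M)
    fix i j assume ij: "(i, j) \<in> support M" "(i, j) \<noteq> (i0, j0)"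
    then have "wt (i, j) \<le> w" using w_max by (auto simp: supp_M)
    moreover have "wt (i, j) \<noteq> w"
    proof
      assume "wt (i, j) = w"
      then have "j = j0" using ij by (auto simp: supp_M J_def)
      then show False using \<open>wt (i, j) = w\<close> ij0(2) ij(2) pos by (auto simp: wt_def)
    qed
    ultimately show "tdeg f * i + tdeg g * j < tdeg f * i0 + tdeg g * j0"
      using ij0(2) by (simp add: wt_def)
  qed
  then have "w \<le> 1 + L * (tdeg f + tdeg g - 2)"
    using deg_M ij0(2) J by (simp add: wt_def L_def)
  moreover have "L * (tdeg f + tdeg g - 2) + 2 * L = L * (p * d + q * d)"
  proof -
    have "p * d + q * d = (p * d + q * d - 2) + 2" using pos unfolding pq(1,2) by linarith
    then show ?thesis unfolding pq(1,2) by (metis distrib_left mult.commute)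
  qed
  moreover have "L * (p * d + q * d) + L * d \<le> tdeg g * (p * L)"
  proof -
    have "(p + q + 1) * (L * d) \<le> (p * q) * (L * d)" using pq_ge by (intro mult_le_mono1)
    then show ?thesis by (simp add: pq(2) algebra_simps)
  qed
  ultimately have "L * d + 2 * L \<le> 1" "w \<le> 1 + L * (tdeg f + tdeg g - 2)" using w_ge by linarith+
  then have "L = 0" by simp
  with \<open>w \<le> 1 + L * (tdeg f + tdeg g - 2)\<close> have "w \<le> 1" by simp
  have "support \<Gamma> \<subseteq> {(0, 0)}"
  proof
    fix x assume "x \<in> support \<Gamma>"
    then have "wt x \<le> 1" using w_max \<open>w \<le> 1\<close> by (meson le_trans)
    moreover have "tdeg f \<ge> 2" "tdeg g \<ge> 2" using 2 \<open>d > 0\<close> by (simp_all add: pq(1,2))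
        (metis One_nat_def Suc_leI mult_le_mono nat_mult_1_right)+
    then have "wt x \<ge> 2 * fst x + 2 * snd x"
      by (auto simp: wt_def case_prod_unfold intro!: add_mono mult_le_mono1)
    ultimately show "x \<in> {(0, 0)}" by (cases x) auto
  qed
  then have "support \<Gamma> = {(0, 0)}" using ij0(1) by auto
  then have "bisubst \<Gamma> (f, g) = [:[:coeff (coeff \<Gamma> 0) 0:]:]"
    by (simp add: bisubst_as_sum)
  then show False using \<Gamma> by (simp add: varX_def)
qed

text \<open>In characteristic zero the top coefficients of both sides force equal degrees.
  Subtracting from \<open>F\<close> the multiple of \<open>G\<close> with the same leading term
  preserves the relation but lowers the degree, so the difference must vanish.\<close>

lemma constant_ratio:
  fixes F G :: "'a::field_char_0 poly"
  assumes W: "pderiv F * G = F * pderiv G" and "F \<noteq> 0" "G \<noteq> 0"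
  shows "\<exists>c. F = smult c G"
proof -
  have deg_eq: "degree P = degree Q"
    if W: "pderiv P * Q = P * pderiv Q" and 0: "P \<noteq> 0" "Q \<noteq> 0" for P Q :: "'a poly"
  proof (rule ccontr)
    assume ne: "degree P \<noteq> degree Q"
    have "coeff (pderiv P * Q) (degree P + degree Q - 1) = of_nat (degree P) * (lead_coeff P * lead_coeff Q)"
      for P Q :: "'a poly"
    proof (cases "degree P")
      case 0
      then show ?thesis by (simp add: pderiv_eq_0_iff[THEN iffD2])
    next
      case (Suc d)
      then have "coeff (pderiv P * Q) (d + degree Q) = coeff (pderiv P) d * lead_coeff Q"
        by (intro coeff_mult_le_degree) (simp_all add: degree_pderiv)
      then show ?thesis using Suc by (simp add: coeff_pderiv algebra_simps)
    qed
    from this[of P Q] this[of Q P]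
    have "of_nat (degree P) * (lead_coeff P * lead_coeff Q) =
        of_nat (degree Q) * (lead_coeff Q * lead_coeff P)"
      using W by (simp only: mult.commute[of "pderiv Q" P] add.commute[of "degree Q"])
    then show False using ne 0 by (simp add: mult.commute)
  qed
  define c where "c = lead_coeff F / lead_coeff G"
  have "F - smult c G = 0"
  proof (rule ccontr)
    assume nz: "F - smult c G \<noteq> 0"
    have "pderiv (F - smult c G) * G = (F - smult c G) * pderiv G"
      using W by (simp add: pderiv_diff pderiv_smult algebra_simps)
    then have "degree (F - smult c G) = degree G" using nz assms(3) by (intro deg_eq)
    moreover have "coeff (F - smult c G) (degree G) = 0"
      using deg_eq[OF assms] assms(3) by (simp add: c_def)
    ultimately show False using nz by (metis leading_coeff_0_iff)
  qed
  then show ?thesis by auto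
qed

text \<open>For \<open>tdeg f = p * tdeg g\<close> the relation between the leading forms becomes a
  vanishing Wronskian of \<open>F\<close> and \<open>G ^ p\<close>, so \<open>F\<close> is a
  constant multiple of \<open>G ^ p\<close> and subtracting that multiple of \<open>g ^ p\<close>
  removes the top form of \<open>f\<close>.\<close>

lemma tdeg_reduction:
  fixes f g :: "'a::field_char_0 bipoly"
  assumes jac: "jacobian (f, g) = 1" and deg: "tdeg f = p * tdeg g" "tdeg g > 0" "p > 0"
    and "tdeg f + tdeg g > 2"
  shows "\<exists>c. tdeg (f - [:[:c:]:] * g ^ p) < tdeg f"
proof -
  define F where "F = lead_coeff (homog f)"
  define G where "G = lead_coeff (homog g)"
  have nz: "f \<noteq> 0" "g \<noteq> 0" using deg by auto
  then have FG: "F \<noteq> 0" "G \<noteq> 0" by (simp_all add: F_def G_def)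
  have "of_nat (tdeg g) * (pderiv F * G) = of_nat (tdeg g) * (of_nat p * (F * pderiv G))"
    using leading_forms_dependent[OF assms(1,5)] by (simp add: F_def G_def deg(1) algebra_simps)
  then have 1: "pderiv F * G = of_nat p * (F * pderiv G)" using deg(2) by simp
  obtain r where r: "p = Suc r" using deg(3) by (cases p) auto
  have "pderiv F * G ^ p = G ^ r * (pderiv F * G)" by (simp add: r)
  also have "\<dots> = F * (of_nat p * G ^ r * pderiv G)" by (simp add: 1)
  also have "\<dots> = F * pderiv (G ^ p)"
    by (simp add: r pderiv_power_Suc of_nat_poly mult_ac del: of_nat_Suc power_Suc)
  finally obtain c where c: "F = smult c (G ^ p)" using constant_ratio[of F "G ^ p"] FG by auto
  let ?h = "f - [:[:c:]:] * g ^ p"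
  have H: "homog ?h = homog f - [:[:c:]:] * homog g ^ p"
    by (simp add: homog_diff homog_mult homog_power del: mult_pCons_left)
  have degs: "degree (homog g ^ p) = degree (homog f)"
    using deg(1) nz by (simp add: tdeg_def degree_power_eq)
  have "coeff (homog g ^ p) (degree (homog f)) = G ^ p"
    unfolding degs[symmetric] by (simp add: G_def lead_coeff_power)
  then have "coeff (homog ?h) (degree (homog f)) = 0"
    using c unfolding H F_def by simp
  moreover have "degree (homog ?h) \<le> degree (homog f)"
    unfolding H using degs by (intro degree_diff_le) (auto intro: order.trans[OF degree_smult_le])
  moreover have "degree (homog f) > 0" using deg by (simp add: tdeg_def[symmetric])
  ultimately have "degree (homog ?h) < degree (homog f)"
    by (metis degree_0 leading_coeff_0_iff order_le_less)
  then show ?thesis by (auto simp: tdeg_def)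
qed

subsection \<open>Shears\<close>

definition cst :: "'a::comm_ring_1 \<Rightarrow> 'a bipoly" where
  "cst a = [:[:a:]:]"

lemma cst_hom: "comm_ring_hom (cst :: 'a::comm_ring_1 \<Rightarrow> 'a bipoly)"
  unfolding cst_def by (rule const_hom)

lemma cst_simps [simp]:
  "cst 0 = 0" "cst 1 = 1" "bisubst (cst a) \<phi> = cst a" "eval_origin (cst a) = a"
  "homog (cst a) = cst a" "tdeg (cst a) = 0" "diffX (cst b) = 0" "diffY (cst b) = 0"
  by (simp_all add: cst_def one_pCons[symmetric])

lemma cst_add: "cst (a + b) = cst a + cst b"
  and cst_mult: "cst (a * b) = cst a * cst b"
  and cst_diff: "cst (a - b) = cst a - cst b"
  and cst_uminus: "cst (- a) = - cst a"
  by (simp_all add: cst_def)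

lemma cst_eq_0_iff [simp]: "cst a = 0 \<longleftrightarrow> a = 0"
  by (simp add: cst_def)

definition at_poly :: "'a::comm_ring_1 poly \<Rightarrow> 'a bipoly \<Rightarrow> 'a bipoly" where
  "at_poly f p = poly (map_poly cst f) p"

lemma at_poly_add: "at_poly (f + g) p = at_poly f p + at_poly g p"
  and at_poly_smult: "at_poly (smult c f) p = cst c * at_poly f p"
  by (simp_all add: at_poly_def comm_ring_hom.eval_map_add[OF cst_hom]
      comm_ring_hom.eval_map_smult[OF cst_hom])

lemma at_poly_0 [simp]: "at_poly 0 p = 0"
  by (simp add: at_poly_def)

lemma at_poly_pCons: "at_poly (pCons a f) p = cst a + p * at_poly f p"
  by (simp add: at_poly_def map_poly_pCons)

lemma at_poly_monom: "at_poly (monom c k) p = cst c * p ^ k"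
  by (induction k) (simp_all add: monom_0 monom_Suc at_poly_pCons)

lemma at_poly_scale: "at_poly (pcompose f [:0, c:]) p = at_poly f (cst c * p)"
  by (induction f) (simp_all add: pcompose_pCons at_poly_add at_poly_pCons at_poly_smult algebra_simps)

lemma bisubst_at_poly: "bisubst (at_poly f p) \<psi> = at_poly f (bisubst p \<psi>)"
  by (induction f) (simp_all add: at_poly_pCons bisubst_add bisubst_mult)

lemma eval_origin_at_poly: "eval_origin (at_poly f p) = poly f (eval_origin p)"
proof (induction f)
  case 0
  then show ?case by (simp add: eval_origin_def)
qed (simp add: at_poly_pCons)

lemma tdeg_at_poly: "tdeg (at_poly f p) = degree f * tdeg (p :: 'a::idom bipoly)"
proof -
  have "homog (at_poly f p) = at_poly f (homog p)"
    by (simp add: homog_def bisubst_at_poly)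
  also have "\<dots> = pcompose (map_poly (\<lambda>a. [:a:]) f) (homog p)"
    by (induction f) (simp_all add: at_poly_pCons map_poly_pCons pcompose_pCons cst_def)
  finally show ?thesis by (simp add: tdeg_def degree_map_poly degree_pcompose)
qed

definition vpair :: "'a::comm_ring_1 \<times> 'a \<Rightarrow> 'a \<times> 'a \<Rightarrow> 'a" where
  "vpair v w = fst v * snd w - snd v * fst w"

definition pairing :: "'a::comm_ring_1 \<times> 'a \<Rightarrow> 'a bipoly \<times> 'a bipoly \<Rightarrow> 'a bipoly" where
  "pairing v \<phi> = cst (fst v) * snd \<phi> - cst (snd v) * fst \<phi>"

text \<open>The shear is applied after \<open>\<phi>\<close>; a word of shears is then an iterated
  application, and composition with a fixed map on the right commutes with it
  (\<open>shear_comp\<close>).\<close>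

definition shear :: "'a::comm_ring_1 \<times> 'a \<Rightarrow> 'a poly \<Rightarrow> 'a bipoly \<times> 'a bipoly \<Rightarrow> 'a bipoly \<times> 'a bipoly" where
  "shear v f \<phi> = (fst \<phi> + cst (fst v) * at_poly f (pairing v \<phi>),
                  snd \<phi> + cst (snd v) * at_poly f (pairing v \<phi>))"

definition comp_plane :: "'a::comm_ring_1 bipoly \<times> 'a bipoly \<Rightarrow> 'a bipoly \<times> 'a bipoly \<Rightarrow> 'a bipoly \<times> 'a bipoly" where
  "comp_plane \<phi> \<psi> = (bisubst (fst \<phi>) \<psi>, bisubst (snd \<phi>) \<psi>)"

abbreviation id_plane :: "'a::comm_ring_1 bipoly \<times> 'a bipoly" where
  "id_plane \<equiv> (varX, varY)"

lemma comp_plane_assoc: "comp_plane (comp_plane \<phi> \<psi>) \<chi> = comp_plane \<phi> (comp_plane \<psi> \<chi>)"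
  by (simp add: comp_plane_def bisubst_assoc)

lemma comp_plane_id [simp]: "comp_plane id_plane \<phi> = \<phi>" "comp_plane \<phi> id_plane = \<phi>"
  by (simp_all add: comp_plane_def)

lemma pairing_shear: "pairing w (shear v f \<phi>) = pairing w \<phi> + cst (vpair w v) * at_poly f (pairing v \<phi>)"
  by (simp add: pairing_def shear_def vpair_def cst_diff cst_mult algebra_simps)

lemma vpair_self [simp]: "vpair v v = 0"
  by (simp add: vpair_def)

lemma shear_add: "shear v (f + g) \<phi> = shear v f (shear v g \<phi>)"
  by (simp add: shear_def[of v f] shear_def[of v "f + g"] pairing_shear)
    (simp add: shear_def at_poly_add algebra_simps)

lemma shear_0 [simp]: "shear v 0 \<phi> = \<phi>"
  by (simp add: shear_def)

text \<open>Lets parallel neighbours in a word be merged. The coefficient of degree \<open>k\<close>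
  picks up \<open>c^(k+1)\<close>: one factor from the vector itself and \<open>k\<close> from the
  pairing.\<close>

lemma shear_scale:
  "shear (c * fst v, c * snd v) f \<phi> = shear v (smult c (pcompose f [:0, c:])) \<phi>"
proof -
  have "pairing (c * fst v, c * snd v) \<phi> = cst c * pairing v \<phi>"
    by (simp add: pairing_def cst_mult algebra_simps)
  then show ?thesis
    by (simp add: shear_def at_poly_smult at_poly_scale cst_mult mult_ac)
qed

lemma shear_comp: "shear v f (comp_plane \<phi> \<psi>) = comp_plane (shear v f \<phi>) \<psi>"
  by (simp add: shear_def comp_plane_def pairing_def bisubst_add bisubst_mult bisubst_diff bisubst_at_poly)

lemma shear_conv_comp: "shear v f \<phi> = comp_plane (shear v f id_plane) \<phi>"
  by (metis comp_plane_id(1) shear_comp)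

lemma diff_at_poly:
  "diffX (at_poly f p) = at_poly (pderiv f) p * diffX p"
  "diffY (at_poly f p) = at_poly (pderiv f) p * diffY p"
  by (induction f)
    (simp_all add: at_poly_pCons diffX_add diffX_mult diffY_add diffY_mult pderiv_pCons at_poly_add algebra_simps,
      simp_all add: diffX_def diffY_def)

lemma jacobian_shear_id: "jacobian (shear v f id_plane) = 1"
proof -
  have d: "diffX (pairing v id_plane) = - cst (snd v)" "diffY (pairing v id_plane) = cst (fst v)"
    by (simp_all add: pairing_def diffX_def diffY_def cst_def varX_def varY_def pderiv_pCons
        map_poly_pCons pderiv_diff one_pCons)
  show ?thesis
    by (simp add: jacobian_def shear_def diffX_add diffY_add diffX_mult diffY_mult diff_at_poly d
        algebra_simps)
qed

lemma jacobian_shear: "jacobian (shear v f \<phi>) = jacobian \<phi>"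
  by (subst shear_conv_comp)
    (simp add: comp_plane_def jacobian_comp jacobian_shear_id)

lemma eval_origin_shear:
  assumes "coeff f 0 = 0" "eval_origin (fst \<phi>) = 0" "eval_origin (snd \<phi>) = 0"
  shows "eval_origin (fst (shear v f \<phi>)) = 0" "eval_origin (snd (shear v f \<phi>)) = 0"
proof -
  have "eval_origin (pairing v \<phi>) = 0"
    using assms(2,3) by (simp add: pairing_def eval_origin_def)
  then show "eval_origin (fst (shear v f \<phi>)) = 0" "eval_origin (snd (shear v f \<phi>)) = 0"
    using assms by (simp_all add: shear_def eval_origin_at_poly poly_0_coeff_0)
qed

subsection \<open>Jung's theorem\<close>

definition linear_map :: "('a::comm_ring_1 \<times> 'a) \<times> 'a \<times> 'a \<Rightarrow> 'a bipoly \<times> 'a bipoly" where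
  "linear_map g = (cst (fst (fst g)) * varX + cst (fst (snd g)) * varY,
                   cst (snd (fst g)) * varX + cst (snd (snd g)) * varY)"

text \<open>The symplectic transvection along \<open>v\<close>: the linear shear as it acts on
  vectors.\<close>

definition vshear :: "'a::comm_ring_1 \<times> 'a \<Rightarrow> 'a \<Rightarrow> 'a \<times> 'a \<Rightarrow> 'a \<times> 'a" where
  "vshear v a u = (fst u + fst v * a * vpair v u, snd u + snd v * a * vpair v u)"

lemma shear_linear_map:
  "shear v (monom a 1) (linear_map (u, w)) = linear_map (vshear v a u, vshear v a w)"
  by (simp add: shear_def linear_map_def vshear_def at_poly_monom pairing_def vpair_def
      cst_mult cst_add cst_diff algebra_simps)

lemma vpair_vshear: "vpair (vshear v a u) (vshear v a w) = vpair u w"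
  by (simp add: vpair_def vshear_def algebra_simps)

lemma pairing_vshear: "pairing (vshear v a w) (shear v (monom a 1) \<phi>) = pairing w \<phi>"
  by (simp add: pairing_def shear_def vshear_def at_poly_monom vpair_def cst_mult cst_add cst_diff algebra_simps)

text \<open>A linear shear preserves the pairing, so it moves the vector of another shear and leaves
  the polynomial alone.\<close>

lemma shear_conj:
  "shear v (monom a 1) (shear w f \<phi>) = shear (vshear v a w) f (shear v (monom a 1) \<phi>)"
  unfolding shear_def[of "vshear v a w"] pairing_vshear
  by (simp add: shear_def vshear_def at_poly_monom pairing_def vpair_def
      cst_mult cst_add cst_diff algebra_simps)

text \<open>The axes suffice as generators, and for their operators nilpotency and commutators are
  direct computations; all other nonzero vectors are reached by conjugation.\<close>

definition axes :: "('a::comm_ring_1 \<times> 'a) set" where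
  "axes = {(1, 0), (0, 1)}"

text \<open>Row operations reduce a matrix of determinant one to the identity.\<close>

lemma sl2_induct:
  fixes Q :: "('a::field \<times> 'a) \<times> 'a \<times> 'a \<Rightarrow> bool"
  assumes one: "Q ((1, 0), (0, 1))"
    and step: "\<And>v a u w. v \<in> axes \<Longrightarrow> vpair u w = 1 \<Longrightarrow> Q (u, w) \<Longrightarrow> Q (vshear v a u, vshear v a w)"
    and det: "vpair u w = 1"
  shows "Q (u, w)"
proof -
  have rev: "Q (u, w)" if "Q (vshear v a u, vshear v a w)" "v \<in> axes" "vpair u w = 1" for v a u w
  proof -
    have "vshear v (- a) (vshear v a x) = x" for x by (simp add: vshear_def vpair_def algebra_simps)
    then show ?thesis
      using step[OF that(2) _ that(1), of "- a"] that(3) by (simp add: vpair_vshear)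
  qed
  have X: "vshear (1, 0) a u = (fst u + a * snd u, snd u)"
    and Y: "vshear (0, 1) a u = (fst u, snd u - a * fst u)" for a u
    by (simp_all add: vshear_def vpair_def)
  have e: "(1, 0) \<in> axes" "(0, 1) \<in> (axes :: ('a \<times> 'a) set)" by (simp_all add: axes_def)
  have upper: "Q ((1, 0), w)" if "vpair (1, 0) w = 1" for w
    using that rev[of "(1, 0)" "- fst w" "(1, 0)" w] e one by (cases w) (simp add: X vpair_def)
  have nz: "Q (u, w)" if "snd u \<noteq> 0" "vpair u w = 1" for u w
  proof (rule rev[OF rev])
    \<comment> \<open>The first transvection makes the first coordinate of \<open>u\<close> equal to
      1; the second, with factor \<open>snd u\<close>, then clears the other coordinate.\<close>
    let ?a = "(1 - fst u) / snd u"
    show "Q (vshear (0, 1) (snd u) (vshear (1, 0) ?a u), vshear (0, 1) (snd u) (vshear (1, 0) ?a w))"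
    proof -
      have "vshear (0, 1) (snd u) (vshear (1, 0) ?a u) = (1, 0)"
        using that(1) by (simp add: X Y)
      then show ?thesis
        using upper that(2) vpair_vshear by metis
    qed
  qed (use e that in \<open>simp_all add: vpair_vshear\<close>)
  show ?thesis
  proof (cases "snd u = 0")
    case True
    then have "fst u \<noteq> 0" using det by (auto simp: vpair_def)
    \<comment> \<open>A transvection along the second axis produces the nonzero second coordinate
      that \<open>nz\<close> asks for.\<close>
    have "Q (vshear (0, 1) 1 u, vshear (0, 1) 1 w)"
      by (rule nz) (use True \<open>fst u \<noteq> 0\<close> det in \<open>simp_all add: Y vpair_vshear\<close>,
        simp add: vpair_def algebra_simps)
    then show ?thesis using rev e det by blast
  next
    case False
    then show ?thesis using nz det by blast
  qed
qed

text \<open>One shear at a time lowers the sum of the degrees until the map is linear, where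
  \<open>sl2_induct\<close> takes over. The bound \<open>k < n\<close> survives because a shear that
  lowers \<open>f\<close> has degree \<open>p\<close> with \<open>tdeg f = p * tdeg g\<close>, hence
  \<open>p \<le> tdeg f < n\<close>, and likewise for \<open>g\<close>.\<close>

lemma jung_induct:
  fixes Q :: "'a::field_char_0 bipoly \<times> 'a bipoly \<Rightarrow> bool"
  assumes id: "Q id_plane"
    and step: "\<And>v c k \<phi>. v \<in> axes \<Longrightarrow> k > 0 \<Longrightarrow> k < n \<Longrightarrow> Q \<phi> \<Longrightarrow> Q (shear v (monom c k) \<phi>)"
    and jac: "jacobian \<phi> = 1" and inv: "\<exists>\<Gamma>. bisubst \<Gamma> \<phi> = varX"
    and origin: "eval_origin (fst \<phi>) = 0" "eval_origin (snd \<phi>) = 0"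
    and deg: "tdeg (fst \<phi>) < n" "tdeg (snd \<phi>) < n"
  shows "Q \<phi>"
  using jac inv origin deg
proof (induction "tdeg (fst \<phi>) + tdeg (snd \<phi>)" arbitrary: \<phi> rule: less_induct)
  case less
  obtain f g where \<phi>: "\<phi> = (f, g)" by (cases \<phi>)
  note jac = less.prems(1)[unfolded \<phi>]
  have e: "(1, 0) \<in> axes" "(0, 1) \<in> (axes :: ('a \<times> 'a) set)" by (simp_all add: axes_def)
  have "tdeg f + tdeg g \<ge> 2" using tdeg_jacobian[of f g] jac by simp
  have const: "jacobian (f, g) = 0" if "tdeg f = 0 \<or> tdeg g = 0"
  proof -
    have "diffX p = 0 \<and> diffY p = 0" if "tdeg p = 0" for p :: "'a bipoly"
    proof -
      have "coeff (coeff p j) i = 0" if "(i, j) \<noteq> (0, 0)" for i j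
        using \<open>tdeg p = 0\<close> that by (simp add: coeff_eq_coeff_homog tdeg_def coeff_eq_0)
      then have "p = [:[:coeff (coeff p 0) 0:]:]"
        by (intro poly_eqI) (auto simp: coeff_pCons split: nat.splits)
      then show ?thesis by (metis diffX_simps(1) diffY_simps(1))
    qed
    then show ?thesis using that by (auto simp: jacobian_def)
  qed
  have pos: "tdeg f > 0" "tdeg g > 0" using const jac by (metis gr0I zero_neq_one)+
  have reduce: "Q \<phi>"
    if v: "v \<in> axes" and k: "k > 0" "k < n"
      and less': "tdeg (fst (shear v (monom c k) \<phi>)) + tdeg (snd (shear v (monom c k) \<phi>)) < tdeg f + tdeg g"
        "tdeg (fst (shear v (monom c k) \<phi>)) < n" "tdeg (snd (shear v (monom c k) \<phi>)) < n" for v c k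
  proof -
    let ?\<psi> = "shear v (monom c k) \<phi>"
    have revert: "shear v (monom (- c) k) ?\<psi> = \<phi>"
      by (simp add: shear_add[symmetric] add_monom)
    obtain \<Gamma> where "bisubst \<Gamma> \<phi> = varX" using less.prems(2) by blast
    then have "bisubst \<Gamma> (comp_plane (shear v (monom (- c) k) id_plane) ?\<psi>) = varX"
      using revert shear_conv_comp by metis
    then have inv': "\<exists>\<Gamma>. bisubst \<Gamma> ?\<psi> = varX" by (auto simp: comp_plane_def bisubst_assoc[symmetric])
    have "Q ?\<psi>"
    proof (rule less.hyps)
      show "tdeg (fst ?\<psi>) + tdeg (snd ?\<psi>) < tdeg (fst \<phi>) + tdeg (snd \<phi>)"
        using less' by (simp add: \<phi>)
    qed (use less.prems less' inv' k in \<open>auto simp: jacobian_shear intro!: eval_origin_shear\<close>)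
    then have "Q (shear v (monom (- c) k) ?\<psi>)" using step v k by blast
    then show ?thesis by (simp add: revert)
  qed
  show ?case
  proof (cases "tdeg f + tdeg g > 2")
    case False
    then have "tdeg f \<le> 1" "tdeg g \<le> 1" using pos by auto
    moreover have "eval_origin f = 0" "eval_origin g = 0" using less.prems by (simp_all add: \<phi>)
    ultimately obtain u1 w1 u2 w2 where
      "f = [:[:u1:]:] * varX + [:[:w1:]:] * varY" "g = [:[:u2:]:] * varX + [:[:w2:]:] * varY"
      using tdeg_le_1_imp_linear by metis
    then have lin: "\<phi> = linear_map ((u1, u2), (w1, w2))"
      by (simp add: \<phi> linear_map_def cst_def del: mult_pCons_left)
    have "jacobian \<phi> = cst (vpair (u1, u2) (w1, w2))"
      by (simp add: lin linear_map_def jacobian_def diffX_add diffX_mult diffY_add diffY_mult vpair_def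
          cst_diff cst_mult mult_ac)
    then have "cst (vpair (u1, u2) (w1, w2) - 1) = 0" using less.prems(1) by (simp add: cst_diff)
    then have det: "vpair (u1, u2) (w1, w2) = 1" by simp
    have "1 < n" using less.prems(5) pos by (simp add: \<phi>)
    have "Q (linear_map g)" if "g = ((u1, u2), (w1, w2))" for g
      unfolding that
    proof (rule sl2_induct[of "\<lambda>g. Q (linear_map g)", OF _ _ det])
      show "Q (linear_map ((1, 0), (0, 1)))" using id by (simp add: linear_map_def)
    next
      fix v u w :: "'a \<times> 'a" and a
      assume "v \<in> axes" "Q (linear_map (u, w))"
      then show "Q (linear_map (vshear v a u, vshear v a w))"
        using step[of v 1 "linear_map (u, w)" a] \<open>1 < n\<close> unfolding shear_linear_map by simp
    qed
    then show ?thesis by (simp add: lin)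
  next
    case True
    define d where "d = gcd (tdeg f) (tdeg g)"
    obtain p q where pq: "tdeg f = p * d" "tdeg g = q * d" "coprime p q"
      using gcd_coprime_exists[of "tdeg f" "tdeg g"] pos unfolding d_def by auto
    obtain \<Gamma> where "bisubst \<Gamma> (f, g) = varX" using less.prems(2) \<phi> by blast
    then have "p = 1 \<or> q = 1" using jacobian_pair_degrees[OF jac _ pq pos] by blast
    then show ?thesis
    proof
      assume "q = 1"
      then have fp: "tdeg f = p * tdeg g" "p > 0" using pq pos by auto
      then obtain c where c: "tdeg (f - [:[:c:]:] * g ^ p) < tdeg f"
        using tdeg_reduction[OF jac] True pos by blast
      have sh: "shear (1, 0) (monom (- c) p) (f, g) = (f - [:[:c:]:] * g ^ p, g)"
        by (simp add: shear_def at_poly_monom pairing_def cst_uminus) (simp add: cst_def)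
      have "p \<le> tdeg f" using fp pos by simp
      then have "p < n" using less.prems(5) by (simp add: \<phi>)
      then show ?thesis
        using reduce[OF e(1), of p "- c"] c less.prems(5,6) fp by (simp add: sh \<phi> del: mult_pCons_left)
    next
      assume "p = 1"
      then have gq: "tdeg g = q * tdeg f" "q > 0" using pq pos by auto
      \<comment> \<open>The quarter turn \<open>(g, - f)\<close> exchanges the roles of the
        components at Jacobian one; its sign agrees with \<open>pairing (0, 1)\<close>, which yields
        \<open>- f\<close>.\<close>
      have jac': "jacobian (g, - f) = 1"
      proof -
        have "diffX (- f) = - diffX f" "diffY (- f) = - diffY f"
          by (auto intro!: poly_eqI simp: diffX_def diffY_def coeff_map_poly pderiv_minus)
        then show ?thesis using jac by (simp add: jacobian_def algebra_simps)
      qed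
      have neg: "tdeg (- f) = tdeg f" by (simp add: tdeg_def homog_diff[of 0 f, simplified])
      obtain c where c: "tdeg (g - [:[:c:]:] * (- f) ^ q) < tdeg g"
        using tdeg_reduction[OF jac', of q] True pos gq unfolding neg by (auto simp: add.commute)
      have sh: "shear (0, 1) (monom (- c) q) (f, g) = (f, g - [:[:c:]:] * (- f) ^ q)"
        by (simp add: shear_def at_poly_monom pairing_def cst_uminus) (simp add: cst_def)
      have "q \<le> tdeg g" using gq pos by simp
      then have "q < n" using less.prems(6) by (simp add: \<phi>)
      then show ?thesis
        using reduce[OF e(2), of q "- c"] c less.prems(5,6) gq by (simp add: sh \<phi> del: mult_pCons_left)
    qed
  qed
qed

subsection \<open>Reduced words of shears are not linear\<close>

text \<open>Two letters with proportional vectors belong to the same factor of the free product.\<close>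

fun reduced :: "(('a::comm_ring_1 \<times> 'a) \<times> 'a poly) list \<Rightarrow> bool" where
  "reduced [] \<longleftrightarrow> True"
| "reduced ((v, f) # ws) \<longleftrightarrow> v \<noteq> (0, 0) \<and> f \<noteq> 0 \<and> coeff f 0 = 0 \<and> coeff f 1 = 0 \<and>
     (ws \<noteq> [] \<longrightarrow> vpair (fst (hd ws)) v \<noteq> 0) \<and> reduced ws"

definition plane_word :: "(('a::comm_ring_1 \<times> 'a) \<times> 'a poly) list \<Rightarrow> 'a bipoly \<times> 'a bipoly \<Rightarrow> 'a bipoly \<times> 'a bipoly" where
  "plane_word ws = foldr (\<lambda>(v, f). shear v f) ws"

lemma plane_word_simps [simp]:
  "plane_word [] \<phi> = \<phi>" "plane_word ((v, f) # ws) \<phi> = shear v f (plane_word ws \<phi>)"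
  by (simp_all add: plane_word_def)

lemma degree_ge_2:
  assumes "f \<noteq> 0" "coeff f 0 = 0" "coeff f 1 = 0"
  shows "degree f \<ge> 2"
proof (rule ccontr)
  assume "\<not> degree f \<ge> 2"
  then have "degree f = 0 \<or> degree f = 1" by auto
  then show False using assms by (metis leading_coeff_0_iff)
qed

lemma tdeg_add_eq: "tdeg p < tdeg q \<Longrightarrow> tdeg (p + q) = tdeg q"
  by (simp add: tdeg_def homog_add degree_add_eq_right)

text \<open>\<open>D\<close> is the degree of a linear form in general position on the image; only
  multiples of the head vector may fall short of it. In a reduced word the next vector is not such a
  multiple, so its letter multiplies \<open>D\<close> by \<open>degree f \<ge> 2\<close>.\<close>

lemma tdeg_plane_word:
  fixes \<phi> :: "'a::idom bipoly \<times> 'a bipoly"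
  assumes "reduced ws" and base: "\<And>w. w \<noteq> (0, 0) \<Longrightarrow> tdeg (pairing w \<phi>) = 1"
  shows "\<exists>D\<ge>1. (ws \<noteq> [] \<longrightarrow> D \<ge> 2) \<and> (\<forall>w. tdeg (pairing w (plane_word ws \<phi>)) \<le> D) \<and>
    (\<forall>w. w \<noteq> (0, 0) \<longrightarrow> (ws \<noteq> [] \<longrightarrow> vpair (fst (hd ws)) w \<noteq> 0) \<longrightarrow>
       tdeg (pairing w (plane_word ws \<phi>)) = D)"
  using assms(1)
proof (induction ws)
  case Nil
  have "tdeg (pairing w \<phi>) \<le> 1" for w
    using base[of w] by (cases "w = (0, 0)") (simp_all add: pairing_def)
  then show ?case using base by (intro exI[of _ 1]) auto
next
  case (Cons x ws)
  obtain v f where x: "x = (v, f)" by (cases x)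
  let ?\<psi> = "plane_word ws \<phi>"
  have red: "v \<noteq> (0, 0)" "f \<noteq> 0" "coeff f 0 = 0" "coeff f 1 = 0" "reduced ws"
    "ws \<noteq> [] \<Longrightarrow> vpair (fst (hd ws)) v \<noteq> 0"
    using Cons.prems by (auto simp: x)
  obtain D where D: "D \<ge> 1" "\<And>w. tdeg (pairing w ?\<psi>) \<le> D"
    "\<And>w. w \<noteq> (0, 0) \<Longrightarrow> (ws \<noteq> [] \<longrightarrow> vpair (fst (hd ws)) w \<noteq> 0) \<Longrightarrow> tdeg (pairing w ?\<psi>) = D"
    using Cons.IH red(5) by blast
  have f: "degree f \<ge> 2" using degree_ge_2 red by blast
  define D' where "D' = degree f * D"
  have "2 * D \<le> D'" unfolding D'_def using f by (rule mult_le_mono1)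
  then have "D < D'" "D' \<ge> 2" using D(1) by auto
  have F: "tdeg (at_poly f (pairing v ?\<psi>)) = D'"
    using D(3)[of v] red by (simp add: tdeg_at_poly D'_def)
  have pw: "pairing w (plane_word (x # ws) \<phi>) =
      pairing w ?\<psi> + cst (vpair w v) * at_poly f (pairing v ?\<psi>)" for w
    by (simp add: x pairing_shear)
  have "tdeg (pairing w (plane_word (x # ws) \<phi>)) \<le> D'" for w
    unfolding pw using D(2)[of w] \<open>D < D'\<close> tdeg_mult_le[of "cst (vpair w v)" "at_poly f (pairing v ?\<psi>)"]
    by (intro tdeg_add_le) (auto simp: F)
  moreover have "tdeg (pairing w (plane_word (x # ws) \<phi>)) = D'" if "vpair v w \<noteq> 0" for w
  proof -
    have "vpair w v \<noteq> 0" using that by (auto simp: vpair_def algebra_simps)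
    moreover have "at_poly f (pairing v ?\<psi>) \<noteq> 0" using F \<open>D' \<ge> 2\<close> by auto
    ultimately have "tdeg (cst (vpair w v) * at_poly f (pairing v ?\<psi>)) = D'"
      by (simp add: tdeg_mult F)
    then show ?thesis
      unfolding pw using D(2)[of w] \<open>D < D'\<close> by (subst tdeg_add_eq) auto
  qed
  ultimately show ?case
    using \<open>D' \<ge> 2\<close> by (intro exI[of _ D']) (auto simp: x)
qed

lemma tdeg_linear_form:
  assumes "a \<noteq> 0 \<or> b \<noteq> (0::'a::idom)"
  shows "tdeg (cst a * varX + cst b * varY) = 1"
proof -
  have "homog (cst a * varX + cst b * varY) = cst a * (varX * varY) + cst b * varY"
    by (simp add: homog_add homog_mult)
  also have "\<dots> = [:0, [:b, a:]:]" by (simp add: cst_def varX_def varY_def)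
  finally have "homog (cst a * varX + cst b * varY) = [:0, [:b, a:]:]" .
  then show ?thesis using assms by (auto simp: tdeg_def)
qed

lemma plane_word_ne_id:
  fixes u w :: "'a::idom \<times> 'a"
  assumes "reduced ws" "ws \<noteq> []" and det: "vpair u w = 1"
  shows "plane_word ws (linear_map (u, w)) \<noteq> id_plane"
proof
  assume id: "plane_word ws (linear_map (u, w)) = id_plane"
  have base: "tdeg (pairing z (linear_map (u, w))) = 1" if "z \<noteq> (0, 0)" for z
  proof -
    have "pairing z (linear_map (u, w)) = cst (vpair z u) * varX + cst (vpair z w) * varY"
      by (simp add: pairing_def linear_map_def vpair_def cst_diff cst_mult algebra_simps)
    moreover have "vpair z u \<noteq> 0 \<or> vpair z w \<noteq> 0"
    proof (rule ccontr)
      assume "\<not> ?thesis"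
      \<comment> \<open>Cramer's rule recovers \<open>z\<close> from its pairings with
        \<open>u\<close> and \<open>w\<close>.\<close>
      moreover have "fst z * vpair u w = fst u * vpair z w - fst w * vpair z u"
        "snd z * vpair u w = snd u * vpair z w - snd w * vpair z u"
        by (simp_all add: vpair_def algebra_simps)
      ultimately have "fst z * vpair u w = 0" "snd z * vpair u w = 0" by simp_all
      then show False using that det by (cases z) auto
    qed
    ultimately show ?thesis by (simp add: tdeg_linear_form)
  qed
  obtain D where D: "D \<ge> 2" "\<And>z. z \<noteq> (0, 0) \<Longrightarrow> vpair (fst (hd ws)) z \<noteq> 0 \<Longrightarrow> tdeg (pairing z id_plane) = D"
    using tdeg_plane_word[OF assms(1) base] assms(2) unfolding id by blast
  obtain v where v: "v = fst (hd ws)" "v \<noteq> (0, 0)" using assms(1,2) by (cases ws rule: reduced.cases) auto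
  have "vpair v (1, 0) \<noteq> 0 \<or> vpair v (0, 1) \<noteq> 0" using v(2) by (cases v) (auto simp: vpair_def)
  moreover have "(1 :: 'a, 0 :: 'a) \<noteq> (0, 0)" "(0 :: 'a, 1 :: 'a) \<noteq> (0, 0)" by simp_all
  ultimately obtain z :: "'a \<times> 'a" where z: "z \<noteq> (0, 0)" "vpair v z \<noteq> 0" by blast
  have "pairing z id_plane = cst (- snd z) * varX + cst (fst z) * varY"
    by (simp add: pairing_def cst_uminus)
  then have "tdeg (pairing z id_plane) = 1"
    using z(1) tdeg_linear_form[of "- snd z" "fst z"] by (cases z) auto
  then show False using D(1) D(2)[OF z(1)] z(2) v(1) by simp
qed

subsection \<open>The ring of linear operators on sequences\<close>

text \<open>Operators on all sequences form a ring without dimension conditions; finite dimension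
  enters through the truncation of particular operators and through invariant subspaces.\<close>

typedef (overloaded) 'a linop = "{T :: (nat \<Rightarrow> 'a::comm_ring_1) \<Rightarrow> nat \<Rightarrow> 'a.
    (\<forall>x y. T (\<lambda>i. x i + y i) = (\<lambda>i. T x i + T y i)) \<and> (\<forall>c x. T (\<lambda>i. c * x i) = (\<lambda>i. c * T x i))}"
  morphisms app Linop
  by (rule exI[of _ id]) simp

setup_lifting type_definition_linop

instantiation linop :: (comm_ring_1) ring_1
begin

lift_definition zero_linop :: "'a linop" is "\<lambda>x i. 0" by simp
lift_definition one_linop :: "'a linop" is "\<lambda>x. x" by simp
lift_definition plus_linop :: "'a linop \<Rightarrow> 'a linop \<Rightarrow> 'a linop" is "\<lambda>S T x i. S x i + T x i"
  by (auto simp: algebra_simps)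
lift_definition minus_linop :: "'a linop \<Rightarrow> 'a linop \<Rightarrow> 'a linop" is "\<lambda>S T x i. S x i - T x i"
  by (auto simp: algebra_simps)
lift_definition uminus_linop :: "'a linop \<Rightarrow> 'a linop" is "\<lambda>T x i. - T x i"
  by (auto simp: algebra_simps)
lift_definition times_linop :: "'a linop \<Rightarrow> 'a linop \<Rightarrow> 'a linop" is "\<lambda>S T x. S (T x)"
  by auto

instance
proof
  have "(\<lambda>x i. 0) \<noteq> (\<lambda>x :: nat \<Rightarrow> 'a. x)"
    by (metis zero_neq_one)
  then show "(0 :: 'a linop) \<noteq> 1" by transfer
qed (transfer; auto simp: algebra_simps fun_eq_iff)+

end

lift_definition scal :: "'a::comm_ring_1 \<Rightarrow> 'a linop" is "\<lambda>c x i. c * x i"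
  by (auto simp: algebra_simps)

lemma linop_eqI: "(\<And>x i. app S x i = app T x i) \<Longrightarrow> S = T"
  by transfer (simp add: fun_eq_iff)

lemma app_simps [simp]:
  "app 0 x i = 0" "app 1 x = x" "app (S + T) x i = app S x i + app T x i"
  "app (S - T) x i = app S x i - app T x i" "app (- T) x i = - app T x i"
  "app (S * T) x = app S (app T x)" "app (scal c) x i = c * x i"
  by (transfer; simp)+

lemma app_sum: "app (\<Sum>k\<in>A. T k) x i = (\<Sum>k\<in>A. app (T k) x i)"
  by (induction A rule: infinite_finite_induct) simp_all

lemma app_add: "app T (\<lambda>i. x i + y i) i = app T x i + app T y i"
  by transfer (simp add: fun_eq_iff)

lemma app_scale: "app T (\<lambda>i. c * x i) i = c * app T x i"
  by transfer (simp add: fun_eq_iff)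

lemma app_zero [simp]: "app T (\<lambda>i. 0) i = 0"
  using app_scale[of T 0 "\<lambda>i. 0"] by simp

lemma app_sum_vec: "app T (\<lambda>i. \<Sum>k\<in>A. x k i) i = (\<Sum>k\<in>A. app T (x k) i)"
  by (induction A rule: infinite_finite_induct) (simp_all add: app_add)

lemma scal_simps [simp]: "scal 0 = 0" "scal 1 = 1"
  by (rule linop_eqI; simp)+

lemma scal_add: "scal (a + b) = scal a + scal b"
  and scal_mult: "scal (a * b) = scal a * scal b"
  and scal_diff: "scal (a - b) = scal a - scal b"
  and scal_uminus: "scal (- a) = - scal a"
  by (rule linop_eqI; simp add: algebra_simps)+

lemma scal_central: "T * scal a = scal a * T"
  by (rule linop_eqI) (simp add: app_scale[symmetric], metis app_simps(7))

lemma scal_left_commute: "T * (scal a * U) = scal a * (T * U)"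
  by (simp add: scal_central mult.assoc[symmetric])

lemma scal_mult_power: "(scal a * T) ^ k = scal (a ^ k) * T ^ k"
proof (induction k)
  case (Suc k)
  then show ?case by (simp only: power_Suc scal_left_commute[of T] scal_mult mult.assoc)
qed simp

lemma power_conj:
  fixes A :: "'a::monoid_mult"
  assumes "A * S = T * A"
  shows "A * S ^ k = T ^ k * A"
proof (induction k)
  case (Suc k)
  have "A * S ^ Suc k = T * (A * S ^ k)" using assms by (simp add: mult.assoc[symmetric])
  then show ?case by (simp add: Suc.IH mult.assoc)
qed simp

subsection \<open>Evaluating polynomials at an operator\<close>

text \<open>For fixed \<open>s\<close> this is a ring homomorphism: identities between exponentials
  of one operator are proved among commutative polynomials and then transported.\<close>

definition eval_op :: "'a::comm_ring_1 poly \<Rightarrow> 'a linop \<Rightarrow> 'a linop" where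
  "eval_op p s = fold_coeffs (\<lambda>a T. scal a + s * T) p 0"

lemma eval_op_0 [simp]: "eval_op 0 s = 0"
  by (simp add: eval_op_def)

lemma eval_op_pCons: "eval_op (pCons a p) s = scal a + s * eval_op p s"
  by (cases "p = 0 \<and> a = 0") (auto simp: eval_op_def)

lemma eval_op_add: "eval_op (p + q) s = eval_op p s + eval_op q s"
  by (induction p q rule: poly_induct2) (simp_all add: eval_op_pCons scal_add algebra_simps)

lemma eval_op_smult: "eval_op (smult c p) s = scal c * eval_op p s"
  by (induction p) (simp_all add: eval_op_pCons scal_mult distrib_left scal_left_commute)

lemma eval_op_mult: "eval_op (p * q) s = eval_op p s * eval_op q s"
  by (induction p) (simp_all add: eval_op_pCons eval_op_add eval_op_smult algebra_simps)

lemma eval_op_diff: "eval_op (p - q) s = eval_op p s - eval_op q s"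
  using eval_op_add[of "p - q" q s] by (simp add: algebra_simps)

lemma eval_op_1 [simp]: "eval_op 1 s = 1"
  by (simp add: one_pCons eval_op_pCons)

lemma eval_op_monom: "eval_op (monom a k) s = scal a * s ^ k"
  by (induction k) (simp_all add: monom_0 monom_Suc eval_op_pCons scal_left_commute)

lemma eval_op_sum: "eval_op (\<Sum>k\<in>A. p k) s = (\<Sum>k\<in>A. eval_op (p k) s)"
  by (induction A rule: infinite_finite_induct) (simp_all add: eval_op_add)

lemma eval_op_scale: "eval_op (pcompose p [:0, c:]) s = eval_op p (scal c * s)"
  by (induction p)
    (simp_all add: pcompose_pCons eval_op_add eval_op_mult eval_op_pCons eval_op_smult
      scal_left_commute mult.assoc)

lemma eval_op_conj: "A * s = s' * A \<Longrightarrow> A * eval_op p s = eval_op p s' * A"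
proof (induction p)
  case (pCons a p)
  have "A * eval_op (pCons a p) s = scal a * A + (A * s) * eval_op p s"
    by (simp add: eval_op_pCons distrib_left scal_central mult.assoc)
  also have "\<dots> = scal a * A + s' * (A * eval_op p s)"
    by (simp add: pCons.prems mult.assoc)
  finally show ?case
    by (simp add: pCons.IH pCons.prems eval_op_pCons distrib_right mult.assoc)
qed simp

lemma eval_op_cong_nilpotent:
  assumes "s ^ n = 0" "monom 1 n dvd p - q"
  shows "eval_op p s = eval_op q s"
proof -
  obtain r where r: "p - q = monom 1 n * r" using assms(2) by (auto elim: dvdE)
  have "eval_op p s - eval_op q s = eval_op (monom 1 n) s * eval_op r s"
    by (simp add: eval_op_diff[symmetric] r eval_op_mult)
  then show ?thesis using assms(1) by (simp add: eval_op_monom)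
qed

lemma eval_op_nilpotent:
  assumes "s ^ n = 0"
  shows "eval_op p s = (\<Sum>k<n. scal (coeff p k) * s ^ k)"
proof -
  have "eval_op p s = eval_op (\<Sum>k<n. monom (coeff p k) k) s"
  proof (rule eval_op_cong_nilpotent[OF assms])
    have "p - (\<Sum>k<n. monom (coeff p k) k) = monom 1 n * poly_shift n p"
      by (rule poly_eqI) (auto simp: coeff_sum coeff_monom_mult coeff_poly_shift)
    then show "monom 1 n dvd p - (\<Sum>k<n. monom (coeff p k) k)" by simp
  qed
  then show ?thesis by (simp add: eval_op_sum eval_op_monom)
qed

subsection \<open>Truncated exponentials\<close>

definition texp :: "nat \<Rightarrow> 'a::field_char_0 poly poly \<Rightarrow> 'a poly poly" where
  "texp n p = (\<Sum>j\<le>n. smult [:1 / fact j:] (p ^ j))"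

lemma smult_sum_right: "smult c (\<Sum>i\<in>A. f i) = (\<Sum>i\<in>A. smult c (f i))"
  by (induction A rule: infinite_finite_induct) (simp_all add: smult_add_right)

lemma texp_0 [simp]: "texp n 0 = 1"
proof -
  have "texp n 0 = (\<Sum>j\<le>n. if j = 0 then 1 else 0 :: 'a poly poly)"
    unfolding texp_def by (intro sum.cong) (auto simp: one_pCons)
  then show ?thesis by simp
qed

lemma texp_pcompose: "texp n (pcompose p r) = pcompose (texp n p) r"
proof -
  have "pcompose (p ^ j) r = pcompose p r ^ j" for j
    by (induction j) (simp_all add: pcompose_mult pcompose_1)
  then show ?thesis by (simp add: texp_def pcompose_sum pcompose_smult)
qed

lemma monom_power_dvd:
  assumes "coeff p 0 = (0::'a::comm_ring_1)"
  shows "monom 1 k dvd p ^ k"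
proof -
  obtain a q where "p = pCons a q" by (cases p) auto
  then have "p = monom 1 1 * q" using assms by (simp add: monom_Suc)
  then have "p ^ k = monom 1 1 ^ k * q ^ k" by (simp add: power_mult_distrib)
  also have "monom 1 1 ^ k = (monom 1 k :: 'a poly)" by (simp add: monom_power)
  finally show ?thesis by simp
qed

text \<open>The terms with \<open>i + j \<le> n\<close> add up to the exponential of the sum by the
  binomial formula; every other term of the product contains at least \<open>n + 1\<close> factors
  without constant term.\<close>

lemma texp_add:
  fixes p q :: "'a::field_char_0 poly poly"
  assumes "coeff p 0 = 0" "coeff q 0 = 0"
  shows "monom 1 (Suc n) dvd texp n p * texp n q - texp n (p + q)"
proof -
  define u where "u j = smult [:1 / fact j:] (p ^ j)" for j
  define v where "v j = smult [:1 / fact j:] (q ^ j)" for j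
  have bin: "smult [:1 / fact k:] ((p + q) ^ k) = (\<Sum>i\<le>k. u i * v (k - i))" for k
  proof -
    have "smult [:1 / fact k:] (of_nat (k choose i) * p ^ i * q ^ (k - i)) = u i * v (k - i)"
      if "i \<le> k" for i
    proof -
      have "of_nat (k choose i) = ([:[:of_nat (k choose i):]:] :: 'a poly poly)"
        by (simp add: of_nat_poly)
      moreover have "1 / fact k * of_nat (k choose i) = 1 / fact i * (1 / fact (k - i) :: 'a)"
        using that by (simp add: binomial_fact field_simps)
      ultimately show ?thesis by (simp add: u_def v_def)
    qed
    then show ?thesis
      by (simp add: binomial_ring smult_sum_right)
  qed
  let ?S = "{..n} \<times> {..n}" and ?T = "{(i, j). i + j \<le> n}"
  have sub: "?T \<subseteq> ?S" by auto
  have fin: "finite ?T" by (rule finite_subset[OF sub]) simp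
  have "texp n p * texp n q = (\<Sum>(i, j)\<in>?S. u i * v j)"
    by (simp add: texp_def u_def v_def sum_product sum.cartesian_product)
  moreover have "texp n (p + q) = (\<Sum>(i, j)\<in>?T. u i * v j)"
    by (simp add: texp_def bin sum.triangle_reindex_eq)
  ultimately have "texp n p * texp n q - texp n (p + q) = (\<Sum>(i, j)\<in>?S - ?T. u i * v j)"
    using sum.subset_diff[OF sub, of "\<lambda>(i, j). u i * v j"] by simp
  also have "monom 1 (Suc n) dvd \<dots>"
  proof (rule dvd_sum)
    fix x assume "x \<in> ?S - ?T"
    moreover obtain i j where x: "x = (i, j)" by (cases x)
    ultimately have "Suc n \<le> i + j" by simp
    then have "monom 1 (Suc n) dvd (monom 1 (i + j) :: 'a poly poly)"
      by (metis dvd_triv_left le_add_diff_inverse mult_monom mult_1)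
    also have "monom 1 (i + j) = monom 1 i * (monom 1 j :: 'a poly poly)" by (simp add: mult_monom)
    also have "\<dots> dvd u i * v j"
      unfolding u_def v_def using assms by (intro mult_dvd_mono dvd_smult monom_power_dvd)
    finally show "monom 1 (Suc n) dvd (case x of (i, j) \<Rightarrow> u i * v j)" by (simp add: x)
  qed
  finally show ?thesis .
qed

subsection \<open>A representation of the Lie superalgebra osp(1|2)\<close>

text \<open>The coordinates \<open>0, \<dots>, 2 m\<close> stand for the basis \<open>x\<^sup>i y\<^bsup>m-i\<^esup>\<close> (index \<open>2 i\<close>) and
  \<open>x\<^sup>i y\<^bsup>m-1-i\<^esup>\<close> (index \<open>2 i + 1\<close>) of the binary forms of degree \<open>m\<close> and \<open>m - 1\<close>. A vector
  \<open>v = a x + b y\<close> acts by multiplication with \<open>v\<close> on the latter and by the derivation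
  \<open>a \<partial>\<^sub>y - b \<partial>\<^sub>x\<close> on the former.\<close>

definition up_coeff :: "nat \<Rightarrow> nat \<Rightarrow> 'a::comm_ring_1" where
  "up_coeff m i = (if even i then of_nat m - of_nat (i div 2) else 1)"

definition down_coeff :: "nat \<Rightarrow> 'a::comm_ring_1" where
  "down_coeff i = (if even i then - of_nat (i div 2) else 1)"

lift_definition up_op :: "nat \<Rightarrow> 'a::comm_ring_1 linop" is
  "\<lambda>m x i. if 0 < i \<and> i \<le> 2 * m then up_coeff m (i - 1) * x (i - 1) else 0"
  by (auto simp: algebra_simps fun_eq_iff)

lift_definition down_op :: "nat \<Rightarrow> 'a::comm_ring_1 linop" is
  "\<lambda>m x i. if i < 2 * m then down_coeff (Suc i) * x (Suc i) else 0"
  by (auto simp: algebra_simps fun_eq_iff)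

lemma app_up_op: "app (up_op m) x i = (if 0 < i \<and> i \<le> 2 * m then up_coeff m (i - 1) * x (i - 1) else 0)"
  and app_down_op: "app (down_op m) x i = (if i < 2 * m then down_coeff (Suc i) * x (Suc i) else 0)"
  by (transfer, simp)+

text \<open>Together with \<open>down_down_up\<close> this is the relation
  \<open>[s_v^2, s_w] = <v, w> s_v\<close> on the axes: the squares of the odd operators act on the
  odd operators as sl(2) acts on the plane.\<close>

lemma up_up_down: "up_op m ^ 2 * down_op m = down_op m * up_op m ^ 2 + up_op m"
proof (rule linop_eqI)
  fix x :: "nat \<Rightarrow> 'a" and i
  show "app (up_op m ^ 2 * down_op m) x i = app (down_op m * up_op m ^ 2 + up_op m) x i"
  proof (cases "even i")
    case True
    then obtain k where k: "i = 2 * k" by blast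
    show ?thesis
      by (cases k; cases k m rule: linorder_cases)
        (auto simp: k power2_eq_square app_up_op app_down_op up_coeff_def down_coeff_def algebra_simps)
  next
    case False
    then obtain k where k: "i = 2 * k + 1" by (blast elim: oddE)
    show ?thesis
      by (cases k; cases k m rule: linorder_cases)
        (auto simp: k power2_eq_square app_up_op app_down_op up_coeff_def down_coeff_def algebra_simps)
  qed
qed

lemma down_down_up: "down_op m ^ 2 * up_op m = up_op m * down_op m ^ 2 - down_op m"
proof (rule linop_eqI)
  fix x :: "nat \<Rightarrow> 'a" and i
  show "app (down_op m ^ 2 * up_op m) x i = app (up_op m * down_op m ^ 2 - down_op m) x i"
  proof (cases "even i")
    case True
    then obtain k where k: "i = 2 * k" by blast
    show ?thesis
      by (cases k; cases k m rule: linorder_cases)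
        (auto simp: k power2_eq_square app_up_op app_down_op up_coeff_def down_coeff_def algebra_simps)
  next
    case False
    then obtain k where k: "i = 2 * k + 1" by (blast elim: oddE)
    show ?thesis
      by (cases k; cases "Suc k" m rule: linorder_cases)
        (auto simp: k power2_eq_square app_up_op app_down_op up_coeff_def down_coeff_def algebra_simps)
  qed
qed

lemma app_up_op_power:
  "app (up_op m ^ j) x i =
     (if j \<le> i \<and> (j = 0 \<or> i \<le> 2 * m) then (\<Prod>l\<in>{i - j..<i}. up_coeff m l) * x (i - j) else 0)"
proof (induction j arbitrary: i)
  case (Suc j)
  show ?case
  proof (cases "Suc j \<le> i \<and> i \<le> 2 * m")
    case True
    then obtain i' where i: "i = Suc i'" by (cases i) auto
    then show ?thesis using True by (auto simp: app_up_op Suc.IH mult_ac prod.atLeastLessThan_Suc)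
  qed (auto simp: app_up_op Suc.IH)
qed simp

lemma up_op_nilpotent: "up_op m ^ Suc (2 * m) = 0"
  by (rule linop_eqI) (auto simp: app_up_op_power simp del: power_Suc)

lemma down_op_nilpotent: "down_op m ^ Suc (2 * m) = 0"
proof -
  have "app (down_op m ^ Suc j) x i = 0" if "i + Suc j > 2 * m" for j i and x :: "nat \<Rightarrow> 'a"
    using that
  proof (induction j arbitrary: i)
    case (Suc j)
    then show ?case by (simp add: app_down_op)
  qed (simp add: app_down_op)
  then show ?thesis by (intro linop_eqI) (simp del: power_Suc)
qed

definition vec_op :: "nat \<Rightarrow> 'a::field_char_0 \<times> 'a \<Rightarrow> 'a poly linop" where
  "vec_op m v = scal [:fst v:] * up_op m + scal [:snd v:] * down_op m"

lemma vec_op_axes [simp]: "vec_op m (1, 0) = up_op m" "vec_op m (0, 1) = down_op m"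
  by (simp_all add: vec_op_def one_pCons[symmetric])

lemma vec_op_scale: "vec_op m (c * fst v, c * snd v) = scal [:c:] * vec_op m v"
proof -
  have "scal [:c * a:] = scal [:c:] * scal [:a:]" for a by (simp add: scal_mult[symmetric] mult.commute)
  then show ?thesis by (simp add: vec_op_def distrib_left mult.assoc)
qed

lemma vec_op_axis_nilpotent: "v \<in> axes \<Longrightarrow> vec_op m v ^ Suc (2 * m) = 0"
  using up_op_nilpotent[of m] down_op_nilpotent[of m] by (auto simp: axes_def)

lemma scal_const_ring: "scal [:a + b:] = scal [:a:] + scal [:b:]" "scal [:a * b:] = scal [:a:] * scal [:b:]"
  "scal [:- a:] = - scal [:a:]" "scal [:a - b:] = scal [:a:] - scal [:b:]"
  by (simp_all add: scal_add[symmetric] scal_mult[symmetric] scal_diff[symmetric] scal_uminus[symmetric]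
      mult.commute)

lemma vec_op_commutator:
  assumes "v \<in> axes"
  shows "vec_op m v ^ 2 * vec_op m w = vec_op m w * vec_op m v ^ 2 + scal [:vpair v w:] * vec_op m v"
proof -
  have "vec_op m v ^ 2 * vec_op m w =
      scal [:fst w:] * (vec_op m v ^ 2 * up_op m) + scal [:snd w:] * (vec_op m v ^ 2 * down_op m)"
    by (simp add: vec_op_def[of m w] distrib_left scal_left_commute)
  moreover have "vec_op m w * vec_op m v ^ 2 =
      scal [:fst w:] * (up_op m * vec_op m v ^ 2) + scal [:snd w:] * (down_op m * vec_op m v ^ 2)"
    by (simp add: vec_op_def[of m w] distrib_right mult.assoc)
  ultimately show ?thesis
    using assms
    by (auto simp: axes_def vpair_def up_up_down down_down_up algebra_simps scal_const_ring
        power_commutes one_pCons[symmetric])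
qed

subsection \<open>Exponentials of polynomials in one vector\<close>

text \<open>Positive parts \<open>d_i \<le> D\<close> satisfy
  \<open>sum d_i^2 \<le> D * sum d_i\<close>, with equality only if every part is \<open>D\<close>;
  this singles out the top coefficient. The value 0 at the linear coefficient keeps SL(2) free of
  \<open>t\<close>.\<close>

definition t_weight :: "nat \<Rightarrow> nat" where
  "t_weight k = (if k \<le> 1 then 0 else Suc k ^ 2)"

text \<open>The coefficient of degree \<open>k\<close> has weight \<open>k + 1\<close> under the torus, whence the power \<open>s\<^bsup>k+1\<^esup>\<close>;
  the powers of \<open>t\<close> grow faster than linearly so that the leading coefficient of \<open>f\<close> dominates
  the coefficient of \<open>s\<^bsup>2m\<^esup>\<close> in the exponential.\<close>

definition t_poly :: "'a::field_char_0 poly \<Rightarrow> 'a poly poly" where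
  "t_poly f = (\<Sum>k\<le>degree f. monom (monom (coeff f k) (t_weight k)) (Suc k))"

lemma coeff_t_poly: "coeff (t_poly f) i = (case i of 0 \<Rightarrow> 0 | Suc k \<Rightarrow> monom (coeff f k) (t_weight k))"
proof (cases i)
  case (Suc k)
  have "coeff (t_poly f) (Suc k) =
      (\<Sum>j\<le>degree f. if j = k then monom (coeff f k) (t_weight k) else 0)"
    unfolding t_poly_def coeff_sum by (intro sum.cong) auto
  then show ?thesis by (auto simp: Suc coeff_eq_0)
qed (simp add: t_poly_def coeff_sum)

lemma t_poly_add: "t_poly (f + g) = t_poly f + t_poly g"
  by (rule poly_eqI) (auto simp: coeff_t_poly add_monom split: nat.splits)

lemma t_poly_0 [simp]: "t_poly 0 = 0"
  by (rule poly_eqI) (auto simp: coeff_t_poly split: nat.splits)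

lemma t_poly_linear: "t_poly (monom a 1) = monom [:a:] 2"
  by (rule poly_eqI) (auto simp: coeff_t_poly coeff_monom t_weight_def monom_0 split: nat.splits)

lemma t_poly_scale: "t_poly (smult c (pcompose f [:0, c:])) = pcompose (t_poly f) [:0, [:c:]:]"
proof -
  have "[:c:] ^ i = [:c ^ i:]" for i by (induction i) (simp_all add: one_pCons)
  then show ?thesis
    by (intro poly_eqI)
      (auto simp: coeff_t_poly coeff_pcompose_linear smult_monom mult_ac split: nat.splits)
qed

definition exp_op :: "nat \<Rightarrow> 'a::field_char_0 \<times> 'a \<Rightarrow> 'a poly \<Rightarrow> 'a poly linop" where
  "exp_op m v f = eval_op (texp (2 * m) (t_poly f)) (vec_op m v)"

lemma exp_op_0 [simp]: "exp_op m v 0 = 1"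
  by (simp add: exp_op_def)

lemma exp_op_add:
  assumes "vec_op m v ^ Suc (2 * m) = 0"
  shows "exp_op m v (f + g) = exp_op m v f * exp_op m v g"
proof -
  have "eval_op (texp (2 * m) (t_poly f) * texp (2 * m) (t_poly g)) (vec_op m v) =
      eval_op (texp (2 * m) (t_poly f + t_poly g)) (vec_op m v)"
    using assms by (rule eval_op_cong_nilpotent) (intro texp_add; simp add: coeff_t_poly)
  then show ?thesis by (simp add: exp_op_def t_poly_add eval_op_mult)
qed

lemma exp_op_scale: "exp_op m (c * fst v, c * snd v) f = exp_op m v (smult c (pcompose f [:0, c:]))"
  by (simp add: exp_op_def vec_op_scale t_poly_scale texp_pcompose eval_op_scale)

lemma exp_op_conj:
  "A * vec_op m v = vec_op m w * A \<Longrightarrow> A * exp_op m v f = exp_op m w f * A"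
  unfolding exp_op_def by (rule eval_op_conj)

lemma exp_op_linear:
  "exp_op m v (monom a 1) = (\<Sum>j\<le>2 * m. scal [:a ^ j / fact j:] * (vec_op m v ^ 2) ^ j)"
proof -
  have c: "[:a:] ^ j = [:a ^ j:]" for j by (induction j) (simp_all add: one_pCons)
  show ?thesis
    unfolding exp_op_def t_poly_linear texp_def eval_op_sum
    by (simp add: monom_power eval_op_monom smult_monom c power_mult[symmetric] mult.commute)
qed

text \<open>With \<open>X = s_v^2\<close>, the commutator \<open>Z\<close> of \<open>X\<close> and
  \<open>Y = s_w\<close> commutes with \<open>X\<close>, so conjugating \<open>Y\<close> by
  \<open>exp(a X)\<close> stops after the linear term. The result \<open>Y + a Z\<close> is the
  operator of the transvected vector.\<close>

lemma exp_op_linear_conj: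
  assumes v: "v \<in> axes" and "m > 0"
  shows "exp_op m v (monom a 1) * vec_op m w = vec_op m (vshear v a w) * exp_op m v (monom a 1)"
proof -
  define X where "X = vec_op m v ^ 2"
  define Y where "Y = vec_op m w"
  define Z where "Z = scal [:vpair v w:] * vec_op m v"
  define E where "E = exp_op m v (monom a 1)"
  have XY: "X * Y = Y * X + Z"
    unfolding X_def Y_def Z_def by (rule vec_op_commutator[OF v])
  have XZ: "X * Z = Z * X"
    by (simp add: X_def Z_def scal_left_commute power_commutes mult.assoc)
  have pow: "X ^ j * Y = Y * X ^ j + of_nat j * Z * X ^ (j - 1)" for j
  proof (induction j)
    case (Suc j)
    have "X ^ Suc j * Y = X * (X ^ j * Y)" by (simp add: mult.assoc)
    also have "\<dots> = X * Y * X ^ j + of_nat j * (X * Z) * X ^ (j - 1)"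
      by (simp add: Suc.IH distrib_left mult.assoc mult_of_nat_commute)
    also have "\<dots> = Y * X ^ Suc j + Z * X ^ j + of_nat j * Z * (X * X ^ (j - 1))"
      by (simp add: XY XZ distrib_right mult.assoc)
    also have "of_nat j * Z * (X * X ^ (j - 1)) = of_nat j * Z * X ^ j"
      by (cases j) simp_all
    finally show ?case by (simp add: distrib_right mult.assoc add.assoc)
  qed simp
  have "vec_op m v ^ (4 * m) = vec_op m v ^ Suc (2 * m) * vec_op m v ^ (2 * m - 1)"
    using \<open>m > 0\<close> by (subst power_add[symmetric]) simp
  then have X0: "X ^ (2 * m) = 0"
    using vec_op_axis_nilpotent[OF v, of m] by (simp add: X_def power_mult[symmetric] del: power_Suc)
  have E: "E = (\<Sum>j\<le>2 * m. scal [:a ^ j / fact j:] * X ^ j)"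
    unfolding E_def X_def by (rule exp_op_linear)
  \<comment> \<open>Differentiating the truncated series loses its last term, which is zero anyway;
    this makes the shifted sum below equal to \<open>E\<close> again.\<close>
  then have E': "E = (\<Sum>j<2 * m. scal [:a ^ j / fact j:] * X ^ j)"
    by (simp add: lessThan_Suc_atMost[symmetric] X0)
  have of_nat_scal: "of_nat j = scal [:of_nat j :: 'a:]" for j
    by (induction j) (simp_all add: scal_const_ring one_pCons[symmetric])
  have "E * Y = (\<Sum>j\<le>2 * m. Y * (scal [:a ^ j / fact j:] * X ^ j)) +
      (\<Sum>j\<le>2 * m. scal [:a ^ j / fact j:] * (of_nat j * Z * X ^ (j - 1)))"
    unfolding E sum_distrib_right
    by (simp add: mult.assoc pow distrib_left sum.distrib scal_left_commute)
  also have "(\<Sum>j\<le>2 * m. scal [:a ^ j / fact j:] * (of_nat j * Z * X ^ (j - 1))) =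
      (\<Sum>j<2 * m. scal [:a:] * Z * (scal [:a ^ j / fact j:] * X ^ j))"
  proof -
    have "scal [:a ^ Suc j / fact (Suc j):] * (of_nat (Suc j) * Z * X ^ (Suc j - 1)) =
        scal [:a:] * Z * (scal [:a ^ j / fact j:] * X ^ j)" for j
    proof -
      have "a ^ Suc j / fact (Suc j) * of_nat (Suc j) = a * (a ^ j / fact j)"
        by (simp add: field_simps del: of_nat_Suc)
      then have c: "scal [:a ^ Suc j / fact (Suc j):] * of_nat (Suc j) =
          scal [:a:] * scal [:a ^ j / fact j:]"
        unfolding of_nat_scal scal_const_ring(2)[symmetric] by simp
      have "scal [:a ^ Suc j / fact (Suc j):] * (of_nat (Suc j) * Z * X ^ (Suc j - 1)) =
          (scal [:a ^ Suc j / fact (Suc j):] * of_nat (Suc j)) * (Z * X ^ j)"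
        by (simp only: mult.assoc diff_Suc_1)
      also have "\<dots> = scal [:a:] * (scal [:a ^ j / fact j:] * (Z * X ^ j))"
        by (simp only: c mult.assoc)
      also have "\<dots> = scal [:a:] * Z * (scal [:a ^ j / fact j:] * X ^ j)"
        by (simp only: scal_left_commute[of Z] mult.assoc)
      finally show ?thesis .
    qed
    then show ?thesis by (simp add: sum.atMost_shift del: power_Suc fact_Suc of_nat_Suc)
  qed
  also have "(\<Sum>j<2 * m. scal [:a:] * Z * (scal [:a ^ j / fact j:] * X ^ j)) = scal [:a:] * Z * E"
    by (simp add: E' sum_distrib_left)
  also have "(\<Sum>j\<le>2 * m. Y * (scal [:a ^ j / fact j:] * X ^ j)) = Y * E"
    by (simp add: E sum_distrib_left)
  finally have "E * Y = (Y + scal [:a:] * Z) * E" by (simp add: distrib_right)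
  moreover have "vec_op m (vshear v a w) = Y + scal [:a:] * Z"
  proof -
    have "vshear v a w = (fst w + a * (vpair v w * fst v), snd w + a * (vpair v w * snd v))"
      by (simp add: vshear_def mult_ac)
    then show ?thesis
      by (simp add: vec_op_def Y_def Z_def scal_const_ring distrib_right distrib_left mult.assoc add_ac)
  qed
  ultimately show ?thesis by (simp add: E_def Y_def)
qed

subsection \<open>The action of the special linear group\<close>

definition stabilizes :: "'a::comm_ring_1 linop \<Rightarrow> (nat \<Rightarrow> 'a) set \<Rightarrow> bool" where
  "stabilizes T X \<longleftrightarrow> (\<forall>x\<in>X. app T x \<in> X)"

lemma stabilizesD: "stabilizes T X \<Longrightarrow> x \<in> X \<Longrightarrow> app T x \<in> X"
  by (simp add: stabilizes_def)

lemma stabilizes_1 [simp]: "stabilizes 1 X"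
  by (simp add: stabilizes_def)

lemma stabilizes_mult: "stabilizes S X \<Longrightarrow> stabilizes T X \<Longrightarrow> stabilizes (S * T) X"
  by (simp add: stabilizes_def)

lemma stabilizes_power: "stabilizes T X \<Longrightarrow> stabilizes (T ^ k) X"
  by (induction k) (simp_all add: stabilizes_mult)

definition supported :: "nat \<Rightarrow> (nat \<Rightarrow> 'a::comm_ring_1) set" where
  "supported n = {x. \<forall>i>n. x i = 0}"

text \<open>The summand of binary forms of degree \<open>m\<close>, of dimension
  \<open>m + 1\<close>. The odd operators \<open>vec_op\<close> do not preserve it, but their
  squares along the axes do; its determinant later pins down a scalar.\<close>

definition even_supported :: "nat \<Rightarrow> (nat \<Rightarrow> 'a::comm_ring_1) set" where
  "even_supported n = {x \<in> supported n. \<forall>i. odd i \<longrightarrow> x i = 0}"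

text \<open>SL(2) keeps these vectors free of \<open>t\<close>, which is what tells its operators
  apart from nonempty words of nonlinear shears.\<close>

definition constant_vecs :: "(nat \<Rightarrow> 'a::comm_ring_1 poly) set" where
  "constant_vecs = {x. \<forall>i. degree (x i) = 0}"

text \<open>The subspaces over the constants \<open>K \<subseteq> K[t]\<close>; \<open>constant_vecs\<close> is not one over \<open>K[t]\<close>.\<close>

definition const_subspace :: "(nat \<Rightarrow> 'a::comm_ring_1 poly) set \<Rightarrow> bool" where
  "const_subspace X \<longleftrightarrow> (\<lambda>i. 0) \<in> X \<and>
     (\<forall>x\<in>X. \<forall>y\<in>X. (\<lambda>i. x i + y i) \<in> X) \<and> (\<forall>a. \<forall>x\<in>X. (\<lambda>i. [:a:] * x i) \<in> X)"

lemma const_subspaces: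
  "const_subspace (supported n :: (nat \<Rightarrow> 'a::comm_ring_1 poly) set)"
  "const_subspace (even_supported n :: (nat \<Rightarrow> 'a::comm_ring_1 poly) set)"
  "const_subspace (constant_vecs :: (nat \<Rightarrow> 'a::comm_ring_1 poly) set)"
  by (auto simp: const_subspace_def supported_def even_supported_def constant_vecs_def)
    (metis add_0_right degree_add_le le_zero_eq max_def,
      metis degree_smult_le le_zero_eq)

lemma stabilizes_add: "const_subspace X \<Longrightarrow> stabilizes S X \<Longrightarrow> stabilizes T X \<Longrightarrow> stabilizes (S + T) X"
proof -
  have "app (S + T) x = (\<lambda>i. app S x i + app T x i)" for x by (simp add: fun_eq_iff)
  then show "const_subspace X \<Longrightarrow> stabilizes S X \<Longrightarrow> stabilizes T X \<Longrightarrow> stabilizes (S + T) X"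
    by (simp add: stabilizes_def const_subspace_def)
qed

lemma stabilizes_scal: "const_subspace X \<Longrightarrow> stabilizes (scal [:a:]) X"
proof -
  have "app (scal [:a:]) x = (\<lambda>i. [:a:] * x i)" for x by (simp add: fun_eq_iff)
  then show "const_subspace X \<Longrightarrow> stabilizes (scal [:a:]) X"
    unfolding stabilizes_def const_subspace_def by metis
qed

lemma stabilizes_0: "const_subspace X \<Longrightarrow> stabilizes 0 X"
  using stabilizes_scal[of X 0] by simp

lemma stabilizes_sum:
  "const_subspace X \<Longrightarrow> (\<And>k. k \<in> A \<Longrightarrow> stabilizes (T k) X) \<Longrightarrow> stabilizes (\<Sum>k\<in>A. T k) X"
  by (induction A rule: infinite_finite_induct) (auto simp: stabilizes_0 intro: stabilizes_add)

lemma vec_op_stabilizes: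
  "stabilizes (vec_op m v) (supported (2 * m))" "stabilizes (vec_op m v) constant_vecs"
proof -
  show "stabilizes (vec_op m v) (supported (2 * m))"
    by (simp add: stabilizes_def vec_op_def supported_def app_up_op app_down_op)
  have deg: "degree (up_coeff m i :: 'a poly) = 0" "degree (down_coeff i :: 'a poly) = 0" for i
    by (simp_all add: up_coeff_def down_coeff_def of_nat_poly)
  have mult: "degree (p * q) = 0" if "degree p = 0" "degree q = 0" for p q :: "'a poly"
    using degree_mult_le[of p q] that by simp
  have "stabilizes (up_op m) (constant_vecs :: (nat \<Rightarrow> 'a poly) set)"
    "stabilizes (down_op m) (constant_vecs :: (nat \<Rightarrow> 'a poly) set)"
    by (simp_all add: stabilizes_def constant_vecs_def app_up_op app_down_op mult deg)
  then show "stabilizes (vec_op m v) constant_vecs"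
    unfolding vec_op_def
    by (intro stabilizes_add stabilizes_mult stabilizes_scal const_subspaces)
qed

lemma vec_op_square_stabilizes:
  assumes "v \<in> axes" and "X \<in> {supported (2 * m), even_supported (2 * m), constant_vecs}"
  shows "stabilizes (vec_op m v ^ 2) X"
proof -
  have "stabilizes (vec_op m v ^ 2) (even_supported (2 * m))"
    using assms(1)
    by (auto simp: axes_def stabilizes_def even_supported_def supported_def power2_eq_square
        app_up_op app_down_op)
  then show ?thesis using assms(2) vec_op_stabilizes[of m v] by (auto intro: stabilizes_power)
qed

lemma exp_op_linear_stabilizes:
  assumes "v \<in> axes" and "X \<in> {supported (2 * m), even_supported (2 * m), constant_vecs}"
  shows "stabilizes (exp_op m v (monom a 1)) X"
proof -
  have "const_subspace X" using assms(2) by (auto simp: const_subspaces)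
  then show ?thesis
    unfolding exp_op_linear
    by (intro stabilizes_sum stabilizes_mult stabilizes_scal
        stabilizes_power[OF vec_op_square_stabilizes[OF assms]])
qed

definition apply_cols :: "('a::comm_ring_1 \<times> 'a) \<times> 'a \<times> 'a \<Rightarrow> 'a \<times> 'a \<Rightarrow> 'a \<times> 'a" where
  "apply_cols g z = (fst z * fst (fst g) + snd z * fst (snd g), fst z * snd (fst g) + snd z * snd (snd g))"

text \<open>\<open>sl2_rep m (u, w) A\<close>: the operator \<open>A\<close> represents the matrix with columns \<open>u\<close> and \<open>w\<close>.\<close>

inductive sl2_rep :: "nat \<Rightarrow> ('a::field_char_0 \<times> 'a) \<times> 'a \<times> 'a \<Rightarrow> 'a poly linop \<Rightarrow> bool" for m where
  one: "sl2_rep m ((1, 0), (0, 1)) 1"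
| step: "sl2_rep m (u, w) A \<Longrightarrow> v \<in> axes \<Longrightarrow>
    sl2_rep m (vshear v a u, vshear v a w) (exp_op m v (monom a 1) * A)"

lemma sl2_rep_exists: "vpair u w = 1 \<Longrightarrow> \<exists>A. sl2_rep m (u, w) A"
  using sl2_induct[of "\<lambda>g. \<exists>A. sl2_rep m g A" u w] sl2_rep.intros by metis

lemma sl2_rep_det: "sl2_rep m (u, w) A \<Longrightarrow> vpair u w = 1"
  by (induction "(u, w)" A arbitrary: u w rule: sl2_rep.induct) (auto simp: vpair_vshear, simp add: vpair_def)

lemma sl2_rep_stabilizes:
  assumes "sl2_rep m g A" "X \<in> {supported (2 * m), even_supported (2 * m), constant_vecs}"
  shows "stabilizes A X"
  using assms(1)
proof induction
  case (step u w A v a)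
  show ?case by (intro stabilizes_mult exp_op_linear_stabilizes step assms(2))
qed simp

lemma exp_op_inverse:
  assumes "vec_op m v ^ Suc (2 * m) = 0"
  shows "exp_op m v f * exp_op m v (- f) = 1" "exp_op m v (- f) * exp_op m v f = 1"
  using exp_op_add[OF assms, of f "- f"] exp_op_add[OF assms, of "- f" f] by simp_all

text \<open>Stability under the inverse is carried through the induction: on infinite sequences it
  would not follow from stability under \<open>A\<close>.\<close>

lemma sl2_rep_inverse:
  assumes "sl2_rep m g A"
  shows "\<exists>B. A * B = 1 \<and> B * A = 1 \<and>
    (\<forall>X\<in>{supported (2 * m), even_supported (2 * m), constant_vecs}. stabilizes B X)"
  using assms
proof induction
  case one
  then show ?case by (intro exI[of _ 1]) simp
next
  case (step u w A v a)
  then obtain B where B: "A * B = 1" "B * A = 1"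
    "\<And>X. X \<in> {supported (2 * m), even_supported (2 * m), constant_vecs} \<Longrightarrow> stabilizes B X" by blast
  let ?E = "exp_op m v (monom a 1)" and ?E' = "exp_op m v (monom (- a) 1)"
  have E: "?E * ?E' = 1" "?E' * ?E = 1"
    using exp_op_inverse[OF vec_op_axis_nilpotent[OF step.hyps(2)], where f = "monom a 1"]
    by (simp_all add: minus_monom)
  show ?case
  proof (intro exI[of _ "B * ?E'"] conjI ballI)
    have "?E * A * (B * ?E') = ?E * (A * B) * ?E'" by (simp only: mult.assoc)
    then show "?E * A * (B * ?E') = 1" using B E by simp
    have "B * ?E' * (?E * A) = B * (?E' * ?E) * A" by (simp only: mult.assoc)
    then show "B * ?E' * (?E * A) = 1" using B E by simp
    fix X :: "(nat \<Rightarrow> 'a poly) set"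
    assume X: "X \<in> {supported (2 * m), even_supported (2 * m), constant_vecs}"
    show "stabilizes (B * ?E') X"
      by (intro stabilizes_mult B(3)[OF X] exp_op_linear_stabilizes[OF step.hyps(2) X])
  qed
qed

lemma apply_cols_vshear: "apply_cols (vshear v a u, vshear v a w) z = vshear v a (apply_cols (u, w) z)"
  by (simp add: apply_cols_def vshear_def vpair_def algebra_simps)

lemma sl2_rep_conj:
  assumes "sl2_rep m g A" "m > 0"
  shows "A * vec_op m z = vec_op m (apply_cols g z) * A"
  using assms(1)
proof induction
  case one
  then show ?case by (simp add: apply_cols_def)
next
  case (step u w A v a)
  have "exp_op m v (monom a 1) * A * vec_op m z =
      exp_op m v (monom a 1) * vec_op m (apply_cols (u, w) z) * A"
    by (simp only: mult.assoc step.IH)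
  then show ?case
    by (simp only: exp_op_linear_conj[OF step.hyps(2) assms(2)] apply_cols_vshear mult.assoc)
qed

lemma exists_complement:
  assumes "v \<noteq> (0, 0)"
  shows "\<exists>w. vpair v w = (1 :: 'a::field)"
proof (cases "fst v = 0")
  case True
  then have "snd v \<noteq> 0" using assms by (cases v) auto
  then have "vpair v (- 1 / snd v, 0) = 1" by (simp add: vpair_def)
  then show ?thesis by blast
next
  case False
  then have "vpair v (0, 1 / fst v) = 1" by (simp add: vpair_def)
  then show ?thesis by blast
qed

text \<open>Every nonzero vector is the first column of a matrix in SL(2), so
  \<open>vec_op m v\<close> is conjugate to \<open>up_op m\<close> and inherits its nilpotency and
  the rank of its top power.\<close>

lemma sl2_transitive:
  assumes "v \<noteq> (0, 0)" "m > 0"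
  shows "\<exists>w A B. sl2_rep m (v, w) A \<and> A * B = 1 \<and> B * A = 1 \<and> A * up_op m = vec_op m v * A"
proof -
  obtain w where w: "vpair v w = 1" using exists_complement[OF assms(1)] by blast
  obtain A where A: "sl2_rep m (v, w) A" using sl2_rep_exists[OF w] by blast
  then have "A * vec_op m (1, 0) = vec_op m v * A"
    using sl2_rep_conj[OF A assms(2), of "(1, 0)"] by (simp add: apply_cols_def)
  moreover obtain B where "A * B = 1" "B * A = 1" using sl2_rep_inverse[OF A] by blast
  ultimately show ?thesis using A unfolding vec_op_axes by blast
qed

lemma vec_op_nilpotent:
  assumes "v \<noteq> (0, 0)" "m > 0"
  shows "vec_op m v ^ Suc (2 * m) = 0"
proof -
  obtain A B where AB: "A * B = 1" "A * up_op m = vec_op m v * A"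
    using sl2_transitive[OF assms] by blast
  have "vec_op m v ^ Suc (2 * m) = vec_op m v ^ Suc (2 * m) * A * B" by (simp add: AB mult.assoc del: power_Suc)
  also have "\<dots> = A * up_op m ^ Suc (2 * m) * B" by (simp only: power_conj[OF AB(2)])
  finally show ?thesis by (simp add: up_op_nilpotent del: power_Suc)
qed

lemma vec_op_zero [simp]: "vec_op m (0, 0) = 0"
  by (simp add: vec_op_def)

lemma vec_op_nilpotent': "m > 0 \<Longrightarrow> vec_op m v ^ Suc (2 * m) = 0"
  using vec_op_nilpotent[of v m] by (cases "v = (0, 0)") auto

subsection \<open>The top power of a vector has rank one\<close>

definition unit_seq :: "nat \<Rightarrow> nat \<Rightarrow> 'a::comm_ring_1" where
  "unit_seq j = (\<lambda>i. if i = j then 1 else 0)"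

definition up_prod :: "nat \<Rightarrow> 'a::comm_ring_1" where
  "up_prod m = (\<Prod>l<2 * m. up_coeff m l)"

definition down_prod :: "nat \<Rightarrow> nat \<Rightarrow> 'a::comm_ring_1" where
  "down_prod m j = (\<Prod>l<j. down_coeff (2 * m - l))"

lemma coeff_nonzero:
  "i < 2 * m \<Longrightarrow> up_coeff m i \<noteq> (0 :: 'a::field_char_0)"
  "i > 0 \<Longrightarrow> down_coeff i \<noteq> (0 :: 'a)"
proof -
  show "up_coeff m i \<noteq> (0 :: 'a)" if "i < 2 * m"
  proof -
    have "i div 2 < m" using that by auto
    then show ?thesis by (auto simp: up_coeff_def)
  qed
  show "down_coeff i \<noteq> (0 :: 'a)" if "i > 0"
    using that by (auto simp: down_coeff_def elim!: evenE)
qed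

lemma coeff_poly_const:
  "up_coeff m i = [:up_coeff m i :: 'a::comm_ring_1:]" "down_coeff i = [:down_coeff i :: 'a:]"
  by (simp_all add: up_coeff_def down_coeff_def of_nat_poly one_pCons)

lemma prod_const_poly: "(\<Prod>l\<in>A. [:f l:]) = [:\<Prod>l\<in>A. f l:]"
  by (induction A rule: infinite_finite_induct) (simp_all add: one_pCons mult.commute)

lemma top_coeff_nonzero:
  "up_prod m \<noteq> (0 :: 'a::field_char_0)" "down_prod m (2 * m) \<noteq> (0 :: 'a)"
proof -
  show "up_prod m \<noteq> (0 :: 'a)"
    unfolding up_prod_def using coeff_nonzero(1) by (auto simp: prod_zero_iff)
  have "down_coeff (2 * m - l) \<noteq> (0 :: 'a)" if "l < 2 * m" for l
    using that by (intro coeff_nonzero(2)) simp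
  then show "down_prod m (2 * m) \<noteq> (0 :: 'a)" by (auto simp: down_prod_def prod_zero_iff)
qed

lemma app_up_op_top:
  assumes "m > 0"
  shows "app (up_op m ^ (2 * m)) x = (\<lambda>i. if i = 2 * m then up_prod m * x 0 else 0)"
  using assms by (auto simp: app_up_op_power up_prod_def atLeast0LessThan)

text \<open>From index \<open>2 * m\<close>, an index as low as \<open>2 * m - j\<close> is reached
  in \<open>j\<close> steps only if all of them go down, so a single path contributes.\<close>

lemma app_vec_op_power_lowest:
  assumes "j \<le> 2 * m"
  shows "(\<forall>i < 2 * m - j. app (vec_op m w ^ j) (unit_seq (2 * m)) i = 0) \<and>
    app (vec_op m w ^ j) (unit_seq (2 * m)) (2 * m - j) = [:snd w ^ j * down_prod m j:]"
  using assms
proof (induction j)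
  case 0
  then show ?case by (auto simp: unit_seq_def down_prod_def one_pCons)
next
  case (Suc j)
  let ?y = "app (vec_op m w ^ j) (unit_seq (2 * m))"
  have y: "?y i = 0" if "i < 2 * m - j" for i using that Suc by auto
  have yj: "?y (2 * m - j) = [:snd w ^ j * down_prod m j:]" using Suc by auto
  have *: "app (vec_op m w ^ Suc j) (unit_seq (2 * m)) i =
      [:snd w:] * ([:down_coeff (Suc i):] * ?y (Suc i))" if "i \<le> 2 * m - Suc j" for i
    using that Suc.prems y[of "i - 1"]
    by (auto simp: vec_op_def app_up_op app_down_op coeff_poly_const(2)[of "Suc i"]
        mult.commute)
  have S: "Suc (2 * m - Suc j) = 2 * m - j" using Suc.prems by simp
  show ?case
    using *[of "2 * m - Suc j"] * y yj unfolding S by (simp add: down_prod_def mult_ac)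
qed

text \<open>\<open>up_op m ^ (2 * m)\<close> reads coordinate 0 and writes coordinate
  \<open>2 * m\<close>. The middle factor therefore enters through a single entry, computed by
  \<open>app_vec_op_power_lowest\<close> as a nonzero multiple of
  \<open>snd w ^ (2 * m)\<close>.\<close>

lemma up_vec_up:
  assumes "m > 0" "snd w \<noteq> 0"
  shows "\<exists>\<kappa>\<noteq>0. up_op m ^ (2 * m) * vec_op m w ^ (2 * m) * up_op m ^ (2 * m) =
      scal [:\<kappa>:] * up_op m ^ (2 * m)"
proof -
  define c :: 'a where "c = up_prod m"
  define d :: 'a where "d = snd w ^ (2 * m) * down_prod m (2 * m)"
  have c: "up_prod m = [:c:]"
    unfolding c_def up_prod_def coeff_poly_const by (rule prod_const_poly)
  have "c \<noteq> 0" "d \<noteq> 0"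
    using assms(2) by (simp_all add: c_def d_def top_coeff_nonzero)
  have d: "app (vec_op m w ^ (2 * m)) (unit_seq (2 * m)) 0 = [:d:]"
    using app_vec_op_power_lowest[of "2 * m" m w] by (simp add: d_def)
  have "up_op m ^ (2 * m) * vec_op m w ^ (2 * m) * up_op m ^ (2 * m) = scal [:d * c:] * up_op m ^ (2 * m)"
  proof (rule linop_eqI)
    fix x :: "nat \<Rightarrow> 'a poly" and i
    have "app (up_op m ^ (2 * m)) x = (\<lambda>i. ([:c:] * x 0) * unit_seq (2 * m) i)"
      by (auto simp: app_up_op_top[OF assms(1)] c unit_seq_def)
    then have "app (vec_op m w ^ (2 * m)) (app (up_op m ^ (2 * m)) x) 0 = ([:c:] * x 0) * [:d:]"
      by (simp only: app_scale d)
    then show "app (up_op m ^ (2 * m) * vec_op m w ^ (2 * m) * up_op m ^ (2 * m)) x i =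
        app (scal [:d * c:] * up_op m ^ (2 * m)) x i"
      by (simp add: app_up_op_top[OF assms(1)] c)
  qed
  then show ?thesis using \<open>c \<noteq> 0\<close> \<open>d \<noteq> 0\<close> by (intro exI[of _ "d * c"]) simp
qed

text \<open>Conjugation reduces this to \<open>up_vec_up\<close>. It shows that the top power of
  \<open>v'\<close> does not annihilate any nonzero vector in the image of the top power of
  \<open>v\<close>.\<close>

lemma vec_op_sandwich:
  assumes "m > 0" "vpair v v' \<noteq> 0"
  shows "\<exists>\<kappa>\<noteq>0. vec_op m v ^ (2 * m) * vec_op m v' ^ (2 * m) * vec_op m v ^ (2 * m) =
      scal [:\<kappa>:] * vec_op m v ^ (2 * m)"
proof -
  have "v \<noteq> (0, 0)" using assms(2) by (auto simp: vpair_def)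
  then obtain w A B where AB: "sl2_rep m (v, w) A" "A * B = 1" "B * A = 1" "A * up_op m = vec_op m v * A"
    using sl2_transitive assms(1) by metis
  \<comment> \<open>The coordinates of \<open>v'\<close> in the basis \<open>v\<close>,
    \<open>w\<close>; the second one is nonzero by assumption.\<close>
  define z where "z = (vpair v' w, vpair v v')"
  have "vpair v w = 1" using sl2_rep_det AB(1) by blast
  have "apply_cols (v, w) z = (vpair v w * fst v', vpair v w * snd v')"
    by (simp add: apply_cols_def z_def vpair_def algebra_simps)
  then have "apply_cols (v, w) z = v'" using \<open>vpair v w = 1\<close> by simp
  then have "A * vec_op m z = vec_op m v' * A" using sl2_rep_conj[OF AB(1) assms(1), of z] by simp
  from power_conj[OF this] power_conj[OF AB(4)]
  have 1: "A * vec_op m z ^ (2 * m) = vec_op m v' ^ (2 * m) * A"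
    and 2: "A * up_op m ^ (2 * m) = vec_op m v ^ (2 * m) * A" by blast+
  obtain \<kappa> where \<kappa>: "\<kappa> \<noteq> 0" "up_op m ^ (2 * m) * vec_op m z ^ (2 * m) * up_op m ^ (2 * m) =
      scal [:\<kappa>:] * up_op m ^ (2 * m)"
    using up_vec_up[OF assms(1), of z] assms(2) by (auto simp: z_def)
  let ?V = "vec_op m v ^ (2 * m)" and ?V' = "vec_op m v' ^ (2 * m)" and ?U = "up_op m ^ (2 * m)"
    and ?Z = "vec_op m z ^ (2 * m)"
  have "?V * ?V' * ?V * A = A * (?U * ?Z * ?U)"
  proof -
    have "?V * ?V' * ?V * A = ?V * ?V' * (A * ?U)" by (simp only: 2 mult.assoc)
    also have "\<dots> = ?V * (A * ?Z) * ?U" by (simp only: 1 mult.assoc)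
    also have "\<dots> = (?V * A) * ?Z * ?U" by (simp only: mult.assoc)
    finally show ?thesis by (simp only: 2[symmetric] mult.assoc)
  qed
  also have "\<dots> = scal [:\<kappa>:] * (?V * A)" by (simp only: \<kappa>(2) scal_left_commute 2)
  finally have "?V * ?V' * ?V * A * B = scal [:\<kappa>:] * (?V * A) * B" by simp
  then show ?thesis using \<kappa>(1) AB(2) by (auto simp: mult.assoc)
qed

lemma vec_op_top_nonzero:
  assumes "m > 0" "v \<noteq> (0, 0)"
  shows "\<exists>x \<in> constant_vecs \<inter> supported (2 * m). app (vec_op m v ^ (2 * m)) x \<noteq> (\<lambda>i. 0)"
proof (cases "snd v = 0")
  case True
  then have "fst v \<noteq> 0" using assms(2) by (cases v) auto
  have "vec_op m v = scal [:fst v:] * up_op m" using True by (simp add: vec_op_def)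
  then have "vec_op m v ^ (2 * m) = scal ([:fst v:] ^ (2 * m)) * up_op m ^ (2 * m)"
    by (simp add: scal_mult_power)
  then have "app (vec_op m v ^ (2 * m)) (unit_seq 0) (2 * m) = [:fst v:] ^ (2 * m) * up_prod m"
    by (simp add: app_up_op_top[OF assms(1)] unit_seq_def)
  moreover have "up_prod m = [:up_prod m :: 'a:]"
    unfolding up_prod_def coeff_poly_const by (rule prod_const_poly)
  ultimately have "app (vec_op m v ^ (2 * m)) (unit_seq 0) (2 * m) \<noteq> 0"
    using \<open>fst v \<noteq> 0\<close> top_coeff_nonzero(1)[of m, where 'a = 'a] by simp
  then show ?thesis
    by (intro bexI[of _ "unit_seq 0"]) (auto simp: unit_seq_def constant_vecs_def supported_def fun_eq_iff)
next
  case False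
  have "app (vec_op m v ^ (2 * m)) (unit_seq (2 * m)) 0 \<noteq> 0"
    using app_vec_op_power_lowest[of "2 * m" m v] False
      top_coeff_nonzero(2)[of m, where 'a = 'a] by simp
  then show ?thesis
    by (intro bexI[of _ "unit_seq (2 * m)"])
      (auto simp: unit_seq_def constant_vecs_def supported_def fun_eq_iff)
qed

subsection \<open>Leading coefficients in \<open>t\<close>\<close>

text \<open>A filtration by slope: the degree in \<open>t\<close> is at most \<open>D\<close> times
  the exponent of \<open>T\<close>. By \<open>coeff_bound_mult\<close>, the coefficients on the line
  of slope \<open>D\<close> multiply among themselves.\<close>

definition coeff_bound :: "nat \<Rightarrow> 'a::comm_ring_1 poly poly \<Rightarrow> bool" where
  "coeff_bound D p \<longleftrightarrow> (\<forall>i. degree (coeff p i) \<le> D * i)"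

lemma coeff_bound_mult:
  assumes "coeff_bound D p" "coeff_bound D q"
  shows "coeff_bound D (p * q)"
    "coeff (coeff (p * q) n) (D * n) = (\<Sum>i\<le>n. coeff (coeff p i) (D * i) * coeff (coeff q (n - i)) (D * (n - i)))"
proof -
  have D: "D * n = D * i + D * (n - i)" if "i \<le> n" for i n :: nat
    using that by (simp add: distrib_left[symmetric])
  show "coeff_bound D (p * q)"
    unfolding coeff_bound_def coeff_mult
  proof (intro allI degree_sum_le finite_atMost)
    fix n i :: nat assume i: "i \<in> {..n}"
    have "degree (coeff p i * coeff q (n - i)) \<le> D * i + D * (n - i)"
      using assms by (intro order.trans[OF degree_mult_le] add_mono) (auto simp: coeff_bound_def)
    then show "degree (coeff p i * coeff q (n - i)) \<le> D * n" using D[of i n] i by simp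
  qed
  show "coeff (coeff (p * q) n) (D * n) =
      (\<Sum>i\<le>n. coeff (coeff p i) (D * i) * coeff (coeff q (n - i)) (D * (n - i)))"
    unfolding coeff_mult[of p q] coeff_sum
  proof (intro sum.cong refl)
    fix i assume i: "i \<in> {..n}"
    show "coeff (coeff p i * coeff q (n - i)) (D * n) =
        coeff (coeff p i) (D * i) * coeff (coeff q (n - i)) (D * (n - i))"
      using assms D[of i n] i by (simp add: coeff_bound_def coeff_mult_le_degree)
  qed
qed

text \<open>The point \<open>(k + 1, (k + 1)^2)\<close> with \<open>k + 1 \<le> D\<close> lies on or
  under the line of slope \<open>D\<close> and meets it only for \<open>k + 1 = D\<close>, so just
  the leading coefficient of \<open>f\<close> survives on the line.\<close>

lemma t_poly_top:
  assumes "f \<noteq> 0" "coeff f 0 = 0" "coeff f 1 = 0"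
  defines "D \<equiv> Suc (degree f)"
  shows "coeff_bound D (t_poly f)"
    "coeff (coeff (t_poly f) i) (D * i) = (if i = D then lead_coeff f else 0)"
proof -
  have nz: "2 \<le> k \<and> k \<le> degree f" if "coeff f k \<noteq> 0" for k
  proof -
    have "k \<noteq> 0" "k \<noteq> 1" using that assms(2,3) by metis+
    then show ?thesis using that by (simp add: le_degree)
  qed
  show "coeff_bound D (t_poly f)"
    unfolding coeff_bound_def
  proof
    fix i
    show "degree (coeff (t_poly f) i) \<le> D * i"
    proof (cases i)
      case (Suc k)
      show ?thesis
      proof (cases "coeff f k = 0")
        case False
        then have "t_weight k = Suc k * Suc k" "Suc k \<le> D"
          using nz[of k] by (simp_all add: t_weight_def D_def power2_eq_square)
        then have "t_weight k \<le> D * i" unfolding Suc by (simp only: mult_le_mono1)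
        then show ?thesis using degree_monom_le[of "coeff f k" "t_weight k"]
          by (simp add: coeff_t_poly Suc)
      qed (simp add: coeff_t_poly Suc)
    qed (simp add: coeff_t_poly)
  qed
  show "coeff (coeff (t_poly f) i) (D * i) = (if i = D then lead_coeff f else 0)"
  proof (cases i)
    case (Suc k)
    show ?thesis
    proof (cases "coeff f k = 0")
      case True
      then have "k \<noteq> degree f" using assms(1) by auto
      then show ?thesis using True by (simp add: coeff_t_poly Suc D_def)
    next
      case False
      then have "t_weight k = Suc k * Suc k"
        using nz[of k] by (simp add: t_weight_def power2_eq_square)
      moreover have "Suc k * Suc k = D * Suc k \<longleftrightarrow> Suc k = D" by (simp only: mult_cancel2) simp
      ultimately show ?thesis by (simp add: coeff_t_poly Suc D_def del: mult_Suc mult_Suc_right)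
    qed
  qed (simp add: coeff_t_poly D_def)
qed

lemma t_poly_power_top:
  assumes "f \<noteq> 0" "coeff f 0 = 0" "coeff f 1 = 0"
  defines "D \<equiv> Suc (degree f)"
  shows "coeff_bound D (t_poly f ^ j) \<and>
    (\<forall>n. coeff (coeff (t_poly f ^ j) n) (D * n) = (if n = D * j then lead_coeff f ^ j else 0))"
proof (induction j)
  case 0
  show ?case by (auto simp: coeff_bound_def)
next
  case (Suc j)
  note top = t_poly_top[OF assms(1-3), folded D_def]
  have "coeff (coeff (t_poly f ^ Suc j) n) (D * n) =
      (if n = D * Suc j then lead_coeff f ^ Suc j else 0)" for n
  proof -
    have "coeff (coeff (t_poly f ^ Suc j) n) (D * n) =
        (\<Sum>i\<le>n. if i = D then lead_coeff f * (if n - D = D * j then lead_coeff f ^ j else 0) else 0)"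
      unfolding power_Suc coeff_bound_mult(2)[OF top(1) conjunct1[OF Suc]]
      by (intro sum.cong refl) (auto simp: top(2) Suc)
    also have "\<dots> = (if n = D * Suc j then lead_coeff f ^ Suc j else 0)"
      by (auto simp: le_iff_add)
    finally show ?thesis .
  qed
  then show ?case using coeff_bound_mult(1)[OF top(1) conjunct1[OF Suc]] by simp
qed

text \<open>On that line \<open>t_poly f\<close> is a single monomial whose \<open>j\<close>-th
  power meets \<open>T^n\<close> only for \<open>n = D * j\<close>, so exactly one term of the
  exponential contributes.\<close>

lemma texp_top:
  assumes "f \<noteq> 0" "coeff f 0 = 0" "coeff f 1 = 0"
  defines "D \<equiv> Suc (degree f)"
  assumes "D dvd n"
  shows "coeff_bound D (texp n (t_poly f))"
    "coeff (coeff (texp n (t_poly f)) n) (D * n) = lead_coeff f ^ (n div D) / fact (n div D)"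
proof -
  note top = t_poly_power_top[OF assms(1-3), folded D_def]
  show "coeff_bound D (texp n (t_poly f))"
    using top unfolding coeff_bound_def texp_def
    by (auto simp: coeff_sum intro!: degree_sum_le order.trans[OF degree_smult_le])
  have "D > 0" by (simp add: D_def)
  have "n = D * j \<longleftrightarrow> j = n div D" for j
    using assms(5) \<open>D > 0\<close> by (metis dvd_mult_div_cancel nonzero_mult_div_cancel_left not_less0)
  then have "coeff (coeff (texp n (t_poly f)) n) (D * n) =
      (\<Sum>j\<le>n. if j = n div D then lead_coeff f ^ j / fact j else 0)"
    unfolding texp_def coeff_sum by (intro sum.cong refl) (auto simp: top)
  then show "coeff (coeff (texp n (t_poly f)) n) (D * n) = lead_coeff f ^ (n div D) / fact (n div D)"
    by simp
qed

definition bounded_vec :: "nat \<Rightarrow> (nat \<Rightarrow> 'a::comm_ring_1 poly) \<Rightarrow> bool" where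
  "bounded_vec d x \<longleftrightarrow> (\<forall>i. degree (x i) \<le> d)"

text \<open>The coefficients are kept as constant polynomials so that operators over
  \<open>K[t]\<close> still apply; \<open>vec_op\<close>, being free of \<open>t\<close>, commutes
  with this extraction.\<close>

definition coeff_vec :: "nat \<Rightarrow> (nat \<Rightarrow> 'a::comm_ring_1 poly) \<Rightarrow> nat \<Rightarrow> 'a poly" where
  "coeff_vec d x = (\<lambda>i. [:coeff (x i) d:])"

lemma app_vec_op: "app (vec_op m v) x i =
    smult (fst v) (if 0 < i \<and> i \<le> 2 * m then smult (up_coeff m (i - 1)) (x (i - 1)) else 0) +
    smult (snd v) (if i < 2 * m then smult (down_coeff (Suc i)) (x (Suc i)) else 0)"
  by (simp add: vec_op_def app_up_op app_down_op coeff_poly_const[where 'a = 'a])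

lemma vec_op_lead:
  "bounded_vec d x \<Longrightarrow> bounded_vec d (app (vec_op m v) x)"
  "coeff_vec d (app (vec_op m v) x) = app (vec_op m v) (coeff_vec d x)"
  by (auto simp: bounded_vec_def app_vec_op coeff_vec_def fun_eq_iff
      intro!: degree_add_le order.trans[OF degree_smult_le])

lemma vec_op_power_lead:
  "bounded_vec d x \<Longrightarrow> bounded_vec d (app (vec_op m v ^ k) x)"
  "coeff_vec d (app (vec_op m v ^ k) x) = app (vec_op m v ^ k) (coeff_vec d x)"
  by (induction k) (simp_all add: vec_op_lead)

text \<open>The term with the \<open>k\<close>-th power of \<open>vec_op m v\<close> has degree at
  most \<open>D * k + d\<close> in \<open>t\<close>, which falls short of the bound for
  \<open>k < 2 * m\<close>; only the top power reaches it.\<close>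

lemma exp_op_lead:
  assumes "f \<noteq> 0" "coeff f 0 = 0" "coeff f 1 = 0" "m > 0"
  defines "D \<equiv> Suc (degree f)"
  assumes "D dvd 2 * m" and x: "bounded_vec d x"
  shows "bounded_vec (D * (2 * m) + d) (app (exp_op m v f) x)"
    "\<exists>\<kappa>\<noteq>0. coeff_vec (D * (2 * m) + d) (app (exp_op m v f) x) =
       app (scal [:\<kappa>:] * vec_op m v ^ (2 * m)) (coeff_vec d x)"
proof -
  define p where "p = texp (2 * m) (t_poly f)"
  have p: "\<And>k. degree (coeff p k) \<le> D * k"
    and top: "coeff (coeff p (2 * m)) (D * (2 * m)) = lead_coeff f ^ (2 * m div D) / fact (2 * m div D)"
    using texp_top[OF assms(1-3), of "2 * m"] assms(6) by (simp_all add: p_def D_def coeff_bound_def)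
  define y where "y k = app (vec_op m v ^ k) x" for k
  have y: "degree (y k i) \<le> d" for k i
    using vec_op_power_lead(1)[OF x] by (simp add: y_def bounded_vec_def)
  have E: "app (exp_op m v f) x i = (\<Sum>k<Suc (2 * m). coeff p k * y k i)" for i
    unfolding exp_op_def p_def[symmetric] y_def eval_op_nilpotent[OF vec_op_nilpotent'[OF assms(4)]]
    by (simp add: app_sum)
  have deg: "degree (coeff p k * y k i) \<le> D * k + d" for k i
    using p[of k] y[of k i] by (intro order.trans[OF degree_mult_le] add_mono)
  show "bounded_vec (D * (2 * m) + d) (app (exp_op m v f) x)"
    unfolding bounded_vec_def E
  proof (intro allI degree_sum_le finite_lessThan)
    fix i k assume "k \<in> {..<Suc (2 * m)}"
    then have "D * k + d \<le> D * (2 * m) + d" by simp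
    then show "degree (coeff p k * y k i) \<le> D * (2 * m) + d" using deg order.trans by blast
  qed
  define \<kappa> where "\<kappa> = lead_coeff f ^ (2 * m div D) / fact (2 * m div D)"
  have "coeff (app (exp_op m v f) x i) (D * (2 * m) + d) = \<kappa> * coeff (y (2 * m) i) d" for i
  proof -
    have "coeff (coeff p k * y k i) (D * (2 * m) + d) = 0" if "k < 2 * m" for k
    proof (rule coeff_eq_0)
      have "D > 0" by (simp add: D_def)
      then have "D * k + d < D * (2 * m) + d" using that by simp
      then show "degree (coeff p k * y k i) < D * (2 * m) + d" using deg order.strict_trans1 by blast
    qed
    then have "coeff (app (exp_op m v f) x i) (D * (2 * m) + d) =
        coeff (coeff p (2 * m) * y (2 * m) i) (D * (2 * m) + d)"
      by (simp add: E coeff_sum)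
    also have "\<dots> = \<kappa> * coeff (y (2 * m) i) d"
      using coeff_mult_le_degree[OF p y, of "2 * m" "2 * m" i] by (simp add: top \<kappa>_def)
    finally show ?thesis .
  qed
  then have "coeff_vec (D * (2 * m) + d) (app (exp_op m v f) x) =
      (\<lambda>i. [:\<kappa>:] * coeff_vec d (y (2 * m)) i)"
    by (simp add: coeff_vec_def mult.commute[of _ \<kappa>])
  also have "\<dots> = app (scal [:\<kappa>:] * vec_op m v ^ (2 * m)) (coeff_vec d x)"
    by (simp add: fun_eq_iff y_def vec_op_power_lead(2))
  finally show "\<exists>\<kappa>\<noteq>0. coeff_vec (D * (2 * m) + d) (app (exp_op m v f) x) =
       app (scal [:\<kappa>:] * vec_op m v ^ (2 * m)) (coeff_vec d x)"
    using assms(1) by (intro exI[of _ \<kappa>]) (simp add: \<kappa>_def)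
qed

definition op_word :: "nat \<Rightarrow> (('a::field_char_0 \<times> 'a) \<times> 'a poly) list \<Rightarrow> 'a poly linop" where
  "op_word m ws = foldr (\<lambda>(v, f) T. exp_op m v f * T) ws 1"

lemma op_word_simps [simp]:
  "op_word m [] = 1" "op_word m ((v, f) # ws) = exp_op m v f * op_word m ws"
  by (simp_all add: op_word_def)

text \<open>The witness \<open>y\<close> strengthens the induction: the leading vector is not merely
  nonzero but lies in the image of the top power of the head vector. By
  \<open>vec_op_sandwich\<close> the next letter cannot annihilate it.\<close>

lemma op_word_lead:
  assumes "reduced ws" "ws \<noteq> []" "m > 0" "\<forall>(v, f)\<in>set ws. Suc (degree f) dvd 2 * m"
  shows "\<exists>x\<in>constant_vecs \<inter> supported (2 * m). \<exists>d\<ge>1. \<exists>y.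
    bounded_vec d (app (op_word m ws) x) \<and>
    coeff_vec d (app (op_word m ws) x) = app (vec_op m (fst (hd ws)) ^ (2 * m)) y \<and>
    coeff_vec d (app (op_word m ws) x) \<noteq> (\<lambda>i. 0)"
  using assms(1,2,4)
proof (induction ws)
  case (Cons a ws)
  obtain v f where a: "a = (v, f)" by (cases a)
  have f: "f \<noteq> 0" "coeff f 0 = 0" "coeff f 1 = 0" "v \<noteq> (0, 0)" "Suc (degree f) dvd 2 * m"
    using Cons.prems by (auto simp: a)
  let ?D = "Suc (degree f) * (2 * m)"
  have D: "?D \<ge> 1" using assms(3) by simp
  have scal_nz: "(\<lambda>i. [:\<kappa>:] * z i) \<noteq> (\<lambda>i. 0)" if "\<kappa> \<noteq> 0" "z \<noteq> (\<lambda>i. 0)" for \<kappa> :: 'a and z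
    using that by (auto simp: fun_eq_iff)
  have app_scal: "app (scal [:\<kappa>:] * T) z = (\<lambda>i. [:\<kappa>:] * app T z i)" for \<kappa> :: 'a and T z
    by (simp add: fun_eq_iff)
  have app_scal': "app (scal [:\<kappa>:] * T) z = app T (\<lambda>i. [:\<kappa>:] * z i)" for \<kappa> :: 'a and T z
    by (simp only: app_scal app_scale fun_eq_iff) simp
  show ?case
  proof (cases ws)
    case Nil
    obtain x where x: "x \<in> constant_vecs \<inter> supported (2 * m)" "app (vec_op m v ^ (2 * m)) x \<noteq> (\<lambda>i. 0)"
      using vec_op_top_nonzero[OF assms(3) f(4)] by blast
    have bx: "bounded_vec 0 x" and cx: "coeff_vec 0 x = x"
      using x(1) by (auto simp: bounded_vec_def constant_vecs_def coeff_vec_def fun_eq_iff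
          elim!: degree_eq_zeroE) (metis degree_eq_zeroE coeff_pCons_0)
    note lead = exp_op_lead[OF f(1-3) assms(3) f(5) bx, of v]
    obtain \<kappa> where \<kappa>: "\<kappa> \<noteq> 0" "coeff_vec (?D + 0) (app (exp_op m v f) x) =
        app (scal [:\<kappa>:] * vec_op m v ^ (2 * m)) x"
      using lead(2) unfolding cx by blast
    have nz: "coeff_vec (?D + 0) (app (exp_op m v f) x) \<noteq> (\<lambda>i. 0)"
      unfolding \<kappa>(2) app_scal using scal_nz[OF \<kappa>(1) x(2)] .
    show ?thesis
      using x(1) D lead(1) nz \<kappa>(2)[unfolded app_scal']
      by (intro bexI[of _ x] exI[of _ "?D + 0"] conjI exI[of _ "\<lambda>i. [:\<kappa>:] * x i"])
        (simp_all add: a Nil)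
  next
    case (Cons b ws')
    let ?v' = "fst (hd ws)" and ?N = "2 * m"
    obtain x d y where x: "x \<in> constant_vecs \<inter> supported (2 * m)" and
      b: "bounded_vec d (app (op_word m ws) x)" and
      y: "coeff_vec d (app (op_word m ws) x) = app (vec_op m ?v' ^ ?N) y" and
      nz: "coeff_vec d (app (op_word m ws) x) \<noteq> (\<lambda>i. 0)"
      using Cons.IH Cons.prems Cons by (auto simp: a)
    have "vpair ?v' v \<noteq> 0" using Cons.prems Cons by (auto simp: a)
    then obtain \<kappa>' where \<kappa>': "\<kappa>' \<noteq> 0" "vec_op m ?v' ^ ?N * vec_op m v ^ ?N * vec_op m ?v' ^ ?N =
      scal [:\<kappa>':] * vec_op m ?v' ^ ?N"
      using vec_op_sandwich[OF assms(3)] by blast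
    note lead = exp_op_lead[OF f(1-3) assms(3) f(5) b, of v]
    obtain \<kappa> where \<kappa>: "\<kappa> \<noteq> 0" "coeff_vec (?D + d) (app (exp_op m v f) (app (op_word m ws) x)) =
        app (scal [:\<kappa>:] * vec_op m v ^ ?N) (app (vec_op m ?v' ^ ?N) y)"
      using lead(2) unfolding y by blast
    have "app (vec_op m v ^ ?N) (app (vec_op m ?v' ^ ?N) y) \<noteq> (\<lambda>i. 0)"
    proof
      assume 0: "app (vec_op m v ^ ?N) (app (vec_op m ?v' ^ ?N) y) = (\<lambda>i. 0)"
      have "app (scal [:\<kappa>':] * vec_op m ?v' ^ ?N) y = (\<lambda>i. 0)"
        unfolding \<kappa>'(2)[symmetric] by (simp add: 0 fun_eq_iff)
      then show False using scal_nz[OF \<kappa>'(1) nz] unfolding y app_scal by simp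
    qed
    then have nz': "coeff_vec (?D + d) (app (exp_op m v f) (app (op_word m ws) x)) \<noteq> (\<lambda>i. 0)"
      unfolding \<kappa>(2) app_scal using scal_nz[OF \<kappa>(1)] by blast
    show ?thesis
      using x D lead(1) nz' \<kappa>(2)[unfolded app_scal']
      by (intro bexI[of _ x] exI[of _ "?D + d"] conjI
          exI[of _ "\<lambda>i. [:\<kappa>:] * app (vec_op m ?v' ^ ?N) y i"]) (simp_all add: a)
  qed
qed simp

text \<open>If the product were trivial, the word would act on \<open>supported (2 * m)\<close> as
  the inverse of \<open>A\<close>, which keeps constant vectors constant; but the word gives some
  constant vector a positive degree in \<open>t\<close>.\<close>

lemma op_word_nontrivial:
  assumes "reduced ws" "ws \<noteq> []" "m > 0" "\<forall>(v, f)\<in>set ws. Suc (degree f) dvd 2 * m"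
    and A: "sl2_rep m g A"
  shows "\<exists>x\<in>supported (2 * m). app (op_word m ws * A) x \<noteq> x"
proof (rule ccontr)
  assume "\<not> ?thesis"
  then have triv: "app (op_word m ws * A) x = x" if "x \<in> supported (2 * m)" for x using that by blast
  obtain B where B: "A * B = 1" "stabilizes B (supported (2 * m))" "stabilizes B constant_vecs"
    using sl2_rep_inverse[OF A] by blast
  obtain x d where x: "x \<in> constant_vecs" "x \<in> supported (2 * m)" "d \<ge> 1"
    "coeff_vec d (app (op_word m ws) x) \<noteq> (\<lambda>i. 0)"
    using op_word_lead[OF assms(1-4)] by blast
  have "app A (app B x) = x" using B(1) by (metis app_simps(2,6))
  then have "app (op_word m ws) x = app B x"
    using triv[of "app B x"] stabilizesD[OF B(2) x(2)] by simp
  moreover have "app B x \<in> constant_vecs" using stabilizesD[OF B(3) x(1)] .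
  ultimately have "coeff_vec d (app (op_word m ws) x) = (\<lambda>i. 0)"
    using x(3) by (auto simp: coeff_vec_def constant_vecs_def coeff_eq_0)
  then show False using x(4) by simp
qed

subsection \<open>Matrices and determinants\<close>

definition seq_span :: "(nat \<Rightarrow> nat) \<Rightarrow> nat \<Rightarrow> (nat \<Rightarrow> 'a::comm_ring_1) set" where
  "seq_span \<iota> n = {x. \<forall>k. k \<notin> \<iota> ` {..<n} \<longrightarrow> x k = 0}"

text \<open>The map \<open>\<iota>\<close> selects the coordinates: the identity for the whole
  space, doubling for the even part.\<close>

definition op_mat :: "(nat \<Rightarrow> nat) \<Rightarrow> nat \<Rightarrow> 'a::comm_ring_1 linop \<Rightarrow> 'a mat" where
  "op_mat \<iota> n T = mat n n (\<lambda>(i, j). app T (unit_seq (\<iota> j)) (\<iota> i))"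

lemma op_mat_carrier [simp]: "op_mat \<iota> n T \<in> carrier_mat n n"
  by (simp add: op_mat_def)

lemma unit_seq_in_span: "j < n \<Longrightarrow> unit_seq (\<iota> j) \<in> seq_span \<iota> n"
  by (auto simp: seq_span_def unit_seq_def)

lemma app_seq_span:
  assumes "inj_on \<iota> {..<n}" "x \<in> seq_span \<iota> n"
  shows "app T x i = (\<Sum>k<n. x (\<iota> k) * app T (unit_seq (\<iota> k)) i)"
proof -
  have "x = (\<lambda>i. \<Sum>k<n. x (\<iota> k) * unit_seq (\<iota> k) i)"
  proof
    fix i
    show "x i = (\<Sum>k<n. x (\<iota> k) * unit_seq (\<iota> k) i)"
    proof (cases "i \<in> \<iota> ` {..<n}")
      case True
      then obtain j where j: "j < n" "i = \<iota> j" by blast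
      have "(\<Sum>k<n. x (\<iota> k) * unit_seq (\<iota> k) i) = (\<Sum>k<n. if k = j then x (\<iota> k) else 0)"
        using j assms(1) by (intro sum.cong) (auto simp: unit_seq_def inj_on_eq_iff)
      then show ?thesis using j by simp
    next
      case False
      then have "(\<Sum>k<n. x (\<iota> k) * unit_seq (\<iota> k) i) = 0"
        by (intro sum.neutral) (auto simp: unit_seq_def)
      then show ?thesis using False assms(2) by (simp add: seq_span_def)
    qed
  qed
  then have "app T x i = app T (\<lambda>i. \<Sum>k<n. x (\<iota> k) * unit_seq (\<iota> k) i) i" by simp
  also have "\<dots> = (\<Sum>k<n. x (\<iota> k) * app T (unit_seq (\<iota> k)) i)"
    by (simp only: app_sum_vec app_scale)
  finally show ?thesis .
qed

lemma op_mat_mult: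
  assumes "inj_on \<iota> {..<n}" "stabilizes T (seq_span \<iota> n)"
  shows "op_mat \<iota> n (S * T) = op_mat \<iota> n S * op_mat \<iota> n T"
proof (rule eq_matI)
  fix i j assume "i < dim_row (op_mat \<iota> n S * op_mat \<iota> n T)" "j < dim_col (op_mat \<iota> n S * op_mat \<iota> n T)"
  then have ij: "i < n" "j < n" by (simp_all add: op_mat_def)
  have "app T (unit_seq (\<iota> j)) \<in> seq_span \<iota> n"
    using assms(2) unit_seq_in_span[OF ij(2)] by (rule stabilizesD)
  then have "app S (app T (unit_seq (\<iota> j))) (\<iota> i) =
      (\<Sum>k<n. app T (unit_seq (\<iota> j)) (\<iota> k) * app S (unit_seq (\<iota> k)) (\<iota> i))"
    by (rule app_seq_span[OF assms(1)])
  then show "op_mat \<iota> n (S * T) $$ (i, j) = (op_mat \<iota> n S * op_mat \<iota> n T) $$ (i, j)"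
    using ij by (simp add: op_mat_def scalar_prod_def atLeast0LessThan mult.commute)
qed (simp_all add: op_mat_def)

lemma op_mat_scalar:
  assumes "inj_on \<iota> {..<n}" "\<And>x. x \<in> seq_span \<iota> n \<Longrightarrow> app T x = (\<lambda>i. c * x i)"
  shows "op_mat \<iota> n T = c \<cdot>\<^sub>m 1\<^sub>m n"
proof -
  have "app T (unit_seq (\<iota> j)) (\<iota> i) = c * unit_seq (\<iota> j) (\<iota> i)" if "j < n" for i j
    using assms(2)[OF unit_seq_in_span[OF that]] by simp
  then show ?thesis
    using assms(1) by (intro eq_matI) (auto simp: op_mat_def unit_seq_def inj_on_eq_iff)
qed

lemma op_mat_one: "inj_on \<iota> {..<n} \<Longrightarrow> op_mat \<iota> n 1 = 1\<^sub>m n"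
  by (subst op_mat_scalar[where c = 1]) auto

lemma det_op_mat_mult:
  assumes "inj_on \<iota> {..<n}" "stabilizes T (seq_span \<iota> n)"
  shows "det (op_mat \<iota> n (S * T)) = det (op_mat \<iota> n S) * det (op_mat \<iota> n T)"
  by (simp add: op_mat_mult[OF assms] det_mult[where n = n])

lemma supported_eq_span: "supported (2 * m) = seq_span (\<lambda>i. i) (Suc (2 * m))"
  by (auto simp: supported_def seq_span_def)

lemma even_supported_eq_span: "even_supported (2 * m) = seq_span (\<lambda>i. 2 * i) (Suc m)"
proof -
  have "k \<in> (\<lambda>i. 2 * i) ` {..<Suc m} \<longleftrightarrow> k \<le> 2 * m \<and> even k" for k
  proof
    assume "k \<le> 2 * m \<and> even k"
    then have "k = 2 * (k div 2)" "k div 2 \<in> {..<Suc m}" by auto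
    then show "k \<in> (\<lambda>i. 2 * i) ` {..<Suc m}" by (rule image_eqI)
  qed auto
  then have *: "k \<notin> (\<lambda>i. 2 * i) ` {..<Suc m} \<longleftrightarrow> k > 2 * m \<or> odd k" for k
    by (simp only: not_le de_Morgan_conj)
  show ?thesis
    unfolding even_supported_def supported_def seq_span_def * by auto
qed

text \<open>A diagonal matrix conjugates \<open>exp_op m v g\<close> to \<open>exp_op m v f * exp_op m v g\<close>, so that
  \<open>exp_op m v f\<close> is a commutator.\<close>

lemma det_exp_op:
  fixes f g :: "'a::field_char_0 poly"
  assumes v: "v \<in> axes" and "m > 0" and g: "smult 2 (pcompose g [:0, 2:]) = f + g"
    and X: "inj_on \<iota> {..<n}"
      "seq_span \<iota> n \<in> {supported (2 * m), even_supported (2 * m), constant_vecs :: (nat \<Rightarrow> 'a poly) set}"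
    and stab: "stabilizes (exp_op m v g) (seq_span \<iota> n)"
      "stabilizes (exp_op m v (- g)) (seq_span \<iota> n)"
  shows "det (op_mat \<iota> n (exp_op m v f)) = 1"
proof -
  let ?d = "\<lambda>T. det (op_mat \<iota> n T)"
  \<comment> \<open>One of diag(2, 1/2) and its inverse doubles the axis vector.\<close>
  have "\<exists>u w. vpair u w = 1 \<and> apply_cols (u, w) v = (2 * fst v, 2 * snd v)"
  proof (cases "v = (1, 0)")
    case True
    then show ?thesis
      by (intro exI[of _ "(2, 0)"] exI[of _ "(0, 1 / 2)"]) (simp add: vpair_def apply_cols_def)
  next
    case False
    then have "v = (0, 1)" using v by (auto simp: axes_def)
    then show ?thesis
      by (intro exI[of _ "(1 / 2, 0)"] exI[of _ "(0, 2)"]) (simp add: vpair_def apply_cols_def)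
  qed
  then obtain u w where uw: "vpair u w = 1" "apply_cols (u, w) v = (2 * fst v, 2 * snd v)" by blast
  obtain A where A: "sl2_rep m (u, w) A" using sl2_rep_exists uw(1) by blast
  obtain B where "A * B = 1" and
    "\<forall>X\<in>{supported (2 * m), even_supported (2 * m), constant_vecs}. stabilizes B X"
    using sl2_rep_inverse[OF A] by blast
  then have B: "A * B = 1" "stabilizes B (seq_span \<iota> n)" using X(2) by blast+
  have stabA: "stabilizes A (seq_span \<iota> n)" using sl2_rep_stabilizes[OF A X(2)] .
  have nil: "vec_op m v ^ Suc (2 * m) = 0" using vec_op_axis_nilpotent[OF v] .
  have "A * vec_op m v = vec_op m (2 * fst v, 2 * snd v) * A"
    using sl2_rep_conj[OF A \<open>m > 0\<close>, of v] by (simp add: uw)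
  then have "A * exp_op m v g = exp_op m (2 * fst v, 2 * snd v) g * A" by (rule exp_op_conj)
  also have "\<dots> = exp_op m v f * (exp_op m v g * A)"
    by (simp add: exp_op_scale g exp_op_add[OF nil] mult.assoc)
  finally have "?d (A * exp_op m v g) = ?d (exp_op m v f * (exp_op m v g * A))" by simp
  then have "?d A * ?d (exp_op m v g) = ?d (exp_op m v f) * (?d (exp_op m v g) * ?d A)"
    by (simp add: det_op_mat_mult[OF X(1)] stabA stab stabilizes_mult)
  moreover have "?d A * ?d B = 1"
    using det_op_mat_mult[OF X(1) B(2), of A] by (simp add: B(1) op_mat_one[OF X(1)])
  moreover have "?d (exp_op m v g) * ?d (exp_op m v (- g)) = 1"
    using det_op_mat_mult[OF X(1) stab(2), of "exp_op m v g"]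
    by (simp add: exp_op_inverse[OF nil] op_mat_one[OF X(1)])
  ultimately have "?d (exp_op m v f) * (?d (exp_op m v g) * ?d A) = 1 * (?d (exp_op m v g) * ?d A)"
    and "?d (exp_op m v g) * ?d A \<noteq> 0"
    by (simp_all add: mult.commute) auto
  then show ?thesis by (metis mult_right_cancel)
qed

lemma exp_op_stabilizes_supported: "m > 0 \<Longrightarrow> stabilizes (exp_op m v f) (supported (2 * m))"
proof -
  assume "m > 0"
  have "stabilizes (scal c) (supported (2 * m))" for c :: "'a poly"
    by (simp add: stabilizes_def supported_def)
  then show ?thesis
    unfolding exp_op_def eval_op_nilpotent[OF vec_op_nilpotent'[OF \<open>m > 0\<close>]]
    by (intro stabilizes_sum const_subspaces stabilizes_mult stabilizes_power vec_op_stabilizes)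
qed

lemma det_exp_op_full:
  assumes "v \<in> axes" "m > 0"
  shows "det (op_mat (\<lambda>i. i) (Suc (2 * m)) (exp_op m v f)) = 1"
proof -
  \<comment> \<open>Solves \<open>2^(k+1) * g_k = f_k + g_k\<close> in each degree, which
    characteristic zero permits.\<close>
  define g where "g = (\<Sum>k\<le>degree f. monom (coeff f k / (2 ^ Suc k - 1)) k)"
  have cg: "coeff g k = coeff f k / (2 ^ Suc k - 1)" for k
  proof -
    have "coeff g k = (\<Sum>j\<le>degree f. if j = k then coeff f k / (2 ^ Suc k - 1) else 0)"
      unfolding g_def coeff_sum by (intro sum.cong) auto
    then show ?thesis by (auto simp: coeff_eq_0)
  qed
  have nz: "2 ^ Suc k - 1 \<noteq> (0 :: 'a)" for k
  proof
    assume "2 ^ Suc k - 1 = (0 :: 'a)"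
    then have "of_nat (2 ^ Suc k) = (of_nat 1 :: 'a)" by simp
    then have "(2 :: nat) ^ Suc k = 1" by (simp only: of_nat_eq_iff)
    then show False by simp
  qed
  have "smult 2 (pcompose g [:0, 2:]) = f + g"
  proof (rule poly_eqI)
    fix k
    have "2 ^ Suc k * (coeff f k / (2 ^ Suc k - 1)) = coeff f k + coeff f k / (2 ^ Suc k - 1)"
      using nz[of k] by (simp add: field_simps del: power_Suc)
    then show "coeff (smult 2 (pcompose g [:0, 2:])) k = coeff (f + g) k"
      by (simp add: coeff_pcompose_linear cg mult.assoc)
  qed
  then show ?thesis
    by (rule det_exp_op[OF assms])
      (use exp_op_stabilizes_supported[OF assms(2)] in \<open>simp_all add: supported_eq_span\<close>)
qed

section \<open>Operators representing the identity matrix\<close>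

lemma sl2_rep_det_op_mat:
  fixes A :: "'a::field_char_0 poly linop"
  assumes "sl2_rep m g A" "m > 0" and X: "inj_on \<iota> {..<n}"
    "seq_span \<iota> n \<in> {supported (2 * m), even_supported (2 * m), constant_vecs :: (nat \<Rightarrow> 'a poly) set}"
  shows "det (op_mat \<iota> n A) = 1"
  using assms(1)
proof induction
  case one
  then show ?case by (simp add: op_mat_one[OF X(1)])
next
  case (step u w A v a)
  \<comment> \<open>With \<open>b\<close> the coefficient of the auxiliary linear polynomial,
    \<open>4 b = a + b\<close> gives \<open>b = a / 3\<close>. Its linearity ensures stability of
    the even part as well.\<close>
  have "smult 2 (pcompose (monom (a / 3) 1) [:0, 2:]) = monom a 1 + monom (a / 3) 1"
    by (rule poly_eqI) (auto simp: coeff_pcompose_linear)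
  then have "det (op_mat \<iota> n (exp_op m v (monom a 1))) = 1"
    by (rule det_exp_op[OF step.hyps(2) assms(2) _ X])
      (unfold minus_monom, (rule exp_op_linear_stabilizes[OF step.hyps(2) X(2)])+)
  then show ?case
    by (simp only: det_op_mat_mult[OF X(1) sl2_rep_stabilizes[OF step.hyps(1) X(2)]] step.IH mult_1)
qed

text \<open>Schur's lemma by hand: \<open>A\<close> commutes with every \<open>vec_op\<close>, so it
  preserves the kernel of \<open>down_op\<close>, spanned within \<open>supported (2 * m)\<close> by
  the lowest vector; powers of \<open>up_op\<close> carry the scalar from there to all
  coordinates.\<close>

lemma sl2_rep_one_scalar:
  fixes A :: "'a::field_char_0 poly linop"
  assumes "sl2_rep m ((1, 0), (0, 1)) A" "m > 0"
  shows "\<exists>c. \<forall>x\<in>supported (2 * m). app A x = (\<lambda>i. c * x i)"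
proof -
  have comm: "A * vec_op m z = vec_op m z * A" for z
    using sl2_rep_conj[OF assms, of z] by (simp add: apply_cols_def)
  have stab: "stabilizes A (supported (2 * m))" using sl2_rep_stabilizes[OF assms(1)] by simp
  define c where "c = app A (unit_seq 0) 0"
  have unit: "unit_seq k \<in> supported (2 * m)" if "k \<le> 2 * m" for k
    using that by (auto simp: unit_seq_def supported_def)
  have A0: "app A (unit_seq 0) = (\<lambda>i. c * unit_seq 0 i)"
  proof
    fix i
    have "app (down_op m) (app A (unit_seq 0)) = app A (app (down_op m) (unit_seq 0))"
      using comm[of "(0, 1)"] by (metis app_simps(6) vec_op_axes(2))
    also have "app (down_op m) (unit_seq 0) = (\<lambda>i. 0 :: 'a poly)"
      by (auto simp: app_down_op unit_seq_def)
    finally have 0: "app (down_op m) (app A (unit_seq 0)) i = 0" for i by simp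
    show "app A (unit_seq 0) i = c * unit_seq 0 i"
    proof (cases i)
      case (Suc j)
      show ?thesis
      proof (cases "i \<le> 2 * m")
        case True
        then show ?thesis
          using 0[of j] coeff_nonzero(2)[of i, where 'a = 'a] Suc
          by (simp add: app_down_op unit_seq_def coeff_poly_const[where 'a = 'a])
      next
        case False
        then show ?thesis
          using stabilizesD[OF stab unit[of 0]] by (simp add: supported_def unit_seq_def Suc)
      qed
    qed (simp add: c_def unit_seq_def)
  qed
  have Ak: "app A (unit_seq k) i = c * unit_seq k i" if k: "k \<le> 2 * m" for k i
  proof -
    define u :: "'a poly" where "u = (\<Prod>l<k. up_coeff m l)"
    have "u = [:\<Prod>l<k. up_coeff m l:]"
      unfolding u_def coeff_poly_const[where 'a = 'a] by (rule prod_const_poly)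
    then have "u \<noteq> 0" using k coeff_nonzero(1)[where 'a = 'a] by (auto simp: prod_zero_iff)
    have up: "app (up_op m ^ k) (unit_seq 0) = (\<lambda>i. u * unit_seq k i)"
      using k by (auto simp: app_up_op_power unit_seq_def u_def atLeast0LessThan)
    have "A * up_op m ^ k = up_op m ^ k * A"
      using power_conj[OF comm[of "(1, 0)"]] by simp
    then have "app A (app (up_op m ^ k) (unit_seq 0)) i = app (up_op m ^ k) (app A (unit_seq 0)) i"
      by (metis app_simps(6))
    then have "u * app A (unit_seq k) i = c * (u * unit_seq k i)"
      unfolding A0 up app_scale by (simp only: up)
    then show ?thesis using \<open>u \<noteq> 0\<close> by simp
  qed
  have "app A x i = c * x i" if x: "x \<in> supported (2 * m)" for x i
  proof -
    have inj: "inj_on (\<lambda>i. i) {..<Suc (2 * m)}" by simp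
    note expand = app_seq_span[OF inj x[unfolded supported_eq_span]]
    have "app A x i = (\<Sum>k<Suc (2 * m). x k * (c * unit_seq k i))"
      unfolding expand by (intro sum.cong) (auto simp: Ak)
    also have "\<dots> = c * app 1 x i"
      unfolding expand[of 1] sum_distrib_left by (intro sum.cong) (auto simp: mult_ac)
    finally show ?thesis by simp
  qed
  then show ?thesis by (intro exI[of _ c]) auto
qed

text \<open>The two determinants show that the scalar is a root of unity of the coprime orders
  \<open>2 m + 1\<close> and \<open>m + 1\<close>.\<close>

lemma sl2_rep_one_trivial:
  assumes A: "sl2_rep m ((1, 0), (0, 1)) A" and "m > 0" and x: "x \<in> supported (2 * m)"
  shows "app A x = x"
proof -
  obtain c where c: "\<And>x. x \<in> supported (2 * m) \<Longrightarrow> app A x = (\<lambda>i. c * x i)"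
    using sl2_rep_one_scalar[OF A \<open>m > 0\<close>] by blast
  have inj: "inj_on (\<lambda>i. i) {..<Suc (2 * m)}" "inj_on (\<lambda>i. 2 * i) {..<Suc m}"
    by (auto simp: inj_on_def)
  have "op_mat (\<lambda>i. i) (Suc (2 * m)) A = c \<cdot>\<^sub>m 1\<^sub>m (Suc (2 * m))"
    using c by (intro op_mat_scalar[OF inj(1)]) (simp add: supported_eq_span)
  moreover have "det (op_mat (\<lambda>i. i) (Suc (2 * m)) A) = 1"
    by (rule sl2_rep_det_op_mat[OF A \<open>m > 0\<close> inj(1)]) (simp add: supported_eq_span)
  ultimately have 1: "c ^ Suc (2 * m) = 1" by (simp add: det_smult)
  have "op_mat (\<lambda>i. 2 * i) (Suc m) A = c \<cdot>\<^sub>m 1\<^sub>m (Suc m)"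
    using c by (intro op_mat_scalar[OF inj(2)])
      (simp add: even_supported_eq_span[symmetric] even_supported_def)
  moreover have "det (op_mat (\<lambda>i. 2 * i) (Suc m) A) = 1"
    by (rule sl2_rep_det_op_mat[OF A \<open>m > 0\<close> inj(2)]) (simp add: even_supported_eq_span)
  ultimately have 2: "c ^ Suc m = 1" by (simp add: det_smult)
  have "c * c ^ Suc (2 * m) = c ^ (Suc m * 2)" by (simp add: mult.commute[of m])
  also have "\<dots> = (c ^ Suc m) ^ 2" by (rule power_mult)
  finally have "c * c ^ Suc (2 * m) = (c ^ Suc m) ^ 2" .
  then have "c = 1" using 1 2 by simp
  then show ?thesis using c[OF x] by simp
qed

subsection \<open>The correspondence between automorphisms and operators\<close>

text \<open>The subgroup of pairs generated by the shears along the axes and their operators; it turns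
  out to be the graph of an injective homomorphism.\<close>

inductive rep_graph :: "nat \<Rightarrow> nat \<Rightarrow> 'a::field_char_0 bipoly \<times> 'a bipoly \<Rightarrow> 'a poly linop \<Rightarrow> bool"
  for n m where
  one: "rep_graph n m id_plane 1"
| step: "rep_graph n m \<phi> A \<Longrightarrow> v \<in> axes \<Longrightarrow> coeff f 0 = 0 \<Longrightarrow> degree f < n \<Longrightarrow>
    rep_graph n m (shear v f \<phi>) (exp_op m v f * A)"

lemma rep_graph_mult:
  assumes "rep_graph n m \<phi> A" "rep_graph n m \<psi> B"
  shows "rep_graph n m (comp_plane \<phi> \<psi>) (A * B)"
  using assms(1)
proof induction
  case (step \<phi> A v f)
  then show ?case using rep_graph.step[OF step.IH step.hyps(2-4)]
    by (simp add: shear_comp mult.assoc)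
qed (simp add: assms(2))

lemma rep_graph_inverse:
  assumes "rep_graph n m \<phi> A"
  shows "\<exists>\<psi> B. rep_graph n m \<psi> B \<and> comp_plane \<psi> \<phi> = id_plane \<and> comp_plane \<phi> \<psi> = id_plane \<and>
    A * B = 1 \<and> B * A = 1"
  using assms
proof induction
  case one
  show ?case using rep_graph.one[of n m] by force
next
  case (step \<phi> A v f)
  then obtain \<psi> B where B: "rep_graph n m \<psi> B" "comp_plane \<psi> \<phi> = id_plane"
    "comp_plane \<phi> \<psi> = id_plane" "A * B = 1" "B * A = 1" by blast
  let ?s = "shear v (- f) id_plane" and ?E = "exp_op m v f" and ?E' = "exp_op m v (- f)"
  have E: "?E * ?E' = 1" "?E' * ?E = 1"
    using exp_op_inverse[OF vec_op_axis_nilpotent[OF step.hyps(2)]] by blast+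
  have "rep_graph n m ?s (?E' * 1)"
    using step.hyps by (intro rep_graph.intros) simp_all
  then have 1: "rep_graph n m (comp_plane \<psi> ?s) (B * ?E')"
    using rep_graph_mult[OF B(1)] by simp
  have "comp_plane (comp_plane \<psi> ?s) (shear v f \<phi>) = comp_plane \<psi> (shear v (- f) (shear v f \<phi>))"
    by (simp only: comp_plane_assoc shear_conv_comp[symmetric])
  then have 2: "comp_plane (comp_plane \<psi> ?s) (shear v f \<phi>) = id_plane"
    by (simp add: shear_add[symmetric] B)
  have "comp_plane (shear v f \<phi>) (comp_plane \<psi> ?s) = shear v f (comp_plane (comp_plane \<phi> \<psi>) ?s)"
    by (simp only: shear_comp comp_plane_assoc)
  then have 3: "comp_plane (shear v f \<phi>) (comp_plane \<psi> ?s) = id_plane"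
    by (simp add: B shear_add[symmetric])
  have "?E * A * (B * ?E') = ?E * (A * B) * ?E'" by (simp only: mult.assoc)
  then have 4: "?E * A * (B * ?E') = 1" using B E by simp
  have "B * ?E' * (?E * A) = B * (?E' * ?E) * A" by (simp only: mult.assoc)
  then have 5: "B * ?E' * (?E * A) = 1" using B E by simp
  show ?case using 1 2 3 4 5 by blast
qed

lemma rep_graph_stabilizes:
  "rep_graph n m \<phi> A \<Longrightarrow> m > 0 \<Longrightarrow> stabilizes A (supported (2 * m))"
  by (induction rule: rep_graph.induct) (simp_all add: stabilizes_mult exp_op_stabilizes_supported)

lemma rep_graph_det:
  "rep_graph n m \<phi> A \<Longrightarrow> m > 0 \<Longrightarrow> det (op_mat (\<lambda>i. i) (Suc (2 * m)) A) = 1"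
proof (induction rule: rep_graph.induct)
  case one
  then show ?case by (simp add: op_mat_one)
next
  case (step \<phi> A v f)
  have "stabilizes A (seq_span (\<lambda>i. i) (Suc (2 * m)))"
    using rep_graph_stabilizes[OF step.hyps(1) step.prems] by (simp add: supported_eq_span)
  then have "det (op_mat (\<lambda>i. i) (Suc (2 * m)) (exp_op m v f * A)) =
      det (op_mat (\<lambda>i. i) (Suc (2 * m)) (exp_op m v f)) * det (op_mat (\<lambda>i. i) (Suc (2 * m)) A)"
    by (intro det_op_mat_mult) simp_all
  then show ?case using step det_exp_op_full by simp
qed

section \<open>Reduced normal forms in the plane and among operators\<close>

lemma vshear_inverse: "vshear v (- a) (vshear v a x) = x"
  by (simp add: vshear_def vpair_def algebra_simps)

lemma vshear_eq_0_iff: "vshear v a u = (0, 0) \<longleftrightarrow> u = (0, 0)"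
proof -
  have "vshear v b (0, 0) = (0, 0)" for b by (simp add: vshear_def vpair_def)
  then show ?thesis by (metis vshear_inverse)
qed

text \<open>The same change of vectors serves both coordinates of the correspondence, and since
  transvections preserve \<open>vpair\<close> it keeps words reduced.\<close>

lemma word_linear_conj:
  fixes ws :: "(('a::field_char_0 \<times> 'a) \<times> 'a poly) list" and a :: 'a
  assumes v: "v \<in> axes" and "m > 0"
  defines "ws' \<equiv> map (\<lambda>(u, h). (vshear v a u, h)) ws"
  shows "shear v (monom a 1) (plane_word ws \<chi>) = plane_word ws' (shear v (monom a 1) \<chi>)"
    "exp_op m v (monom a 1) * op_word m ws = op_word m ws' * exp_op m v (monom a 1)"
    "reduced ws \<Longrightarrow> reduced ws'"
  unfolding ws'_def
proof (induction ws)
  case (Cons x ws)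
  obtain u h where x: "x = (u, h)" by (cases x)
  {
    case 1
    show ?case by (simp only: x list.map prod.case plane_word_simps shear_conj Cons.IH(1))
  next
    case 2
    let ?E = "exp_op m v (monom a 1)"
    have "?E * exp_op m u h = exp_op m (vshear v a u) h * ?E"
      by (rule exp_op_conj[OF exp_op_linear_conj[OF v \<open>m > 0\<close>]])
    then show ?case
      using Cons.IH(2) by (simp only: x list.map prod.case op_word_simps mult.assoc[symmetric])
        (simp only: mult.assoc)
  next
    case 3
    then show ?case
      using Cons.IH(3) by (cases ws) (auto simp: x vshear_eq_0_iff vpair_vshear)
  }
qed simp_all

lemma vpair_eq_0_imp_scale:
  assumes "vpair u v = 0" "u \<noteq> (0, 0)" "v \<noteq> (0, 0)"
  shows "\<exists>c. c \<noteq> (0 :: 'a::field) \<and> u = (c * fst v, c * snd v)"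
proof (cases "fst v = 0")
  case True
  then have "snd v \<noteq> 0" "fst u = 0" using assms by (cases v, auto simp: vpair_def)+
  then show ?thesis using assms(2) True by (intro exI[of _ "snd u / snd v"]) (cases u, simp)
next
  case False
  then have "snd u = fst u / fst v * snd v" using assms(1) by (simp add: vpair_def field_simps)
  moreover have "fst u \<noteq> 0"
  proof
    assume "fst u = 0"
    then show False using calculation assms(2) by (cases u) simp
  qed
  ultimately show ?thesis using False by (intro exI[of _ "fst u / fst v"]) (cases u, simp)
qed

text \<open>A letter parallel to the head is merged with it; \<open>shear_scale\<close> and
  \<open>exp_op_scale\<close> yield the same polynomial \<open>k\<close> on both sides. If
  \<open>k = 0\<close> the two letters cancel, otherwise the merged vector is still independent of
  the one after it.\<close>

lemma word_cons:
  fixes ws :: "(('a::field_char_0 \<times> 'a) \<times> 'a poly) list"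
  assumes ws: "reduced ws" "\<forall>(u, h)\<in>set ws. degree h < n" and "m > 0"
    and f: "v \<noteq> (0, 0)" "coeff f 0 = 0" "coeff f 1 = 0" "degree f < n"
  shows "\<exists>ws'. reduced ws' \<and> (\<forall>(u, h)\<in>set ws'. degree h < n) \<and>
    (\<forall>\<chi>. plane_word ws' \<chi> = shear v f (plane_word ws \<chi>)) \<and>
    op_word m ws' = exp_op m v f * op_word m ws"
proof (cases "f = 0")
  case True
  then show ?thesis using ws by (intro exI[of _ ws]) simp
next
  case False
  show ?thesis
  proof (cases "ws \<noteq> [] \<longrightarrow> vpair (fst (hd ws)) v \<noteq> 0")
    case True
    then show ?thesis using ws f False by (intro exI[of _ "(v, f) # ws"]) auto
  next
    case parallel: False
    then obtain u h ws1 where ws_eq: "ws = (u, h) # ws1" by (cases ws) auto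
    have u: "u \<noteq> (0, 0)" "vpair u v = 0" using ws parallel by (auto simp: ws_eq)
    then obtain c where c: "c \<noteq> 0" "u = (c * fst v, c * snd v)"
      using vpair_eq_0_imp_scale f(1) by blast
    define k where "k = f + smult c (pcompose h [:0, c:])"
    have plane: "shear v f (plane_word ws \<chi>) = shear v k (plane_word ws1 \<chi>)" for \<chi>
      by (simp add: ws_eq c(2) shear_scale k_def shear_add)
    have op: "exp_op m v f * op_word m ws = exp_op m v k * op_word m ws1"
      by (simp add: ws_eq c(2) exp_op_scale k_def exp_op_add[OF vec_op_nilpotent'[OF \<open>m > 0\<close>]] mult.assoc)
    have "degree (smult c (pcompose h [:0, c:])) < n"
      using ws(2) c(1) by (simp add: ws_eq degree_pcompose)
    then have k: "coeff k 0 = 0" "coeff k 1 = 0" "degree k < n"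
      using f ws by (simp_all add: k_def ws_eq coeff_pcompose_linear poly_0_coeff_0
          degree_add_less)
    have "vpair (fst (hd ws1)) v \<noteq> 0" if "ws1 \<noteq> []"
    proof -
      have "vpair (fst (hd ws1)) u \<noteq> 0" using ws that by (simp add: ws_eq)
      then show ?thesis by (auto simp: c(2) vpair_def algebra_simps)
    qed
    then have "reduced ((v, k) # ws1)" if "k \<noteq> 0" using that k f ws by (simp add: ws_eq)
    then show ?thesis
      using plane op k ws
      by (cases "k = 0")
        (intro exI[of _ ws1], simp add: ws_eq, intro exI[of _ "(v, k) # ws1"], simp add: ws_eq)
  qed
qed

text \<open>The linear term of each new letter is pushed through the word by conjugation and
  absorbed into the SL(2) factor at its right end; the remainder, of order at least two, joins the
  word.\<close>

lemma rep_graph_word: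
  assumes "rep_graph n m \<phi> A" "m > 0" "n \<ge> 2"
  shows "\<exists>ws g A0. reduced ws \<and> (\<forall>(u, h)\<in>set ws. degree h < n) \<and> sl2_rep m g A0 \<and>
    \<phi> = plane_word ws (linear_map g) \<and> A = op_word m ws * A0"
  using assms(1)
proof induction
  case one
  show ?case
    by (intro exI[of _ "[]"] exI[of _ "((1, 0), (0, 1))"] exI[of _ 1])
      (simp add: sl2_rep.one linear_map_def)
next
  case (step \<phi> A v f)
  then obtain ws g A0 where ws: "reduced ws" "\<forall>(u, h)\<in>set ws. degree h < n" and
    A0: "sl2_rep m g A0" and \<phi>: "\<phi> = plane_word ws (linear_map g)" and A: "A = op_word m ws * A0"
    by blast
  define a where "a = coeff f 1"
  define f' where "f' = f - monom a 1"
  have f: "f = f' + monom a 1" by (simp add: f'_def)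
  have "degree (monom a 1) < n" using degree_monom_le[of a 1] assms(3) by simp
  then have f': "coeff f' 0 = 0" "coeff f' 1 = 0" "degree f' < n"
    using step.hyps(3,4) by (simp_all add: f'_def a_def degree_diff_less)
  have "v \<noteq> (0, 0)" using step.hyps(2) by (auto simp: axes_def)
  define ws1 where "ws1 = map (\<lambda>(u, h). (vshear v a u, h)) ws"
  note conj = word_linear_conj[OF step.hyps(2) assms(2), where ws = ws and a = a, folded ws1_def]
  have "\<forall>(u, h)\<in>set ws1. degree h < n" using ws(2) by (auto simp: ws1_def)
  then obtain ws' where ws': "reduced ws'" "\<forall>(u, h)\<in>set ws'. degree h < n"
    "\<And>\<chi>. plane_word ws' \<chi> = shear v f' (plane_word ws1 \<chi>)"
    "op_word m ws' = exp_op m v f' * op_word m ws1"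
    using word_cons[OF conj(3)[OF ws(1)] _ assms(2) \<open>v \<noteq> (0, 0)\<close> f'] by blast
  obtain u w where g: "g = (u, w)" by (cases g)
  have A1: "sl2_rep m (vshear v a u, vshear v a w) (exp_op m v (monom a 1) * A0)"
    using sl2_rep.step[OF A0[unfolded g] step.hyps(2)] .
  have "shear v f \<phi> = plane_word ws' (linear_map (vshear v a u, vshear v a w))"
    unfolding f shear_add \<phi> conj(1) ws'(3) g shear_linear_map ..
  moreover have "exp_op m v f * A = op_word m ws' * (exp_op m v (monom a 1) * A0)"
  proof -
    have "exp_op m v f * A = exp_op m v f' * (exp_op m v (monom a 1) * op_word m ws) * A0"
      unfolding A by (subst f) (simp only: exp_op_add[OF vec_op_axis_nilpotent[OF step.hyps(2)]] mult.assoc)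
    then show ?thesis by (simp only: conj(2) ws'(4) mult.assoc)
  qed
  ultimately show ?case using ws' A1 by blast
qed

lemma linear_map_eq_id_iff: "linear_map (u, w) = id_plane \<longleftrightarrow> u = (1, 0) \<and> w = (0, 1)"
  by (cases u; cases w) (auto simp: linear_map_def cst_def varX_def varY_def one_pCons)

text \<open>The kernel form of single-valuedness. Growth of degrees empties the word, the linear
  factor is then the identity matrix, and \<open>sl2_rep_one_trivial\<close> applies.\<close>

lemma rep_graph_id_imp_trivial:
  assumes "rep_graph n m id_plane A" "m > 0" "n \<ge> 2" and x: "x \<in> supported (2 * m)"
  shows "app A x = x"
proof -
  obtain ws g A0 where ws: "reduced ws" "sl2_rep m g A0" "id_plane = plane_word ws (linear_map g)"
    "A = op_word m ws * A0"
    using rep_graph_word[OF assms(1-3)] by blast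
  obtain u w where g: "g = (u, w)" by (cases g)
  have "ws = []"
    using plane_word_ne_id[OF ws(1) _ sl2_rep_det] ws(2,3) by (metis g)
  then have "g = ((1, 0), (0, 1))" "A = A0"
    using ws(3,4) linear_map_eq_id_iff[of u w] by (simp_all add: g)
  then show ?thesis using sl2_rep_one_trivial[OF _ assms(2) x] ws(2) by blast
qed

text \<open>The kernel form of injectivity. Growth in \<open>t\<close> empties the word; what
  remains conjugates \<open>vec_op m z\<close> into \<open>vec_op m (apply_cols g z)\<close>, and
  being trivial it forces \<open>g\<close> to fix every vector.\<close>

lemma rep_graph_trivial_imp_id:
  assumes "rep_graph n m \<phi> A" "m > 0" "n \<ge> 2" and dvd: "\<And>d. 0 < d \<Longrightarrow> d \<le> n \<Longrightarrow> d dvd 2 * m"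
    and triv: "\<And>x. x \<in> supported (2 * m) \<Longrightarrow> app A x = x"
  shows "\<phi> = id_plane"
proof -
  obtain ws g A0 where ws: "reduced ws" "\<forall>(u, h)\<in>set ws. degree h < n" "sl2_rep m g A0"
    "\<phi> = plane_word ws (linear_map g)" "A = op_word m ws * A0"
    using rep_graph_word[OF assms(1-3)] by blast
  \<comment> \<open>Degrees below \<open>n\<close> give \<open>Suc (degree f) \<le> n\<close>, so
    the divisors range over all of \<open>1, ..., n\<close>.\<close>
  have "\<forall>(v, f)\<in>set ws. Suc (degree f) dvd 2 * m" using ws(2) dvd by force
  then have "ws = []"
    using op_word_nontrivial[OF ws(1) _ assms(2) _ ws(3)] triv ws(5) by blast
  then have A: "A = A0" "\<phi> = linear_map g" using ws by simp_all
  have "apply_cols g z = z" for z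
  proof -
    have *: "app (vec_op m (apply_cols g z)) x = app (vec_op m z) x" if x: "x \<in> supported (2 * m)" for x
    proof -
      have "app (vec_op m z) x = app (A0 * vec_op m z) x"
        using triv stabilizesD[OF vec_op_stabilizes(1) x] by (simp add: A)
      also have "\<dots> = app (vec_op m (apply_cols g z)) (app A0 x)"
        by (simp add: sl2_rep_conj[OF ws(3) assms(2)])
      finally show ?thesis using triv[OF x] by (simp add: A)
    qed
    \<comment> \<open>Two entries determine the vector: those of \<open>vec_op m z\<close> from 0 to
      1 and from 1 to 0 are \<open>m * fst z\<close> and \<open>snd z\<close>.\<close>
    have "unit_seq 0 \<in> supported (2 * m)" "unit_seq 1 \<in> supported (2 * m)"
      using assms(2) by (auto simp: unit_seq_def supported_def)
    from fun_cong[OF *[OF this(1)], of 1] fun_cong[OF *[OF this(2)], of 0]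
    show ?thesis
      using assms(2) by (simp add: app_vec_op unit_seq_def up_coeff_def down_coeff_def prod_eq_iff)
  qed
  from this[of "(1, 0)"] this[of "(0, 1)"] have "g = ((1, 0), (0, 1))"
    by (simp add: apply_cols_def prod_eq_iff)
  then show ?thesis by (simp add: A linear_map_def)
qed

lemma rep_graph_unique:
  assumes "rep_graph n m \<phi> A" "rep_graph n m \<phi> A'" "m > 0" "n \<ge> 2" and x: "x \<in> supported (2 * m)"
  shows "app A x = app A' x"
proof -
  obtain \<psi> B where B: "rep_graph n m \<psi> B" "comp_plane \<psi> \<phi> = id_plane" "A * B = 1"
    using rep_graph_inverse[OF assms(1)] by blast
  have "rep_graph n m id_plane (B * A')" using rep_graph_mult[OF B(1) assms(2)] B(2) by simp
  then have "app (B * A') x = x" using assms(3,4) x by (rule rep_graph_id_imp_trivial)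
  then have "app A x = app (A * B) (app A' x)" by simp
  then show ?thesis by (simp add: B(3))
qed

lemma rep_graph_inj:
  assumes "rep_graph n m \<phi> A" "rep_graph n m \<phi>' A'" "m > 0" "n \<ge> 2"
    and dvd: "\<And>d. 0 < d \<Longrightarrow> d \<le> n \<Longrightarrow> d dvd 2 * m"
    and eq: "\<And>x. x \<in> supported (2 * m) \<Longrightarrow> app A x = app A' x"
  shows "\<phi> = \<phi>'"
proof -
  obtain \<psi> B where B: "rep_graph n m \<psi> B" "comp_plane \<phi> \<psi> = id_plane" "B * A = 1"
    using rep_graph_inverse[OF assms(1)] by blast
  have "app (B * A') x = x" if "x \<in> supported (2 * m)" for x
  proof -
    have "app (B * A') x = app (B * A) x" using eq[OF that] by simp
    then show ?thesis by (simp add: B(3))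
  qed
  then have "comp_plane \<psi> \<phi>' = id_plane"
    using rep_graph_trivial_imp_id[OF rep_graph_mult[OF B(1) assms(2)] assms(3,4) dvd] by blast
  then have "comp_plane (comp_plane \<phi> \<psi>) \<phi>' = \<phi>" by (simp add: comp_plane_assoc)
  then show ?thesis by (simp add: B(2))
qed

section \<open>From the correspondence to matrices over K(t)\<close>

lemma saut0_simps [simp]:
  "monoid.mult saut0 = comp_plane" "\<one>\<^bsub>saut0\<^esub> = id_plane"
  by (simp_all add: saut0_def fun_eq_iff comp_plane_def)

lemma saut0_less_simps [simp]:
  "monoid.mult (saut0_less n) = comp_plane" "carrier (saut0_less n) = generate saut0 {\<phi> \<in> carrier saut0. map_degree \<phi> < n}"
  by (simp_all add: saut0_less_def)

lemma rep_graph_exists_generator: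
  fixes \<phi> :: "'a::field_char_0 bipoly \<times> 'a bipoly"
  assumes "\<phi> \<in> carrier saut0" "map_degree \<phi> < n"
  shows "\<exists>A. rep_graph n m \<phi> A"
proof (rule jung_induct[where Q = "\<lambda>\<phi>. \<exists>A. rep_graph n m \<phi> A" and n = n])
  have "\<phi> \<in> Units end_plane"
    using assms(1) by (simp add: saut0_def aut_plane_def units_of_def)
  then obtain \<psi> where "\<psi> \<otimes>\<^bsub>end_plane\<^esub> \<phi> = \<one>\<^bsub>end_plane\<^esub>" unfolding Units_def by blast
  then show "\<exists>\<Gamma>. bisubst \<Gamma> \<phi> = varX" by auto
  show "tdeg (fst \<phi>) < n" "tdeg (snd \<phi>) < n"
    using assms(2) tdeg_le_total_degree[of "fst \<phi>"] tdeg_le_total_degree[of "snd \<phi>"]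
    by (simp_all add: map_degree_def)
next
  fix v :: "'a \<times> 'a" and c :: 'a and k and \<phi> :: "'a bipoly \<times> 'a bipoly"
  assume v: "v \<in> axes" and k: "k > 0" "k < n" and "\<exists>A. rep_graph n m \<phi> A"
  then obtain A where A: "rep_graph n m \<phi> A" by blast
  have "degree (monom c k) < n" "coeff (monom c k) 0 = 0"
    using degree_monom_le[of c k] k by simp_all
  then show "\<exists>A. rep_graph n m (shear v (monom c k) \<phi>) A"
    using rep_graph.step[OF A v] by blast
qed (use assms(1) rep_graph.one in \<open>auto simp: saut0_def\<close>)

lemma rep_graph_exists:
  assumes "\<phi> \<in> generate saut0 {\<phi> \<in> carrier saut0. map_degree \<phi> < n}"
  shows "\<exists>A. rep_graph n m \<phi> A"
  using assms
proof induction
  case one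
  then show ?case using rep_graph.one by auto
next
  case (incl h)
  then show ?case using rep_graph_exists_generator by blast
next
  case (inv h)
  then obtain A where "rep_graph n m h A" using rep_graph_exists_generator by blast
  then obtain \<psi> B where \<psi>: "rep_graph n m \<psi> B" "comp_plane h \<psi> = id_plane"
    using rep_graph_inverse by blast
  have "comp_plane (inv\<^bsub>saut0\<^esub> h) h = id_plane"
    using group.l_inv[OF group_saut0, of h] inv by simp
  then have "inv\<^bsub>saut0\<^esub> h = \<psi>"
    using \<psi>(2) by (metis comp_plane_assoc comp_plane_id)
  then show ?case using \<psi>(1) by blast
next
  case (eng h1 h2)
  then show ?case using rep_graph_mult by fastforce
qed

lemma Fract_hom: "comm_ring_hom (\<lambda>a::'a::idom. Fract a 1)"
  by unfold_locales (simp_all add: Zero_fract_def One_fract_def)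

lemma special_linear_simps:
  "monoid.mult (special_linear n :: 'a::comm_ring_1 mat monoid) = (*)"
  "monoid.mult (general_linear n :: 'a mat monoid) = (*)"
  "carrier (special_linear n) = {A :: 'a mat. A \<in> carrier (general_linear n) \<and> det A = 1}"
  "carrier (general_linear n) = {A :: 'a mat. A \<in> carrier_mat n n \<and>
     (\<exists>B\<in>carrier_mat n n. B * A = 1\<^sub>m n \<and> A * B = 1\<^sub>m n)}"
  by (auto simp: special_linear_def general_linear_def units_of_def ring_mat_simps Units_def)

lemma saut0_less_embedding:
  assumes "n \<ge> 3"
  shows "\<exists>h. h \<in> mon (saut0_less n :: ('k::field_char_0 bipoly \<times> 'k bipoly) monoid)
    (special_linear (1 + Lcm {1..n}) :: 'k poly fract mat monoid)"
proof -
  define m where "m = Lcm {1..n} div 2"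
  \<comment> \<open>As \<open>2 \<le> n\<close>, the lcm is even, so \<open>1 + Lcm {1..n}\<close>
    is the dimension \<open>2 * m + 1\<close>.\<close>
  have "2 dvd Lcm {1..n}" using assms by (intro dvd_Lcm) simp
  then have 2: "2 * m = Lcm {1..n}" by (simp add: m_def)
  have "Lcm {1..n} \<noteq> 0" by (subst Lcm_0_iff) auto
  then have m: "m > 0" using 2 by (metis gr0I mult_0_right)
  have n: "n \<ge> 2" using assms by simp
  have dvd: "d dvd 2 * m" if "0 < d" "d \<le> n" for d
    unfolding 2 using that by (intro dvd_Lcm) simp
  let ?N = "Suc (2 * m)" and ?\<iota> = "\<lambda>i::nat. i"
  let ?M = "op_mat ?\<iota> ?N :: 'k poly linop \<Rightarrow> 'k poly mat"
  have inj: "inj_on ?\<iota> {..<?N}" by simp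
  interpret F: comm_ring_hom "\<lambda>a::'k poly. Fract a 1" by (rule Fract_hom)
  let ?F = "map_mat (\<lambda>a::'k poly. Fract a 1)"
  \<comment> \<open>The choice is harmless: by \<open>rep_graph_unique\<close> all candidates agree
    on \<open>supported (2 * m)\<close>, hence have the same matrix.\<close>
  define rep :: "'k bipoly \<times> 'k bipoly \<Rightarrow> 'k poly linop" where
    "rep \<phi> = (SOME A. rep_graph n m \<phi> A)" for \<phi>
  define h where "h \<phi> = ?F (?M (rep \<phi>))" for \<phi>
  have rep: "rep_graph n m \<phi> (rep \<phi>)" if "\<phi> \<in> carrier (saut0_less n)" for \<phi>
    using someI_ex[OF rep_graph_exists[of \<phi> n m]] that by (simp add: rep_def)
  have unit: "unit_seq j \<in> (supported (2 * m) :: (nat \<Rightarrow> 'k poly) set)" if "j < ?N" for j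
    using that by (auto simp: unit_seq_def supported_def)
  have M_mult: "?M (S * A) = ?M S * ?M A" if "rep_graph n m \<phi> A" for S \<phi> A
    using rep_graph_stabilizes[OF that m] by (intro op_mat_mult[OF inj]) (simp add: supported_eq_span)
  have F_mult: "?F (?M S * ?M T) = ?F (?M S) * ?F (?M T)" for S T
    by (rule F.mat_hom_mult[of _ ?N ?N _ ?N]) simp_all
  have F_one: "?F (1\<^sub>m ?N) = 1\<^sub>m ?N" by (rule F.mat_hom_one)
  have h_mult: "h (comp_plane \<phi> \<psi>) = h \<phi> * h \<psi>"
    if "\<phi> \<in> carrier (saut0_less n)" "\<psi> \<in> carrier (saut0_less n)" for \<phi> \<psi>
  proof -
    have "comp_plane \<phi> \<psi> \<in> carrier (saut0_less n)"
      using monoid.m_closed[OF group.is_monoid[OF group_saut0_less] that] by simp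
    then have "app (rep (comp_plane \<phi> \<psi>)) x = app (rep \<phi> * rep \<psi>) x" if "x \<in> supported (2 * m)" for x
      using rep_graph_unique[OF rep rep_graph_mult[OF rep rep] m n that] \<open>\<phi> \<in> _\<close> \<open>\<psi> \<in> _\<close> by blast
    then have "?M (rep (comp_plane \<phi> \<psi>)) = ?M (rep \<phi> * rep \<psi>)"
      using unit by (intro eq_matI) (auto simp: op_mat_def)
    then show ?thesis by (simp add: h_def M_mult[OF rep[OF that(2)]] F_mult)
  qed
  have "h \<phi> \<in> carrier (special_linear ?N)" if \<phi>: "\<phi> \<in> carrier (saut0_less n)" for \<phi>
  proof -
    obtain \<psi> B where B: "rep_graph n m \<psi> B" "rep \<phi> * B = 1" "B * rep \<phi> = 1"
      using rep_graph_inverse[OF rep[OF \<phi>]] by blast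
    have "?M (rep \<phi>) * ?M B = 1\<^sub>m ?N" "?M B * ?M (rep \<phi>) = 1\<^sub>m ?N"
      by (simp_all add: M_mult[OF B(1), symmetric] M_mult[OF rep[OF \<phi>], symmetric] B(2,3)
          op_mat_one[OF inj])
    then have "h \<phi> * ?F (?M B) = 1\<^sub>m ?N" "?F (?M B) * h \<phi> = 1\<^sub>m ?N"
      by (simp_all only: h_def F_mult[symmetric] F_one)
    moreover have "det (h \<phi>) = 1"
      unfolding h_def F.hom_det rep_graph_det[OF rep[OF \<phi>] m] by (rule F.hom_one)
    moreover have "h \<phi> \<in> carrier_mat ?N ?N" "?F (?M B) \<in> carrier_mat ?N ?N" by (simp_all add: h_def)
    ultimately show ?thesis unfolding special_linear_simps by blast
  qed
  moreover have "inj_on h (carrier (saut0_less n))"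
  proof (rule inj_onI)
    fix \<phi> \<phi>' assume \<phi>: "\<phi> \<in> carrier (saut0_less n)" "\<phi>' \<in> carrier (saut0_less n)" and eq: "h \<phi> = h \<phi>'"
    have entry: "app (rep \<phi>) (unit_seq j) i = app (rep \<phi>') (unit_seq j) i" if "i < ?N" "j < ?N" for i j
    proof -
      have "h \<phi> $$ (i, j) = h \<phi>' $$ (i, j)" using eq by simp
      then show ?thesis using that by (simp add: h_def op_mat_def eq_fract)
    qed
    have "app (rep \<phi>) x i = app (rep \<phi>') x i" if x: "x \<in> supported (2 * m)" for x i
    proof (cases "i < ?N")
      case True
      note expand = app_seq_span[OF inj x[unfolded supported_eq_span]]
      show ?thesis unfolding expand using True entry by (intro sum.cong) auto
    next
      case False
      then show ?thesis
        using stabilizesD[OF rep_graph_stabilizes[OF rep[OF \<phi>(1)] m] x]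
          stabilizesD[OF rep_graph_stabilizes[OF rep[OF \<phi>(2)] m] x]
        by (simp add: supported_def)
    qed
    then show "\<phi> = \<phi>'"
      using rep_graph_inj[OF rep[OF \<phi>(1)] rep[OF \<phi>(2)] m n dvd] by blast
  qed
  moreover have "1 + Lcm {1..n} = ?N" using 2 by simp
  ultimately have "h \<in> mon (saut0_less n) (special_linear (1 + Lcm {1..n}))"
    unfolding mon_def hom_def using h_mult by (simp add: special_linear_simps(1))
  then show ?thesis by blast
qed

theorem theoremC2:
  shows "(\<forall>n\<ge>3. \<exists>h. h \<in> mon (saut0_less n :: ('k::field_char_0 bipoly \<times> 'k bipoly) monoid)
             (special_linear (1 + Lcm {1..n}) :: 'k poly fract mat monoid)) \<and>
         (\<forall>H. subgroup H (saut0 :: ('k bipoly \<times> 'k bipoly) monoid) \<longrightarrow>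
           (\<exists>S. finite S \<and> S \<subseteq> carrier saut0 \<and> H = generate saut0 S) \<longrightarrow>
           (\<exists>m\<ge>1. \<exists>h. h \<in> mon (saut0\<lparr>carrier := H\<rparr>)
             (general_linear m :: 'k poly fract mat monoid)))"
proof (intro conjI allI impI)
  fix n :: nat assume "n \<ge> 3"
  then show "\<exists>h. h \<in> mon (saut0_less n :: ('k bipoly \<times> 'k bipoly) monoid)
      (special_linear (1 + Lcm {1..n}) :: 'k poly fract mat monoid)"
    by (rule saut0_less_embedding)
next
  fix H :: "('k bipoly \<times> 'k bipoly) set"
  assume "\<exists>S. finite S \<and> S \<subseteq> carrier saut0 \<and> H = generate saut0 S"
  then obtain S where S: "finite S" "S \<subseteq> carrier saut0" "H = generate saut0 S" by blast
  \<comment> \<open>Strictly above the degrees of all generators, and at least 3 so that the first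
    part applies.\<close>
  define n where "n = max 3 (Suc (Max (insert 0 (map_degree ` S))))"
  have "map_degree \<phi> < n" if "\<phi> \<in> S" for \<phi>
  proof -
    have "map_degree \<phi> \<le> Max (insert 0 (map_degree ` S))" using that S(1) by (intro Max_ge) auto
    then show ?thesis unfolding n_def by linarith
  qed
  then have "S \<subseteq> {\<phi> \<in> carrier saut0. map_degree \<phi> < n}" using S(2) by blast
  then have sub: "H \<subseteq> carrier (saut0_less n)"
    unfolding S(3) saut0_less_simps by (rule group.mono_generate[OF group_saut0])
  obtain h where "h \<in> mon (saut0_less n :: ('k bipoly \<times> 'k bipoly) monoid)
      (special_linear (1 + Lcm {1..n}) :: 'k poly fract mat monoid)"
    using saut0_less_embedding[of n] by (auto simp: n_def)
  then have "h \<in> mon (saut0\<lparr>carrier := H\<rparr>) (general_linear (1 + Lcm {1..n}))"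
    using sub unfolding mon_def hom_def
    by (auto simp: special_linear_simps(1-3) Pi_iff subset_iff intro: inj_on_subset)
  then show "\<exists>m\<ge>1. \<exists>h. h \<in> mon (saut0\<lparr>carrier := H\<rparr>) (general_linear m :: 'k poly fract mat monoid)"
    by (intro exI[of _ "1 + Lcm {1..n}"]) auto
qed

end
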